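(* Let $(V,c)$ be a braided vector space over a field $K$ and let $(B,\gamma)$ be a $(V,c)$-bialgebra endowed with a linear map $b:P(B)\to V$ such that $$c_{\gamma(V)}(\gamma b\otimes\gamma(V))=(\gamma(V)\otimes\gamma b)\,c_{P(B),\gamma(V)},\qquad c_{\gamma(V)}(\gamma(V)\otimes\gamma b)=(\gamma b\otimes\gamma(V))\,c_{\gamma(V),P(B)}.$$ Then $$W=\frac{B}{\big([\mathrm{Id}-\gamma b][P(B)]\big)}$$ (the quotient of $B$ by the two-sided ideal generated by $(\mathrm{Id}-\gamma b)[P(B)]$) carries a unique $(V,c)$-bialgebra structure such that the canonical projection $\pi_W:B\to W$ is a morphism of $(V,c)$-bialgebras.
   Context: Fix a field $K$; all vector spaces, tensor products and maps are over $K$ ($K$-linear). An object also denotes its identity map. Braided vector space $(V,c)$: $c:V\otimes V\to V\otimes V$ linear with $(c\otimes V)(V\otimes c)(c\otimes V)=(V\otimes c)(c\otimes V)(V\otimes c)$; a morphism $f:(V,c_V)\to(W,c_W)$ is linear with $c_W(f\otimes f)=(f\otimes f)c_V$. Braided algebra $(A,m,u,c)$: an associative unital algebra and braided vector space with $c(m\otimes A)=(A\otimes m)(c\otimes A)(A\otimes c)$, $c(A\otimes m)=(m\otimes A)(A\otimes c)(c\otimes A)$, $c(u\otimes A)=A\otimes u$, $c(A\otimes u)=u\otimes A$. Braided coalgebra $(C,\Delta,\varepsilon,c)$: a coassociative counital coalgebra and braided vector space with $(\Delta\otimes C)c=(C\otimes c)(c\otimes C)(C\otimes\Delta)$, $(C\otimes\Delta)c=(c\otimes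 C)(C\otimes c)(\Delta\otimes C)$, $(\varepsilon\otimes C)c=C\otimes\varepsilon$, $(C\otimes\varepsilon)c=\varepsilon\otimes C$. Braided bialgebra $(B,m,u,\Delta,\varepsilon,c)$: a braided algebra and braided coalgebra with $\Delta m=(m\otimes m)(B\otimes c\otimes B)(\Delta\otimes\Delta)$, $\Delta(1)=1\otimes 1$, and $\varepsilon$ an algebra map. Morphisms of braided (bi)algebras are (bi)algebra maps that are morphisms of braided vector spaces. $P(B)=\{x\in B\mid \Delta(x)=x\otimes1+1\otimes x\}$. The braiding $c_B$ of $B$ satisfies $c_B(P(B)\otimes B)\subseteq B\otimes P(B)$ and $c_B(B\otimes P(B))\subseteq P(B)\otimes B$, so it restricts to a braiding $c_P$ on $P(B)$; $(P(B),c_P)$ is the infinitesimal part of $B$. A braided bialgebra map $f:B\to B'$ induces $P(f):P(B)\to P(B')$. A $(V,c)$-bialgebra is a pair $(B,\gamma)$ where $B$ is a braided bialgebra with infinitesimal part $(P,c_P)$, $\gamma:(V,c)\to(P,c_P)$ is a morphism of braided vector spaces, and $\gamma(V)$ generates $B$ as a $K$-algebra. A morphism $\pi:(B,\gamma)\to(B',\gamma')$ of $(V,c)$-bialgebras is a braided bialgebra map $\pi:B\to B'$ with $P(\pi)\gamma=\gamma'$. For a $(V,c)$-bialgebra $(B,\gamma)$ the braiding $c_B$ restricts to maps $c_{\gamma(V)}:\gamma(V)\otimes\gamma(V)\to\gamma(V)\otimes\gamma(V)$, $c_{P(B),\gamma(V)}:P(B)\otimes\gamma(V)\to\gamma(V)\otimes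 P(B)$ and $c_{\gamma(V),P(B)}:\gamma(V)\otimes P(B)\to P(B)\otimes\gamma(V)$. *)

theory Defs
  imports "HOL-Algebra.Module" "HOL-Algebra.QuotRing" "HOL-Algebra.Subrings"
begin

text \<open>
  Vector spaces are HOL-Algebra modules over a field. The record \<open>module\<close> extends \<open>ring\<close>, so the
  same record also carries the multiplication and unit of an associative algebra; for a space that
  is only a vector space these two fields play no role and are not constrained.
\<close>

definition lin_hom ::
  "('k, 'r) ring_scheme \<Rightarrow> ('k, 'a, 'm) module_scheme \<Rightarrow> ('k, 'b, 'n) module_scheme \<Rightarrow> ('a \<Rightarrow> 'b) set"
  where "lin_hom K M N =
    {f \<in> carrier M \<rightarrow> carrier N.
      (\<forall>x\<in>carrier M. \<forall>y\<in>carrier M. f (x \<oplus>\<^bsub>M\<^esub> y) = f x \<oplus>\<^bsub>N\<^esub> f y) \<and>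
      (\<forall>a\<in>carrier K. \<forall>x\<in>carrier M. f (a \<odot>\<^bsub>M\<^esub> x) = a \<odot>\<^bsub>N\<^esub> f x)}"

definition scalars :: "('k, 'r) ring_scheme \<Rightarrow> ('k, 'k) module"
  where "scalars K =
    \<lparr>carrier = carrier K, mult = mult K, one = one K, zero = zero K, add = add K,
     smult = mult K\<rparr>"

text \<open>
  Quotient by a submodule \<open>N\<close>; if \<open>M\<close> is an algebra and \<open>N\<close> a two-sided ideal, the \<open>mult\<close> and \<open>one\<close>
  fields make this the quotient algebra.
\<close>

definition quotient_module :: "('k, 'a, 'm) module_scheme \<Rightarrow> 'a set \<Rightarrow> ('k, 'a set) module"
  where "quotient_module M N =
    \<lparr>carrier = carrier (M Quot N), mult = mult (M Quot N), one = one (M Quot N),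
     zero = zero (M Quot N), add = add (M Quot N),
     smult = (\<lambda>a X. \<Union>x\<in>X. N +>\<^bsub>M\<^esub> (a \<odot>\<^bsub>M\<^esub> x))\<rparr>"

definition submodule_span ::
  "('k, 'r) ring_scheme \<Rightarrow> ('k, 'a, 'm) module_scheme \<Rightarrow> 'a set \<Rightarrow> 'a set"
  where "submodule_span K M S = \<Inter>{N. submodule N K M \<and> S \<subseteq> N}"

definition free_module :: "('k, 'r) ring_scheme \<Rightarrow> 's set \<Rightarrow> ('k, 's \<Rightarrow> 'k) module"
  where "free_module K S =
    \<lparr>carrier = {f. (\<forall>s\<in>S. f s \<in> carrier K) \<and> (\<forall>s. s \<notin> S \<longrightarrow> f s = \<zero>\<^bsub>K\<^esub>)
                  \<and> finite {s. f s \<noteq> \<zero>\<^bsub>K\<^esub>}},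
     mult = undefined, one = undefined,
     zero = (\<lambda>s. \<zero>\<^bsub>K\<^esub>), add = (\<lambda>f g s. f s \<oplus>\<^bsub>K\<^esub> g s),
     smult = (\<lambda>a f s. a \<otimes>\<^bsub>K\<^esub> f s)\<rparr>"

definition free_gen :: "('k, 'r) ring_scheme \<Rightarrow> 's \<Rightarrow> 's \<Rightarrow> 'k"
  where "free_gen K s = (\<lambda>t. if t = s then \<one>\<^bsub>K\<^esub> else \<zero>\<^bsub>K\<^esub>)"

definition bilinear_relations ::
  "('k, 'r) ring_scheme \<Rightarrow> ('k, 'a, 'm) module_scheme \<Rightarrow> ('k, 'b, 'n) module_scheme
    \<Rightarrow> ('a \<times> 'b \<Rightarrow> 'k) set"
  where "bilinear_relations K V W =
    (let F = free_module K (carrier V \<times> carrier W); e = (\<lambda>v w. free_gen K (v, w)) in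
      {e (v \<oplus>\<^bsub>V\<^esub> v') w \<ominus>\<^bsub>F\<^esub> (e v w \<oplus>\<^bsub>F\<^esub> e v' w) | v v' w.
         v \<in> carrier V \<and> v' \<in> carrier V \<and> w \<in> carrier W} \<union>
      {e v (w \<oplus>\<^bsub>W\<^esub> w') \<ominus>\<^bsub>F\<^esub> (e v w \<oplus>\<^bsub>F\<^esub> e v w') | v w w'.
         v \<in> carrier V \<and> w \<in> carrier W \<and> w' \<in> carrier W} \<union>
      {e (a \<odot>\<^bsub>V\<^esub> v) w \<ominus>\<^bsub>F\<^esub> (a \<odot>\<^bsub>F\<^esub> e v w) | a v w.
         a \<in> carrier K \<and> v \<in> carrier V \<and> w \<in> carrier W} \<union>
      {e v (a \<odot>\<^bsub>W\<^esub> w) \<ominus>\<^bsub>F\<^esub> (a \<odot>\<^bsub>F\<^esub> e v w) | a v w.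
         a \<in> carrier K \<and> v \<in> carrier V \<and> w \<in> carrier W})"

definition tensor_null ::
  "('k, 'r) ring_scheme \<Rightarrow> ('k, 'a, 'm) module_scheme \<Rightarrow> ('k, 'b, 'n) module_scheme
    \<Rightarrow> ('a \<times> 'b \<Rightarrow> 'k) set"
  where "tensor_null K V W =
    submodule_span K (free_module K (carrier V \<times> carrier W)) (bilinear_relations K V W)"

type_synonym ('k, 'a, 'b) tensor = "('a \<times> 'b \<Rightarrow> 'k) set"

definition tensor ::
  "('k, 'r) ring_scheme \<Rightarrow> ('k, 'a, 'm) module_scheme \<Rightarrow> ('k, 'b, 'n) module_scheme
    \<Rightarrow> ('k, ('k, 'a, 'b) tensor) module"
  where "tensor K V W =
    quotient_module (free_module K (carrier V \<times> carrier W)) (tensor_null K V W)"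

definition pure_tensor ::
  "('k, 'r) ring_scheme \<Rightarrow> ('k, 'a, 'm) module_scheme \<Rightarrow> ('k, 'b, 'n) module_scheme
    \<Rightarrow> 'a \<Rightarrow> 'b \<Rightarrow> ('k, 'a, 'b) tensor"
  where "pure_tensor K V W v w =
    tensor_null K V W +>\<^bsub>free_module K (carrier V \<times> carrier W)\<^esub> free_gen K (v, w)"

text \<open>The linear map on the tensor product induced by a bilinear map (universal property).\<close>

definition tensor_lift ::
  "('k, 'r) ring_scheme \<Rightarrow> ('k, 'a, 'm) module_scheme \<Rightarrow> ('k, 'b, 'n) module_scheme
    \<Rightarrow> ('k, 'c, 'o) module_scheme \<Rightarrow> ('a \<Rightarrow> 'b \<Rightarrow> 'c) \<Rightarrow> ('k, 'a, 'b) tensor \<Rightarrow> 'c"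
  where "tensor_lift K V W U \<beta> =
    (THE h. h \<in> lin_hom K (tensor K V W) U \<inter> extensional (carrier (tensor K V W)) \<and>
      (\<forall>v\<in>carrier V. \<forall>w\<in>carrier W. h (pure_tensor K V W v w) = \<beta> v w))"

definition tensor_map ::
  "('k, 'r) ring_scheme \<Rightarrow> ('k, 'a, 'm) module_scheme \<Rightarrow> ('k, 'b, 'n) module_scheme
    \<Rightarrow> ('k, 'c, 'o) module_scheme \<Rightarrow> ('k, 'd, 'p) module_scheme
    \<Rightarrow> ('a \<Rightarrow> 'c) \<Rightarrow> ('b \<Rightarrow> 'd) \<Rightarrow> ('k, 'a, 'b) tensor \<Rightarrow> ('k, 'c, 'd) tensor"
  where "tensor_map K V W V' W' f g =
    tensor_lift K V W (tensor K V' W') (\<lambda>v w. pure_tensor K V' W' (f v) (g w))"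

text \<open>
  Iterated tensor products are bracketed to the left unless stated otherwise; the associativity
  isomorphism from the left to the right bracketing, and its inverse, are written out.
\<close>

definition tensor_assoc ::
  "('k, 'r) ring_scheme \<Rightarrow> ('k, 'a, 'm) module_scheme \<Rightarrow> ('k, 'b, 'n) module_scheme
    \<Rightarrow> ('k, 'c, 'o) module_scheme
    \<Rightarrow> ('k, ('k, 'a, 'b) tensor, 'c) tensor \<Rightarrow> ('k, 'a, ('k, 'b, 'c) tensor) tensor"
  where "tensor_assoc K U V W =
    tensor_lift K (tensor K U V) W (tensor K U (tensor K V W))
      (\<lambda>t w. tensor_lift K U V (tensor K U (tensor K V W))
        (\<lambda>u v. pure_tensor K U (tensor K V W) u (pure_tensor K V W v w)) t)"

definition tensor_assoc_inv ::
  "('k, 'r) ring_scheme \<Rightarrow> ('k, 'a, 'm) module_scheme \<Rightarrow> ('k, 'b, 'n) module_scheme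
    \<Rightarrow> ('k, 'c, 'o) module_scheme
    \<Rightarrow> ('k, 'a, ('k, 'b, 'c) tensor) tensor \<Rightarrow> ('k, ('k, 'a, 'b) tensor, 'c) tensor"
  where "tensor_assoc_inv K U V W =
    inv_into (carrier (tensor K (tensor K U V) W)) (tensor_assoc K U V W)"

record ('k, 'a) braided_space = "('k, 'a) module" +
  braiding :: "('k, 'a, 'a) tensor \<Rightarrow> ('k, 'a, 'a) tensor"

record ('k, 'a) braided_bialg = "('k, 'a) braided_space" +
  comult :: "'a \<Rightarrow> ('k, 'a, 'a) tensor"
  counit :: "'a \<Rightarrow> 'k"

text \<open>\<open>braid_left\<close> and \<open>braid_right\<close> braid the first two, respectively the last two, of three factors.\<close>

definition braid_left ::
  "('k, 'r) ring_scheme \<Rightarrow> ('k, 'a, 'm) braided_space_scheme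
    \<Rightarrow> ('k, ('k, 'a, 'a) tensor, 'a) tensor \<Rightarrow> ('k, ('k, 'a, 'a) tensor, 'a) tensor"
  where "braid_left K V =
    tensor_map K (tensor K V V) V (tensor K V V) V (braiding V) (\<lambda>x. x)"

definition braid_right ::
  "('k, 'r) ring_scheme \<Rightarrow> ('k, 'a, 'm) braided_space_scheme
    \<Rightarrow> ('k, ('k, 'a, 'a) tensor, 'a) tensor \<Rightarrow> ('k, ('k, 'a, 'a) tensor, 'a) tensor"
  where "braid_right K V = (\<lambda>t. tensor_assoc_inv K V V V
    (tensor_map K V (tensor K V V) V (tensor K V V) (\<lambda>x. x) (braiding V) (tensor_assoc K V V V t)))"

locale braided_vector_space = field K + module K V
  for K :: "('k, 'r) ring_scheme" and V :: "('k, 'a, 'm) braided_space_scheme" +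
  assumes braiding_linear: "braiding V \<in> lin_hom K (tensor K V V) (tensor K V V)"
    and braid_equation: "t \<in> carrier (tensor K (tensor K V V) V) \<Longrightarrow>
      braid_left K V (braid_right K V (braid_left K V t)) =
      braid_right K V (braid_left K V (braid_right K V t))"

definition braided_hom ::
  "('k, 'r) ring_scheme \<Rightarrow> ('k, 'a, 'm) braided_space_scheme \<Rightarrow> ('k, 'b, 'n) braided_space_scheme
    \<Rightarrow> ('a \<Rightarrow> 'b) set"
  where "braided_hom K V W =
    {f \<in> lin_hom K V W. \<forall>t\<in>carrier (tensor K V V).
      braiding W (tensor_map K V V W W f f t) = tensor_map K V V W W f f (braiding V t)}"

definition mult_map ::
  "('k, 'r) ring_scheme \<Rightarrow> ('k, 'a, 'm) module_scheme \<Rightarrow> ('k, 'a, 'a) tensor \<Rightarrow> 'a"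
  where "mult_map K A = tensor_lift K A A A (\<lambda>x y. x \<otimes>\<^bsub>A\<^esub> y)"

text \<open>
  The unit map sends a scalar \<open>a\<close> to \<open>a \<odot> \<one>\<close>; after identifying the tensor product of the ground
  field and \<open>A\<close> with \<open>A\<close>, the two unit axioms become the equations below.
\<close>

locale braided_algebra = braided_vector_space K A + ring A
  for K :: "('k, 'r) ring_scheme" and A :: "('k, 'a, 'm) braided_space_scheme" +
  assumes smult_mult_left: "\<lbrakk>a \<in> carrier K; x \<in> carrier A; y \<in> carrier A\<rbrakk> \<Longrightarrow>
      (a \<odot>\<^bsub>A\<^esub> x) \<otimes>\<^bsub>A\<^esub> y = a \<odot>\<^bsub>A\<^esub> (x \<otimes>\<^bsub>A\<^esub> y)"
    and smult_mult_right: "\<lbrakk>a \<in> carrier K; x \<in> carrier A; y \<in> carrier A\<rbrakk> \<Longrightarrow>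
      x \<otimes>\<^bsub>A\<^esub> (a \<odot>\<^bsub>A\<^esub> y) = a \<odot>\<^bsub>A\<^esub> (x \<otimes>\<^bsub>A\<^esub> y)"
    and braiding_mult_left: "t \<in> carrier (tensor K (tensor K A A) A) \<Longrightarrow>
      braiding A (tensor_map K (tensor K A A) A A A (mult_map K A) (\<lambda>x. x) t) =
      tensor_map K A (tensor K A A) A A (\<lambda>x. x) (mult_map K A)
        (tensor_assoc K A A A (braid_left K A (braid_right K A t)))"
    and braiding_mult_right: "t \<in> carrier (tensor K (tensor K A A) A) \<Longrightarrow>
      braiding A (tensor_map K A (tensor K A A) A A (\<lambda>x. x) (mult_map K A) (tensor_assoc K A A A t)) =
      tensor_map K (tensor K A A) A A A (mult_map K A) (\<lambda>x. x)
        (braid_right K A (braid_left K A t))"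
    and braiding_unit_left: "x \<in> carrier A \<Longrightarrow>
      braiding A (pure_tensor K A A \<one>\<^bsub>A\<^esub> x) = pure_tensor K A A x \<one>\<^bsub>A\<^esub>"
    and braiding_unit_right: "x \<in> carrier A \<Longrightarrow>
      braiding A (pure_tensor K A A x \<one>\<^bsub>A\<^esub>) = pure_tensor K A A \<one>\<^bsub>A\<^esub> x"

text \<open>The counit applied to the first, respectively second, of two factors, with values in \<open>C\<close>.\<close>

definition counit_left ::
  "('k, 'r) ring_scheme \<Rightarrow> ('k, 'a, 'm) braided_bialg_scheme \<Rightarrow> ('k, 'a, 'a) tensor \<Rightarrow> 'a"
  where "counit_left K C = tensor_lift K C C C (\<lambda>x y. counit C x \<odot>\<^bsub>C\<^esub> y)"

definition counit_right ::
  "('k, 'r) ring_scheme \<Rightarrow> ('k, 'a, 'm) braided_bialg_scheme \<Rightarrow> ('k, 'a, 'a) tensor \<Rightarrow> 'a"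
  where "counit_right K C = tensor_lift K C C C (\<lambda>x y. counit C y \<odot>\<^bsub>C\<^esub> x)"

definition comult_left ::
  "('k, 'r) ring_scheme \<Rightarrow> ('k, 'a, 'm) braided_bialg_scheme
    \<Rightarrow> ('k, 'a, 'a) tensor \<Rightarrow> ('k, ('k, 'a, 'a) tensor, 'a) tensor"
  where "comult_left K C = tensor_map K C C (tensor K C C) C (comult C) (\<lambda>x. x)"

definition comult_right ::
  "('k, 'r) ring_scheme \<Rightarrow> ('k, 'a, 'm) braided_bialg_scheme
    \<Rightarrow> ('k, 'a, 'a) tensor \<Rightarrow> ('k, ('k, 'a, 'a) tensor, 'a) tensor"
  where "comult_right K C = (\<lambda>t. tensor_assoc_inv K C C C
    (tensor_map K C C C (tensor K C C) (\<lambda>x. x) (comult C) t))"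

locale braided_coalgebra = braided_vector_space K C
  for K :: "('k, 'r) ring_scheme" and C :: "('k, 'a, 'm) braided_bialg_scheme" +
  assumes comult_linear: "comult C \<in> lin_hom K C (tensor K C C)"
    and counit_linear: "counit C \<in> lin_hom K C (scalars K)"
    and coassociative: "x \<in> carrier C \<Longrightarrow>
      comult_left K C (comult C x) = comult_right K C (comult C x)"
    and counital_left: "x \<in> carrier C \<Longrightarrow> counit_left K C (comult C x) = x"
    and counital_right: "x \<in> carrier C \<Longrightarrow> counit_right K C (comult C x) = x"
    and comult_left_braiding: "t \<in> carrier (tensor K C C) \<Longrightarrow>
      comult_left K C (braiding C t) = braid_right K C (braid_left K C (comult_right K C t))"
    and comult_right_braiding: "t \<in> carrier (tensor K C C) \<Longrightarrow>
      comult_right K C (braiding C t) = braid_left K C (braid_right K C (comult_left K C t))"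
    and counit_left_braiding: "t \<in> carrier (tensor K C C) \<Longrightarrow>
      counit_left K C (braiding C t) = counit_right K C t"
    and counit_right_braiding: "t \<in> carrier (tensor K C C) \<Longrightarrow>
      counit_right K C (braiding C t) = counit_left K C t"

text \<open>
  \<open>braid_middle\<close> braids the two middle factors of the fourfold tensor product bracketed as
  (first, second), (third, fourth); it passes through the completely left-bracketed product.
\<close>

definition braid_middle ::
  "('k, 'r) ring_scheme \<Rightarrow> ('k, 'a, 'm) braided_space_scheme
    \<Rightarrow> ('k, ('k, 'a, 'a) tensor, ('k, 'a, 'a) tensor) tensor
    \<Rightarrow> ('k, ('k, 'a, 'a) tensor, ('k, 'a, 'a) tensor) tensor"
  where "braid_middle K B = (\<lambda>t.
    let BB = tensor K B B; BBB = tensor K BB B in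
      tensor_assoc K BB B B
        (tensor_map K BBB B BBB B (braid_right K B) (\<lambda>x. x) (tensor_assoc_inv K BB B B t)))"

locale braided_bialgebra = braided_algebra K B + braided_coalgebra K B
  for K :: "('k, 'r) ring_scheme" and B :: "('k, 'a, 'm) braided_bialg_scheme" +
  assumes comult_mult: "t \<in> carrier (tensor K B B) \<Longrightarrow>
      comult B (mult_map K B t) =
      tensor_map K (tensor K B B) (tensor K B B) B B (mult_map K B) (mult_map K B)
        (braid_middle K B
          (tensor_map K B B (tensor K B B) (tensor K B B) (comult B) (comult B) t))"
    and comult_one: "comult B \<one>\<^bsub>B\<^esub> = pure_tensor K B B \<one>\<^bsub>B\<^esub> \<one>\<^bsub>B\<^esub>"
    and counit_algebra_map: "counit B \<in> ring_hom B K"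

definition braided_bialgebra_hom ::
  "('k, 'r) ring_scheme \<Rightarrow> ('k, 'a, 'm) braided_bialg_scheme \<Rightarrow> ('k, 'b, 'n) braided_bialg_scheme
    \<Rightarrow> ('a \<Rightarrow> 'b) set"
  where "braided_bialgebra_hom K B B' =
    {f \<in> braided_hom K B B' \<inter> ring_hom B B'. \<forall>x\<in>carrier B.
      comult B' (f x) = tensor_map K B B B' B' f f (comult B x) \<and> counit B' (f x) = counit B x}"

definition primitives :: "('k, 'r) ring_scheme \<Rightarrow> ('k, 'a, 'm) braided_bialg_scheme \<Rightarrow> 'a set"
  where "primitives K B = {x \<in> carrier B.
    comult B x = pure_tensor K B B x \<one>\<^bsub>B\<^esub> \<oplus>\<^bsub>tensor K B B\<^esub> pure_tensor K B B \<one>\<^bsub>B\<^esub> x}"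

text \<open>
  For subspaces \<open>X\<close> and \<open>Y\<close>, the restriction of the braiding to a map from the tensor product of \<open>X\<close>
  and \<open>Y\<close> to that of \<open>Y\<close> and \<open>X\<close>. The tensor product of two subspaces is not literally a subset of
  the ambient one; it is embedded by the tensor product of the inclusions, which is injective over
  a field.
\<close>

definition braiding_on ::
  "('k, 'r) ring_scheme \<Rightarrow> ('k, 'a, 'm) braided_space_scheme \<Rightarrow> 'a set \<Rightarrow> 'a set
    \<Rightarrow> ('k, 'a, 'a) tensor \<Rightarrow> ('k, 'a, 'a) tensor"
  where "braiding_on K B X Y = (\<lambda>t.
    let BX = B\<lparr>carrier := X\<rparr>; BY = B\<lparr>carrier := Y\<rparr> in
      inv_into (carrier (tensor K BY BX)) (tensor_map K BY BX B B (\<lambda>x. x) (\<lambda>x. x))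
        (braiding B (tensor_map K BX BY B B (\<lambda>x. x) (\<lambda>x. x) t)))"

definition infinitesimal_part ::
  "('k, 'r) ring_scheme \<Rightarrow> ('k, 'a, 'm) braided_bialg_scheme \<Rightarrow> ('k, 'a, 'm) braided_bialg_scheme"
  where "infinitesimal_part K B =
    B\<lparr>carrier := primitives K B, braiding := braiding_on K B (primitives K B) (primitives K B)\<rparr>"

definition generated_subalgebra ::
  "('k, 'r) ring_scheme \<Rightarrow> ('k, 'a, 'm) module_scheme \<Rightarrow> 'a set \<Rightarrow> 'a set"
  where "generated_subalgebra K A S = \<Inter>{H. subring H A \<and> submodule H K A \<and> S \<subseteq> H}"

locale vc_bialgebra = V: braided_vector_space K V + B: braided_bialgebra K B
  for K :: "('k, 'r) ring_scheme" and V :: "('k, 'v, 'm) braided_space_scheme"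
    and B :: "('k, 'b, 'n) braided_bialg_scheme" and \<gamma> :: "'v \<Rightarrow> 'b" +
  assumes gamma_hom: "\<gamma> \<in> braided_hom K V (infinitesimal_part K B)"
    and gamma_generates: "generated_subalgebra K B (\<gamma> ` carrier V) = carrier B"

definition vc_bialgebra_hom ::
  "('k, 'r) ring_scheme \<Rightarrow> ('k, 'v, 'm) braided_space_scheme
    \<Rightarrow> ('k, 'a, 'n) braided_bialg_scheme \<Rightarrow> ('v \<Rightarrow> 'a)
    \<Rightarrow> ('k, 'b, 'o) braided_bialg_scheme \<Rightarrow> ('v \<Rightarrow> 'b) \<Rightarrow> ('a \<Rightarrow> 'b) set"
  where "vc_bialgebra_hom K V B \<gamma> B' \<gamma>' =
    {f \<in> braided_bialgebra_hom K B B'. \<forall>v\<in>carrier V. f (\<gamma> v) = \<gamma>' v}"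

definition same_vector_space ::
  "('k, 'a, 'm) module_scheme \<Rightarrow> ('k, 'a, 'n) module_scheme \<Rightarrow> bool"
  where "same_vector_space M N \<longleftrightarrow>
    carrier M = carrier N \<and> zero M = zero N \<and> add M = add N \<and> smult M = smult N"

text \<open>
  Equality of two (V,c)-bialgebra structures on the same vector space. HOL functions are total, so
  the structure maps are compared on their domains only.
\<close>

definition same_vc_structure ::
  "('k, 'r) ring_scheme \<Rightarrow> ('k, 'v, 'm) braided_space_scheme
    \<Rightarrow> ('k, 'b, 'n) braided_bialg_scheme \<Rightarrow> ('v \<Rightarrow> 'b)
    \<Rightarrow> ('k, 'b, 'o) braided_bialg_scheme \<Rightarrow> ('v \<Rightarrow> 'b) \<Rightarrow> bool"
  where "same_vc_structure K V S \<delta> S' \<delta>' \<longleftrightarrow>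
    (\<forall>x\<in>carrier S. \<forall>y\<in>carrier S. x \<otimes>\<^bsub>S\<^esub> y = x \<otimes>\<^bsub>S'\<^esub> y) \<and> \<one>\<^bsub>S\<^esub> = \<one>\<^bsub>S'\<^esub> \<and>
    (\<forall>x\<in>carrier S. comult S x = comult S' x \<and> counit S x = counit S' x) \<and>
    (\<forall>t\<in>carrier (tensor K S S). braiding S t = braiding S' t) \<and>
    (\<forall>v\<in>carrier V. \<delta> v = \<delta>' v)"

end

theory Submission
  imports Defs
begin

text \<open>
  The comultiplication, the counit and the braiding of \<open>B\<close> descend to \<open>W = B/I\<close>. Put \<open>P = P(B)\<close>,
  \<open>G = \<gamma>(V)\<close> and \<open>D = (Id - \<gamma> b)[P]\<close>, so that \<open>I\<close> is the ideal generated by \<open>D\<close>. Because primitives form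
  an equalizer and \<open>G\<close> generates \<open>B\<close>, the braiding \<open>c\<close> exchanges \<open>P\<close> and \<open>G\<close>; by the conditions on \<open>b\<close>
  it then sends \<open>D \<otimes> G\<close> into \<open>B \<otimes> D\<close>. The elements past which \<open>D\<close> can be moved form a subalgebra containing
  \<open>G\<close>, hence all of \<open>B\<close>, and the elements that \<open>c\<close> moves into \<open>I\<close> form an ideal, so
  \<open>c(I \<otimes> B) \<subseteq> B \<otimes> I\<close>, and symmetrically. Thus \<open>c\<close> descends; the elements of \<open>D\<close> are primitive, so \<open>I\<close>
  is a coideal as well. All axioms, and uniqueness, follow from the surjectivity of \<open>\<pi>\<close> and of its
  tensor powers.
\<close>

section \<open>Linear maps, quotients and free modules\<close>

text \<open>The exchange of primitives and generators is controlled from two sides: the coalgebra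
  axioms put c(P \<otimes> B) into B \<otimes> P, the algebra axioms and generation put c(B
  \<otimes> G) into G \<otimes> B, and each inclusion confines only one factor. Two facts about
  vector spaces join them: tensoring keeps equalizers, and an element of both X \<otimes> N and M
  \<otimes> Y lies in X \<otimes> Y. Both come from linear projections, hence from complements of
  subspaces, and this is where the field is used. The conditions on \<open>b\<close> become usable
  only after this step, because they speak of restricted braidings, which are chosen preimages under
  an embedding and mean something only once the braiding is known to land in its image. A second
  obstacle is that the comultiplication is multiplicative for the braided product, which itself
  involves c. So the quotient has to be a braided algebra before the kernel of (\<pi> \<otimes>
  \<pi>) \<Delta> can be seen to be an ideal; this is why the transport of structure has an algebra
  stage and a separate coalgebra stage.\<close>

lemma minus_eq_zeroD:
  assumes "abelian_group M" "x \<ominus>\<^bsub>M\<^esub> y = \<zero>\<^bsub>M\<^esub>" "x \<in> carrier M" "y \<in> carrier M"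
  shows "x = y"
proof -
  interpret abelian_group M by fact
  show ?thesis using assms(2-4) by (metis a_minus_def minus_equality minus_minus a_inv_closed a_comm)
qed

lemma lin_homI:
  assumes "\<And>x. x \<in> carrier M \<Longrightarrow> f x \<in> carrier N"
    and "\<And>x y. x \<in> carrier M \<Longrightarrow> y \<in> carrier M \<Longrightarrow> f (x \<oplus>\<^bsub>M\<^esub> y) = f x \<oplus>\<^bsub>N\<^esub> f y"
    and "\<And>a x. a \<in> carrier K \<Longrightarrow> x \<in> carrier M \<Longrightarrow> f (a \<odot>\<^bsub>M\<^esub> x) = a \<odot>\<^bsub>N\<^esub> f x"
  shows "f \<in> lin_hom K M N"
  using assms unfolding lin_hom_def by auto

lemma lin_hom_closed: "f \<in> lin_hom K M N \<Longrightarrow> x \<in> carrier M \<Longrightarrow> f x \<in> carrier N"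
  unfolding lin_hom_def by auto

lemma lin_hom_add:
  "f \<in> lin_hom K M N \<Longrightarrow> x \<in> carrier M \<Longrightarrow> y \<in> carrier M \<Longrightarrow> f (x \<oplus>\<^bsub>M\<^esub> y) = f x \<oplus>\<^bsub>N\<^esub> f y"
  unfolding lin_hom_def by auto

lemma lin_hom_smult:
  "f \<in> lin_hom K M N \<Longrightarrow> a \<in> carrier K \<Longrightarrow> x \<in> carrier M \<Longrightarrow> f (a \<odot>\<^bsub>M\<^esub> x) = a \<odot>\<^bsub>N\<^esub> f x"
  unfolding lin_hom_def by auto

lemma lin_hom_comp:
  assumes "f \<in> lin_hom K L M" "g \<in> lin_hom K M N"
  shows "(\<lambda>x. g (f x)) \<in> lin_hom K L N"
  by (rule lin_homI)
    (simp_all add: lin_hom_closed[OF assms(1)] lin_hom_closed[OF assms(2)]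
      lin_hom_add[OF assms(1)] lin_hom_add[OF assms(2)]
      lin_hom_smult[OF assms(1)] lin_hom_smult[OF assms(2)])

lemma lin_hom_id: "(\<lambda>x. x) \<in> lin_hom K M M"
  by (rule lin_homI) auto

text \<open>Linearity concerns only values on the carrier; the module hypothesis supplies closure,
  so that \<open>g\<close> and \<open>f\<close> can be compared at sums and scalar multiples as
  well.\<close>

lemma lin_hom_cong:
  assumes "module K M" "f \<in> lin_hom K M N" "\<And>x. x \<in> carrier M \<Longrightarrow> g x = f x"
  shows "g \<in> lin_hom K M N"
proof -
  interpret module K M by fact
  show ?thesis
    using assms(2) by (intro lin_homI) (simp_all add: assms(3) lin_hom_closed lin_hom_add lin_hom_smult)
qed

lemma lin_hom_zero:
  assumes "module K M" "module K N" "f \<in> lin_hom K M N"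
  shows "f \<zero>\<^bsub>M\<^esub> = \<zero>\<^bsub>N\<^esub>"
proof -
  interpret M: module K M by fact
  interpret N: module K N by fact
  have "f (\<zero>\<^bsub>K\<^esub> \<odot>\<^bsub>M\<^esub> \<zero>\<^bsub>M\<^esub>) = \<zero>\<^bsub>K\<^esub> \<odot>\<^bsub>N\<^esub> f \<zero>\<^bsub>M\<^esub>"
    using assms(3) by (intro lin_hom_smult) auto
  then show ?thesis
    using lin_hom_closed[OF assms(3) M.zero_closed] by simp
qed

lemma lin_hom_neg:
  assumes "module K M" "module K N" "f \<in> lin_hom K M N" "x \<in> carrier M"
  shows "f (\<ominus>\<^bsub>M\<^esub> x) = \<ominus>\<^bsub>N\<^esub> f x"
proof -
  interpret M: module K M by fact
  interpret N: module K N by fact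
  have fx: "f x \<in> carrier N" using assms by (auto intro: lin_hom_closed)
  have "f (\<ominus>\<^bsub>M\<^esub> x) = f ((\<ominus>\<^bsub>K\<^esub> \<one>\<^bsub>K\<^esub>) \<odot>\<^bsub>M\<^esub> x)"
    using assms(4) by (simp add: M.smult_l_minus)
  also have "\<dots> = (\<ominus>\<^bsub>K\<^esub> \<one>\<^bsub>K\<^esub>) \<odot>\<^bsub>N\<^esub> f x"
    using assms by (intro lin_hom_smult) auto
  finally show ?thesis using fx by (simp add: N.smult_l_minus)
qed

lemma lin_hom_minus:
  assumes "module K M" "module K N" "f \<in> lin_hom K M N" "x \<in> carrier M" "y \<in> carrier M"
  shows "f (x \<ominus>\<^bsub>M\<^esub> y) = f x \<ominus>\<^bsub>N\<^esub> f y"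
proof -
  interpret M: module K M by fact
  interpret N: module K N by fact
  show ?thesis
    using assms(4,5) by (simp add: a_minus_def lin_hom_add[OF assms(3)] lin_hom_neg[OF assms(1-3)])
qed

lemma lin_hom_plus:
  assumes "module K M" "module K N" "f \<in> lin_hom K M N" "g \<in> lin_hom K M N"
  shows "(\<lambda>x. f x \<oplus>\<^bsub>N\<^esub> g x) \<in> lin_hom K M N"
proof -
  interpret M: module K M by fact
  interpret N: module K N by fact
  show ?thesis
    by (rule lin_homI)
      (auto simp: lin_hom_closed[OF assms(3)] lin_hom_closed[OF assms(4)]
        lin_hom_add[OF assms(3)] lin_hom_add[OF assms(4)] N.smult_r_distr
        lin_hom_smult[OF assms(3)] lin_hom_smult[OF assms(4)] N.a_ac)
qed

lemma lin_hom_diff: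
  assumes "module K M" "module K N" "f \<in> lin_hom K M N" "g \<in> lin_hom K M N"
  shows "(\<lambda>x. f x \<ominus>\<^bsub>N\<^esub> g x) \<in> lin_hom K M N"
proof -
  interpret M: module K M by fact
  interpret N: module K N by fact
  show ?thesis
    by (rule lin_homI)
      (auto simp: lin_hom_closed[OF assms(3)] lin_hom_closed[OF assms(4)] a_minus_def N.minus_add
        lin_hom_add[OF assms(3)] lin_hom_add[OF assms(4)] N.smult_r_distr N.smult_r_minus
        lin_hom_smult[OF assms(3)] lin_hom_smult[OF assms(4)] N.a_ac)
qed

section \<open>Subspaces cut out by linear maps, and spans\<close>

lemma submodule_kernel:
  assumes "module K M" "module K N" "f \<in> lin_hom K M N"
  shows "submodule {x \<in> carrier M. f x = \<zero>\<^bsub>N\<^esub>} K M"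
proof -
  interpret M: module K M by fact
  interpret N: module K N by fact
  show ?thesis
    by (rule M.submoduleI)
      (auto simp: lin_hom_add[OF assms(3)] lin_hom_smult[OF assms(3)] lin_hom_zero[OF assms]
        lin_hom_neg[OF assms])
qed

text \<open>Stated for two maps and not for a difference, since the condition that defines
  \<open>primitives\<close> equates two linear maps.\<close>

lemma submodule_equalizer:
  assumes "module K M" "module K N" "f \<in> lin_hom K M N" "g \<in> lin_hom K M N"
  shows "submodule {x \<in> carrier M. f x = g x} K M"
proof -
  interpret M: module K M by fact
  interpret N: module K N by fact
  show ?thesis
    by (rule M.submoduleI)
      (auto simp: lin_hom_add[OF assms(3)] lin_hom_smult[OF assms(3)] lin_hom_zero[OF assms(1-3)]
        lin_hom_neg[OF assms(1-3)] lin_hom_add[OF assms(4)] lin_hom_smult[OF assms(4)]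
        lin_hom_zero[OF assms(1,2,4)] lin_hom_neg[OF assms(1,2,4)])
qed

lemma submodule_preimage:
  assumes "module K M" "module K N" "f \<in> lin_hom K M N" "submodule H K N"
  shows "submodule {x \<in> carrier M. f x \<in> H} K M"
proof -
  interpret M: module K M by fact
  interpret N: module K N by fact
  interpret H: submodule H K N by fact
  have "\<zero>\<^bsub>N\<^esub> \<in> H" using H.one_closed by simp
  then show ?thesis
    using N.submoduleE[OF assms(4)]
    by (intro M.submoduleI)
      (auto simp: lin_hom_add[OF assms(3)] lin_hom_smult[OF assms(3)] lin_hom_zero[OF assms(1-3)]
        lin_hom_neg[OF assms(1-3)])
qed

lemma submodule_image:
  assumes "module K M" "module K N" "f \<in> lin_hom K M N"
  shows "submodule (f ` carrier M) K N"
proof -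
  interpret M: module K M by fact
  interpret N: module K N by fact
  show ?thesis
  proof (rule N.submoduleI)
    show "f ` carrier M \<subseteq> carrier N" using lin_hom_closed[OF assms(3)] by auto
    show "\<zero>\<^bsub>N\<^esub> \<in> f ` carrier M"
      using lin_hom_zero[OF assms] M.zero_closed by (intro image_eqI[of _ f "\<zero>\<^bsub>M\<^esub>"]) simp_all
    show "\<ominus>\<^bsub>N\<^esub> y \<in> f ` carrier M" if "y \<in> f ` carrier M" for y
      using that by (auto simp: lin_hom_neg[OF assms, symmetric])
    show "y \<oplus>\<^bsub>N\<^esub> z \<in> f ` carrier M" if "y \<in> f ` carrier M" "z \<in> f ` carrier M" for y z
      using that by (auto simp: lin_hom_add[OF assms(3), symmetric])
    show "a \<odot>\<^bsub>N\<^esub> y \<in> f ` carrier M" if "a \<in> carrier K" "y \<in> f ` carrier M" for a y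
      using that by (auto simp: lin_hom_smult[OF assms(3), symmetric])
  qed
qed

lemma submodule_zeroD: "submodule H K M \<Longrightarrow> \<zero>\<^bsub>M\<^esub> \<in> H"
  using subgroup.one_closed[of H "add_monoid M"] by (simp add: submodule_def)

lemma submodule_Inter:
  assumes "module K M" "\<And>N. N \<in> A \<Longrightarrow> submodule N K M" "A \<noteq> {}"
  shows "submodule (\<Inter>A) K M"
proof -
  interpret module K M by fact
  show ?thesis
  proof (rule submoduleI)
    show "\<Inter>A \<subseteq> carrier M" using assms(2,3) submoduleE(1) by blast
    show "\<zero>\<^bsub>M\<^esub> \<in> \<Inter>A" using assms(2) submodule_zeroD by blast
    show "\<ominus>\<^bsub>M\<^esub> a \<in> \<Inter>A" if "a \<in> \<Inter>A" for a
      using that assms(2) submoduleE(3) by blast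
    show "a \<oplus>\<^bsub>M\<^esub> b \<in> \<Inter>A" if "a \<in> \<Inter>A" "b \<in> \<Inter>A" for a b
      using that assms(2) submoduleE(5) by blast
    show "a \<odot>\<^bsub>M\<^esub> b \<in> \<Inter>A" if "a \<in> carrier K" "b \<in> \<Inter>A" for a b
      using that assms(2) submoduleE(4) by blast
  qed
qed

lemma submodule_span_submodule:
  assumes "module K M" "S \<subseteq> carrier M"
  shows "submodule (submodule_span K M S) K M"
  unfolding submodule_span_def
  using assms module.carrier_is_submodule by (intro submodule_Inter) auto

lemma submodule_span_incl: "S \<subseteq> submodule_span K M S"
  unfolding submodule_span_def by auto

lemma submodule_span_least: "submodule N K M \<Longrightarrow> S \<subseteq> N \<Longrightarrow> submodule_span K M S \<subseteq> N"
  unfolding submodule_span_def by auto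

section \<open>Quotient spaces\<close>

lemma submodule_abelian_subgroup:
  assumes "module K M" "submodule N K M"
  shows "abelian_subgroup N M"
proof -
  interpret M: module K M by fact
  show ?thesis
    by (rule abelian_subgroupI3)
      (auto intro: additive_subgroupI submodule.axioms(1)[OF assms(2)] M.abelian_group_axioms)
qed

text \<open>As rewrite rules these expose operations on sets. Calculations with representatives have
  to delete them, so that \<open>quotient_module_add\<close> and
  \<open>quotient_module_smult\<close> still match.\<close>

lemma quotient_module_simps [simp]:
  "carrier (quotient_module M N) = a_rcosets\<^bsub>M\<^esub> N"
  "mult (quotient_module M N) = rcoset_mult M N"
  "one (quotient_module M N) = N +>\<^bsub>M\<^esub> \<one>\<^bsub>M\<^esub>"
  "zero (quotient_module M N) = N"
  "add (quotient_module M N) = set_add M"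
  by (simp_all add: quotient_module_def FactRing_def)

lemma quotient_module_carrierE:
  assumes "X \<in> carrier (quotient_module M N)"
  obtains x where "x \<in> carrier M" "X = N +>\<^bsub>M\<^esub> x"
  using assms by (auto simp: A_RCOSETS_def')

lemma quotient_module_add:
  assumes "module K M" "submodule N K M" "x \<in> carrier M" "y \<in> carrier M"
  shows "(N +>\<^bsub>M\<^esub> x) \<oplus>\<^bsub>quotient_module M N\<^esub> (N +>\<^bsub>M\<^esub> y) = N +>\<^bsub>M\<^esub> (x \<oplus>\<^bsub>M\<^esub> y)"
  using abelian_subgroup.a_rcos_sum[OF submodule_abelian_subgroup[OF assms(1,2)] assms(3,4)] by simp

lemma coset_eq_iff:
  assumes "module K M" "submodule N K M" "x \<in> carrier M" "y \<in> carrier M"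
  shows "N +>\<^bsub>M\<^esub> x = N +>\<^bsub>M\<^esub> y \<longleftrightarrow> x \<ominus>\<^bsub>M\<^esub> y \<in> N"
proof -
  interpret M: module K M by fact
  interpret N: abelian_subgroup N M by (rule submodule_abelian_subgroup) fact+
  have "N +>\<^bsub>M\<^esub> x = N +>\<^bsub>M\<^esub> y \<longleftrightarrow> x \<in> N +>\<^bsub>M\<^esub> y"
    using N.a_repr_independence' N.a_rcos_self assms(3,4) by metis
  then show ?thesis
    using N.a_rcos_module[OF assms(4,3)] by (simp add: a_minus_def)
qed

text \<open>The definition takes a union over all representatives. It collapses to one coset because
  representatives differ by an element of \<open>N\<close>, and \<open>N\<close> is closed under
  scalars.\<close>

lemma quotient_module_smult:
  assumes "module K M" "submodule N K M" "a \<in> carrier K" "x \<in> carrier M"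
  shows "a \<odot>\<^bsub>quotient_module M N\<^esub> (N +>\<^bsub>M\<^esub> x) = N +>\<^bsub>M\<^esub> (a \<odot>\<^bsub>M\<^esub> x)"
proof -
  interpret M: module K M by fact
  interpret N: abelian_subgroup N M by (rule submodule_abelian_subgroup) fact+
  have "N +>\<^bsub>M\<^esub> (a \<odot>\<^bsub>M\<^esub> y) = N +>\<^bsub>M\<^esub> (a \<odot>\<^bsub>M\<^esub> x)" if "y \<in> N +>\<^bsub>M\<^esub> x" for y
  proof -
    have y: "y \<in> carrier M" using that N.a_elemrcos_carrier[OF assms(4)] by simp
    have "y \<ominus>\<^bsub>M\<^esub> x \<in> N"
      using coset_eq_iff[OF assms(1,2) y assms(4)] N.a_repr_independence'[OF that assms(4)] by simp
    then have "a \<odot>\<^bsub>M\<^esub> (y \<ominus>\<^bsub>M\<^esub> x) \<in> N" using M.submoduleE(4)[OF assms(2,3)] by simp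
    then have "a \<odot>\<^bsub>M\<^esub> y \<ominus>\<^bsub>M\<^esub> a \<odot>\<^bsub>M\<^esub> x \<in> N"
      using assms y by (simp add: a_minus_def M.smult_r_distr M.smult_r_minus)
    then show ?thesis using coset_eq_iff[OF assms(1,2)] assms y by simp
  qed
  moreover have "x \<in> N +>\<^bsub>M\<^esub> x" by (rule N.a_rcos_self) fact
  ultimately have "(\<Union>y\<in>N +>\<^bsub>M\<^esub> x. N +>\<^bsub>M\<^esub> (a \<odot>\<^bsub>M\<^esub> y)) = N +>\<^bsub>M\<^esub> (a \<odot>\<^bsub>M\<^esub> x)" by blast
  then show ?thesis by (simp add: quotient_module_def)
qed

lemma coset_closed: "x \<in> carrier M \<Longrightarrow> N +>\<^bsub>M\<^esub> x \<in> carrier (quotient_module M N)"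
  by (auto simp: A_RCOSETS_def')

lemma quotient_module_is_module:
  assumes "module K M" "submodule N K M"
  shows "module K (quotient_module M N)"
proof -
  interpret M: module K M by fact
  interpret N: abelian_subgroup N M by (rule submodule_abelian_subgroup) fact+
  let ?Q = "quotient_module M N"
  note s = quotient_module_smult[OF assms] quotient_module_add[OF assms]
  have zero: "\<zero>\<^bsub>?Q\<^esub> = N +>\<^bsub>M\<^esub> \<zero>\<^bsub>M\<^esub>"
    using M.a_coset_add_zero[of N] N.a_subset by simp
  have ag: "abelian_group ?Q"
  proof (rule abelian_groupI)
    fix x y assume x: "x \<in> carrier ?Q" and y: "y \<in> carrier ?Q"
    obtain u where u: "u \<in> carrier M" "x = N +>\<^bsub>M\<^esub> u" using quotient_module_carrierE[OF x] .
    obtain v where v: "v \<in> carrier M" "y = N +>\<^bsub>M\<^esub> v" using quotient_module_carrierE[OF y] .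
    show "x \<oplus>\<^bsub>?Q\<^esub> y \<in> carrier ?Q"
      using u v coset_closed[of _ M N] s by (simp del: quotient_module_simps)
    show "x \<oplus>\<^bsub>?Q\<^esub> y = y \<oplus>\<^bsub>?Q\<^esub> x"
      using u v s M.a_comm by (simp del: quotient_module_simps)
    fix z assume z: "z \<in> carrier ?Q"
    obtain w where w: "w \<in> carrier M" "z = N +>\<^bsub>M\<^esub> w" using quotient_module_carrierE[OF z] .
    show "x \<oplus>\<^bsub>?Q\<^esub> y \<oplus>\<^bsub>?Q\<^esub> z = x \<oplus>\<^bsub>?Q\<^esub> (y \<oplus>\<^bsub>?Q\<^esub> z)"
      using u v w s M.a_assoc by (simp del: quotient_module_simps)
  next
    fix x assume x: "x \<in> carrier ?Q"
    obtain u where u: "u \<in> carrier M" "x = N +>\<^bsub>M\<^esub> u" using quotient_module_carrierE[OF x] .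
    show "\<zero>\<^bsub>?Q\<^esub> \<oplus>\<^bsub>?Q\<^esub> x = x"
      unfolding zero using u s by (simp del: quotient_module_simps)
    show "\<exists>y\<in>carrier ?Q. y \<oplus>\<^bsub>?Q\<^esub> x = \<zero>\<^bsub>?Q\<^esub>"
      unfolding zero using u s coset_closed[of "\<ominus>\<^bsub>M\<^esub> u" M N]
      by (intro bexI[of _ "N +>\<^bsub>M\<^esub> (\<ominus>\<^bsub>M\<^esub> u)"]) (simp_all del: quotient_module_simps add: M.l_neg)
  next
    show "\<zero>\<^bsub>?Q\<^esub> \<in> carrier ?Q" unfolding zero by (rule coset_closed) simp
  qed
  show ?thesis
  proof (rule moduleI[OF M.is_cring ag])
    fix a x assume a: "a \<in> carrier K" and x: "x \<in> carrier ?Q"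
    obtain u where u: "u \<in> carrier M" "x = N +>\<^bsub>M\<^esub> u" using quotient_module_carrierE[OF x] .
    show "a \<odot>\<^bsub>?Q\<^esub> x \<in> carrier ?Q" using a u coset_closed[of _ M N] s by simp
  next
    fix a b x assume a: "a \<in> carrier K" "b \<in> carrier K" and x: "x \<in> carrier ?Q"
    obtain u where u: "u \<in> carrier M" "x = N +>\<^bsub>M\<^esub> u" using quotient_module_carrierE[OF x] .
    show "(a \<oplus>\<^bsub>K\<^esub> b) \<odot>\<^bsub>?Q\<^esub> x = a \<odot>\<^bsub>?Q\<^esub> x \<oplus>\<^bsub>?Q\<^esub> b \<odot>\<^bsub>?Q\<^esub> x"
      using a u s by (simp del: quotient_module_simps add: M.smult_l_distr)
    show "(a \<otimes>\<^bsub>K\<^esub> b) \<odot>\<^bsub>?Q\<^esub> x = a \<odot>\<^bsub>?Q\<^esub> (b \<odot>\<^bsub>?Q\<^esub> x)"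
      using a u s by (simp del: quotient_module_simps add: M.smult_assoc1)
  next
    fix a x y assume a: "a \<in> carrier K" and x: "x \<in> carrier ?Q" and y: "y \<in> carrier ?Q"
    obtain u where u: "u \<in> carrier M" "x = N +>\<^bsub>M\<^esub> u" using quotient_module_carrierE[OF x] .
    obtain v where v: "v \<in> carrier M" "y = N +>\<^bsub>M\<^esub> v" using quotient_module_carrierE[OF y] .
    show "a \<odot>\<^bsub>?Q\<^esub> (x \<oplus>\<^bsub>?Q\<^esub> y) = a \<odot>\<^bsub>?Q\<^esub> x \<oplus>\<^bsub>?Q\<^esub> a \<odot>\<^bsub>?Q\<^esub> y"
      using a u v s by (simp del: quotient_module_simps add: M.smult_r_distr)
  next
    fix x assume x: "x \<in> carrier ?Q"
    obtain u where u: "u \<in> carrier M" "x = N +>\<^bsub>M\<^esub> u" using quotient_module_carrierE[OF x] .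
    show "\<one>\<^bsub>K\<^esub> \<odot>\<^bsub>?Q\<^esub> x = x"
      using u s by (simp del: quotient_module_simps)
  qed
qed

lemma coset_lin_hom:
  assumes "module K M" "submodule N K M"
  shows "(\<lambda>x. N +>\<^bsub>M\<^esub> x) \<in> lin_hom K M (quotient_module M N)"
  by (rule lin_homI)
    (simp_all add: coset_closed quotient_module_add[OF assms] quotient_module_smult[OF assms]
      del: quotient_module_simps)

lemma quotient_module_lift:
  assumes M: "module K M" and N: "submodule N K M" and L: "module K L"
    and f: "f \<in> lin_hom K M L" and null: "\<And>x. x \<in> N \<Longrightarrow> f x = \<zero>\<^bsub>L\<^esub>"
  shows "\<exists>h \<in> lin_hom K (quotient_module M N) L. \<forall>x\<in>carrier M. h (N +>\<^bsub>M\<^esub> x) = f x"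
proof -
  interpret M: module K M by fact
  interpret L: module K L by fact
  let ?Q = "quotient_module M N"
  \<comment> \<open>The value at a chosen representative; two representatives differ by an element
    of \<open>N\<close>, which \<open>f\<close> kills.\<close>
  define h where "h X = f (SOME x. x \<in> carrier M \<and> X = N +>\<^bsub>M\<^esub> x)" for X
  have h: "h (N +>\<^bsub>M\<^esub> x) = f x" if x: "x \<in> carrier M" for x
  proof -
    define y where "y = (SOME y. y \<in> carrier M \<and> N +>\<^bsub>M\<^esub> x = N +>\<^bsub>M\<^esub> y)"
    have y: "y \<in> carrier M \<and> N +>\<^bsub>M\<^esub> x = N +>\<^bsub>M\<^esub> y"
      unfolding y_def by (rule someI[of _ x]) (simp add: x)
    then have "x \<ominus>\<^bsub>M\<^esub> y \<in> N" using coset_eq_iff[OF M N x, of y] by blast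
    then have "f x \<ominus>\<^bsub>L\<^esub> f y = \<zero>\<^bsub>L\<^esub>"
      using null lin_hom_minus[OF M L f x] y by metis
    then show ?thesis
      unfolding h_def y_def[symmetric]
      using minus_eq_zeroD[OF L.abelian_group_axioms, of "f x" "f y"] lin_hom_closed[OF f] x y by simp
  qed
  have "h \<in> lin_hom K ?Q L"
  proof (rule lin_homI)
    fix x assume x: "x \<in> carrier ?Q"
    obtain u where u: "u \<in> carrier M" "x = N +>\<^bsub>M\<^esub> u" using quotient_module_carrierE[OF x] .
    show "h x \<in> carrier L" using u h lin_hom_closed[OF f] by simp
  next
    fix x y assume x: "x \<in> carrier ?Q" and y: "y \<in> carrier ?Q"
    obtain u where u: "u \<in> carrier M" "x = N +>\<^bsub>M\<^esub> u" using quotient_module_carrierE[OF x] .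
    obtain v where v: "v \<in> carrier M" "y = N +>\<^bsub>M\<^esub> v" using quotient_module_carrierE[OF y] .
    show "h (x \<oplus>\<^bsub>?Q\<^esub> y) = h x \<oplus>\<^bsub>L\<^esub> h y"
      using u v h lin_hom_add[OF f] quotient_module_add[OF M N] by (simp del: quotient_module_simps)
  next
    fix a x assume a: "a \<in> carrier K" and x: "x \<in> carrier ?Q"
    obtain u where u: "u \<in> carrier M" "x = N +>\<^bsub>M\<^esub> u" using quotient_module_carrierE[OF x] .
    show "h (a \<odot>\<^bsub>?Q\<^esub> x) = a \<odot>\<^bsub>L\<^esub> h x"
      using a u h lin_hom_smult[OF f] quotient_module_smult[OF M N] by (simp del: quotient_module_simps)
  qed
  then show ?thesis using h by blast
qed

section \<open>Free modules and their universal property\<close>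

lemma free_module_simps [simp]:
  "zero (free_module K S) = (\<lambda>s. \<zero>\<^bsub>K\<^esub>)"
  "add (free_module K S) = (\<lambda>f g s. f s \<oplus>\<^bsub>K\<^esub> g s)"
  "smult (free_module K S) = (\<lambda>a f s. a \<otimes>\<^bsub>K\<^esub> f s)"
  by (simp_all add: free_module_def)

lemma free_module_carrier:
  "f \<in> carrier (free_module K S) \<longleftrightarrow> (\<forall>s\<in>S. f s \<in> carrier K) \<and>
    (\<forall>s. s \<notin> S \<longrightarrow> f s = \<zero>\<^bsub>K\<^esub>) \<and> finite {s. f s \<noteq> \<zero>\<^bsub>K\<^esub>}"
  by (simp add: free_module_def)

context cring
begin

lemma free_module_eval_closed: "f \<in> carrier (free_module R S) \<Longrightarrow> f s \<in> carrier R"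
  by (cases "s \<in> S") (auto simp: free_module_carrier)

lemma free_module_is_module: "module R (free_module R S)"
proof -
  let ?F = "free_module R S"
  have add: "f \<oplus>\<^bsub>?F\<^esub> g \<in> carrier ?F" if "f \<in> carrier ?F" "g \<in> carrier ?F" for f g
  proof -
    have "{s. f s \<oplus> g s \<noteq> \<zero>} \<subseteq> {s. f s \<noteq> \<zero>} \<union> {s. g s \<noteq> \<zero>}" by auto
    then have "finite {s. f s \<oplus> g s \<noteq> \<zero>}"
      using that by (auto simp: free_module_carrier intro: finite_subset)
    then show ?thesis using that by (auto simp: free_module_carrier)
  qed
  have sm: "a \<odot>\<^bsub>?F\<^esub> g \<in> carrier ?F" if "a \<in> carrier R" "g \<in> carrier ?F" for a g
  proof -
    have "{s. a \<otimes> g s \<noteq> \<zero>} \<subseteq> {s. g s \<noteq> \<zero>}" using that by auto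
    then have "finite {s. a \<otimes> g s \<noteq> \<zero>}"
      using that by (auto simp: free_module_carrier intro: finite_subset)
    then show ?thesis using that by (auto simp: free_module_carrier)
  qed
  have z: "\<zero>\<^bsub>?F\<^esub> \<in> carrier ?F" by (simp add: free_module_carrier)
  have ag: "abelian_group ?F"
  proof (rule abelian_groupI)
    show "\<exists>y\<in>carrier ?F. y \<oplus>\<^bsub>?F\<^esub> x = \<zero>\<^bsub>?F\<^esub>" if x: "x \<in> carrier ?F" for x
      using sm[of "\<ominus> \<one>" x] x free_module_eval_closed[OF x]
      by (intro bexI[of _ "(\<ominus> \<one>) \<odot>\<^bsub>?F\<^esub> x"]) (auto simp: l_minus l_neg)
  qed (use add z in \<open>auto simp: free_module_eval_closed a_ac\<close>)
  show ?thesis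
    by (rule moduleI[OF is_cring ag])
      (use sm in \<open>auto simp: free_module_eval_closed l_distr r_distr m_assoc\<close>)
qed

lemma free_gen_closed: "s \<in> S \<Longrightarrow> free_gen R s \<in> carrier (free_module R S)"
proof -
  assume "s \<in> S"
  moreover have "finite {t. free_gen R s t \<noteq> \<zero>}"
    by (rule finite_subset[of _ "{s}"]) (auto simp: free_gen_def)
  ultimately show ?thesis by (auto simp: free_module_carrier free_gen_def)
qed

lemma free_module_induct [consumes 1, case_names zero smult add]:
  assumes "f \<in> carrier (free_module R S)"
    and zero: "P (\<lambda>s. \<zero>)"
    and smult: "\<And>a s. a \<in> carrier R \<Longrightarrow> s \<in> S \<Longrightarrow> P (a \<odot>\<^bsub>free_module R S\<^esub> free_gen R s)"
    and add: "\<And>f g. f \<in> carrier (free_module R S) \<Longrightarrow> g \<in> carrier (free_module R S) \<Longrightarrow>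
      P f \<Longrightarrow> P g \<Longrightarrow> P (f \<oplus>\<^bsub>free_module R S\<^esub> g)"
  shows "P f"
proof -
  interpret F: module R "free_module R S" by (rule free_module_is_module)
  \<comment> \<open>The induction runs over a finite set containing the support, not over the
    support itself: if the new index lies outside \<open>S\<close>, the same \<open>f\<close> is
    covered by the smaller set; otherwise its coordinate there is split off.\<close>
  have "finite A \<Longrightarrow> {s. f s \<noteq> \<zero>} \<subseteq> A \<Longrightarrow> f \<in> carrier (free_module R S) \<Longrightarrow> P f" for A f
  proof (induction A arbitrary: f rule: finite_induct)
    case empty
    then have "f = (\<lambda>s. \<zero>)" by auto
    then show ?case using zero by simp
  next
    case (insert x A)
    show ?case
    proof (cases "x \<in> S")
      case False
      then have "f x = \<zero>" using insert.prems(2) by (simp add: free_module_carrier)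
      then have "{s. f s \<noteq> \<zero>} \<subseteq> A" using insert.prems(1) by auto
      then show ?thesis using insert by blast
    next
      case True
      note fc = free_module_eval_closed[OF insert.prems(2)]
      define g where "g = f(x := \<zero>)"
      have g1: "{s. g s \<noteq> \<zero>} \<subseteq> A" using insert.prems(1) by (auto simp: g_def)
      then have g2: "g \<in> carrier (free_module R S)"
        using insert.prems(2) insert.hyps(1) by (auto simp: free_module_carrier g_def intro: finite_subset)
      have e: "f = (f x) \<odot>\<^bsub>free_module R S\<^esub> free_gen R x \<oplus>\<^bsub>free_module R S\<^esub> g"
        using fc by (auto simp: g_def free_gen_def fun_eq_iff)
      have "P ((f x) \<odot>\<^bsub>free_module R S\<^esub> free_gen R x \<oplus>\<^bsub>free_module R S\<^esub> g)"
        using free_gen_closed[OF True] fc True g2 insert.IH[OF g1 g2] smult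
        by (intro add F.smult_closed) auto
      then show ?thesis using e by simp
    qed
  qed
  then show ?thesis using assms(1) by (auto simp: free_module_carrier)
qed

lemma free_module_lift:
  assumes L: "module R L" and g: "\<And>s. s \<in> S \<Longrightarrow> g s \<in> carrier L"
  shows "\<exists>h \<in> lin_hom R (free_module R S) L. \<forall>s\<in>S. h (free_gen R s) = g s"
proof -
  interpret L: module R L by fact
  let ?F = "free_module R S"
  interpret F: module R ?F by (rule free_module_is_module)
  \<comment> \<open>Extending \<open>g\<close> by zero makes every term of the sums below an element
    of \<open>L\<close>, without a case distinction on the index.\<close>
  define g' where "g' s = (if s \<in> S then g s else \<zero>\<^bsub>L\<^esub>)" for s
  have g': "g' s \<in> carrier L" for s using g by (simp add: g'_def)
  define h where "h f = (\<Oplus>\<^bsub>L\<^esub>s\<in>{s. f s \<noteq> \<zero>}. f s \<odot>\<^bsub>L\<^esub> g' s)" for f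
  \<comment> \<open>The sum may run over any finite set containing the support, so that two
    functions and their sum can be summed over a common index set.\<close>
  have h: "h f = (\<Oplus>\<^bsub>L\<^esub>s\<in>A. f s \<odot>\<^bsub>L\<^esub> g' s)"
    if "f \<in> carrier ?F" "finite A" "{s. f s \<noteq> \<zero>} \<subseteq> A" for f A
    unfolding h_def using that g' free_module_eval_closed[OF that(1)]
    by (intro L.add.finprod_mono_neutral_cong_left) auto
  have "h \<in> lin_hom R ?F L"
  proof (rule lin_homI)
    fix f assume f: "f \<in> carrier ?F"
    show "h f \<in> carrier L"
      unfolding h_def using g' free_module_eval_closed[OF f] by (intro L.finsum_closed) auto
    fix f2 assume f2: "f2 \<in> carrier ?F"
    let ?A = "{s. f s \<noteq> \<zero>} \<union> {s. f2 s \<noteq> \<zero>}"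
    note c = free_module_eval_closed[OF f] free_module_eval_closed[OF f2]
    have fin: "finite ?A" using f f2 by (simp add: free_module_carrier)
    have "h (f \<oplus>\<^bsub>?F\<^esub> f2) = (\<Oplus>\<^bsub>L\<^esub>s\<in>?A. (f \<oplus>\<^bsub>?F\<^esub> f2) s \<odot>\<^bsub>L\<^esub> g' s)"
      by (rule h[OF F.a_closed[OF f f2] fin]) auto
    also have "\<dots> = (\<Oplus>\<^bsub>L\<^esub>s\<in>?A. f s \<odot>\<^bsub>L\<^esub> g' s \<oplus>\<^bsub>L\<^esub> f2 s \<odot>\<^bsub>L\<^esub> g' s)"
      using c g' by (intro L.finsum_cong') (auto simp: L.smult_l_distr)
    also have "\<dots> = h f \<oplus>\<^bsub>L\<^esub> h f2"
      using c g' by (subst L.finsum_addf) (auto simp: h[OF f fin] h[OF f2 fin])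
    finally show "h (f \<oplus>\<^bsub>?F\<^esub> f2) = h f \<oplus>\<^bsub>L\<^esub> h f2" .
  next
    fix a f assume a: "a \<in> carrier R" and f: "f \<in> carrier ?F"
    note c = free_module_eval_closed[OF f]
    have fin: "finite {s. f s \<noteq> \<zero>}" using f by (simp add: free_module_carrier)
    have "h (a \<odot>\<^bsub>?F\<^esub> f) = (\<Oplus>\<^bsub>L\<^esub>s\<in>{s. f s \<noteq> \<zero>}. (a \<odot>\<^bsub>?F\<^esub> f) s \<odot>\<^bsub>L\<^esub> g' s)"
      by (rule h[OF F.smult_closed[OF a f] fin]) (use a in auto)
    also have "\<dots> = (\<Oplus>\<^bsub>L\<^esub>s\<in>{s. f s \<noteq> \<zero>}. a \<odot>\<^bsub>L\<^esub> (f s \<odot>\<^bsub>L\<^esub> g' s))"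
      using a c g' by (intro L.finsum_cong') (auto simp: L.smult_assoc1)
    also have "\<dots> = a \<odot>\<^bsub>L\<^esub> h f"
      unfolding h_def using a c g' fin by (intro L.finsum_smult_ldistr[symmetric]) auto
    finally show "h (a \<odot>\<^bsub>?F\<^esub> f) = a \<odot>\<^bsub>L\<^esub> h f" .
  qed
  moreover have "h (free_gen R s) = g s" if s: "s \<in> S" for s
  proof -
    have "h (free_gen R s) = (\<Oplus>\<^bsub>L\<^esub>t\<in>{s}. free_gen R s t \<odot>\<^bsub>L\<^esub> g' t)"
      by (rule h[OF free_gen_closed[OF s]]) (auto simp: free_gen_def)
    also have "\<dots> = g s" using g' s by (simp add: free_gen_def) (simp add: g'_def)
    finally show ?thesis .
  qed
  ultimately show ?thesis by blast
qed

end

section \<open>Tensor products\<close>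

definition bilinear ::
  "('k, 'r) ring_scheme \<Rightarrow> ('k, 'a, 'm) module_scheme \<Rightarrow> ('k, 'b, 'n) module_scheme
    \<Rightarrow> ('k, 'c, 'o) module_scheme \<Rightarrow> ('a \<Rightarrow> 'b \<Rightarrow> 'c) \<Rightarrow> bool"
  where "bilinear K V W U \<beta> \<longleftrightarrow>
    (\<forall>v\<in>carrier V. \<beta> v \<in> lin_hom K W U) \<and> (\<forall>w\<in>carrier W. (\<lambda>v. \<beta> v w) \<in> lin_hom K V U)"

lemma bilinearI:
  assumes "\<And>v. v \<in> carrier V \<Longrightarrow> \<beta> v \<in> lin_hom K W U"
    and "\<And>w. w \<in> carrier W \<Longrightarrow> (\<lambda>v. \<beta> v w) \<in> lin_hom K V U"
  shows "bilinear K V W U \<beta>"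
  using assms unfolding bilinear_def by blast

context cring
begin

lemma bilinear_relations_closed:
  assumes V: "module R V" and W: "module R W"
  shows "bilinear_relations R V W \<subseteq> carrier (free_module R (carrier V \<times> carrier W))"
proof -
  interpret V: module R V by fact
  interpret W: module R W by fact
  interpret F: module R "free_module R (carrier V \<times> carrier W)" by (rule free_module_is_module)
  show ?thesis
    unfolding bilinear_relations_def Let_def
    by (auto intro!: F.minus_closed F.a_closed F.smult_closed free_gen_closed simp del: free_module_simps)
qed

lemma tensor_null_submodule:
  assumes V: "module R V" and W: "module R W"
  shows "submodule (tensor_null R V W) R (free_module R (carrier V \<times> carrier W))"
  unfolding tensor_null_def
  by (intro submodule_span_submodule free_module_is_module bilinear_relations_closed assms)

lemma tensor_is_module [simp, intro]:
  assumes V: "module R V" and W: "module R W"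
  shows "module R (tensor R V W)"
  unfolding tensor_def
  by (intro quotient_module_is_module tensor_null_submodule free_module_is_module assms)

lemma pure_tensor_closed [simp, intro]:
  assumes "v \<in> carrier V" "w \<in> carrier W"
  shows "pure_tensor R V W v w \<in> carrier (tensor R V W)"
  unfolding tensor_def pure_tensor_def using assms by (intro coset_closed free_gen_closed) auto

lemma
  assumes V: "module R V" and W: "module R W"
  shows pure_tensor_add_left: "\<And>v v' w. v \<in> carrier V \<Longrightarrow> v' \<in> carrier V \<Longrightarrow> w \<in> carrier W \<Longrightarrow>
      pure_tensor R V W (v \<oplus>\<^bsub>V\<^esub> v') w =
        pure_tensor R V W v w \<oplus>\<^bsub>tensor R V W\<^esub> pure_tensor R V W v' w"
    and pure_tensor_add_right: "\<And>v w w'. v \<in> carrier V \<Longrightarrow> w \<in> carrier W \<Longrightarrow> w' \<in> carrier W \<Longrightarrow>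
      pure_tensor R V W v (w \<oplus>\<^bsub>W\<^esub> w') =
        pure_tensor R V W v w \<oplus>\<^bsub>tensor R V W\<^esub> pure_tensor R V W v w'"
    and pure_tensor_smult_left: "\<And>a v w. a \<in> carrier R \<Longrightarrow> v \<in> carrier V \<Longrightarrow> w \<in> carrier W \<Longrightarrow>
      pure_tensor R V W (a \<odot>\<^bsub>V\<^esub> v) w = a \<odot>\<^bsub>tensor R V W\<^esub> pure_tensor R V W v w"
    and pure_tensor_smult_right: "\<And>a v w. a \<in> carrier R \<Longrightarrow> v \<in> carrier V \<Longrightarrow> w \<in> carrier W \<Longrightarrow>
      pure_tensor R V W v (a \<odot>\<^bsub>W\<^esub> w) = a \<odot>\<^bsub>tensor R V W\<^esub> pure_tensor R V W v w"
proof -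
  interpret V: module R V by fact
  interpret W: module R W by fact
  let ?F = "free_module R (carrier V \<times> carrier W)"
  let ?N = "tensor_null R V W"
  note F = free_module_is_module[of "carrier V \<times> carrier W"]
  note N = tensor_null_submodule[OF V W]
  interpret F: module R ?F by (rule F)
  have rel: "x \<ominus>\<^bsub>?F\<^esub> y \<in> bilinear_relations R V W \<Longrightarrow> x \<in> carrier ?F \<Longrightarrow> y \<in> carrier ?F \<Longrightarrow>
    ?N +>\<^bsub>?F\<^esub> x = ?N +>\<^bsub>?F\<^esub> y" for x y
    using coset_eq_iff[OF F N] submodule_span_incl[of "bilinear_relations R V W" R ?F]
    by (auto simp: tensor_null_def)
  have gen: "free_gen R (v, w) \<in> carrier ?F" if "v \<in> carrier V" "w \<in> carrier W" for v w
    using that by (intro free_gen_closed) auto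
  show "pure_tensor R V W (v \<oplus>\<^bsub>V\<^esub> v') w =
        pure_tensor R V W v w \<oplus>\<^bsub>tensor R V W\<^esub> pure_tensor R V W v' w"
    if "v \<in> carrier V" "v' \<in> carrier V" "w \<in> carrier W" for v v' w
  proof -
    have "free_gen R (v \<oplus>\<^bsub>V\<^esub> v', w) \<ominus>\<^bsub>?F\<^esub> (free_gen R (v, w) \<oplus>\<^bsub>?F\<^esub> free_gen R (v', w)) \<in> bilinear_relations R V W"
      unfolding bilinear_relations_def Let_def using that by blast
    then have "?N +>\<^bsub>?F\<^esub> free_gen R (v \<oplus>\<^bsub>V\<^esub> v', w) = ?N +>\<^bsub>?F\<^esub> (free_gen R (v, w) \<oplus>\<^bsub>?F\<^esub> free_gen R (v', w))"
      using that by (intro rel gen F.a_closed F.smult_closed) simp_all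
    then show ?thesis
      using that by (simp add: tensor_def pure_tensor_def quotient_module_add[OF F N gen gen] del: quotient_module_simps free_module_simps)
  qed
  show "pure_tensor R V W v (w \<oplus>\<^bsub>W\<^esub> w') =
        pure_tensor R V W v w \<oplus>\<^bsub>tensor R V W\<^esub> pure_tensor R V W v w'"
    if "v \<in> carrier V" "w \<in> carrier W" "w' \<in> carrier W" for v w w'
  proof -
    have "free_gen R (v, w \<oplus>\<^bsub>W\<^esub> w') \<ominus>\<^bsub>?F\<^esub> (free_gen R (v, w) \<oplus>\<^bsub>?F\<^esub> free_gen R (v, w')) \<in> bilinear_relations R V W"
      unfolding bilinear_relations_def Let_def using that by blast
    then have "?N +>\<^bsub>?F\<^esub> free_gen R (v, w \<oplus>\<^bsub>W\<^esub> w') = ?N +>\<^bsub>?F\<^esub> (free_gen R (v, w) \<oplus>\<^bsub>?F\<^esub> free_gen R (v, w'))"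
      using that by (intro rel gen F.a_closed F.smult_closed) simp_all
    then show ?thesis
      using that by (simp add: tensor_def pure_tensor_def quotient_module_add[OF F N gen gen] del: quotient_module_simps free_module_simps)
  qed
  show "pure_tensor R V W (a \<odot>\<^bsub>V\<^esub> v) w = a \<odot>\<^bsub>tensor R V W\<^esub> pure_tensor R V W v w"
    if "a \<in> carrier R" "v \<in> carrier V" "w \<in> carrier W" for a v w
  proof -
    have "free_gen R (a \<odot>\<^bsub>V\<^esub> v, w) \<ominus>\<^bsub>?F\<^esub> (a \<odot>\<^bsub>?F\<^esub> free_gen R (v, w)) \<in> bilinear_relations R V W"
      unfolding bilinear_relations_def Let_def using that by blast
    then have "?N +>\<^bsub>?F\<^esub> free_gen R (a \<odot>\<^bsub>V\<^esub> v, w) = ?N +>\<^bsub>?F\<^esub> (a \<odot>\<^bsub>?F\<^esub> free_gen R (v, w))"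
      using that by (intro rel gen F.a_closed F.smult_closed) simp_all
    then show ?thesis
      using that by (simp add: tensor_def pure_tensor_def quotient_module_smult[OF F N _ gen] del: quotient_module_simps free_module_simps)
  qed
  show "pure_tensor R V W v (a \<odot>\<^bsub>W\<^esub> w) = a \<odot>\<^bsub>tensor R V W\<^esub> pure_tensor R V W v w"
    if "a \<in> carrier R" "v \<in> carrier V" "w \<in> carrier W" for a v w
  proof -
    have "free_gen R (v, a \<odot>\<^bsub>W\<^esub> w) \<ominus>\<^bsub>?F\<^esub> (a \<odot>\<^bsub>?F\<^esub> free_gen R (v, w)) \<in> bilinear_relations R V W"
      unfolding bilinear_relations_def Let_def using that by blast
    then have "?N +>\<^bsub>?F\<^esub> free_gen R (v, a \<odot>\<^bsub>W\<^esub> w) = ?N +>\<^bsub>?F\<^esub> (a \<odot>\<^bsub>?F\<^esub> free_gen R (v, w))"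
      using that by (intro rel gen F.a_closed F.smult_closed) simp_all
    then show ?thesis
      using that by (simp add: tensor_def pure_tensor_def quotient_module_smult[OF F N _ gen] del: quotient_module_simps free_module_simps)
  qed
qed

lemma pure_tensor_bilinear:
  assumes V: "module R V" and W: "module R W"
  shows "bilinear R V W (tensor R V W) (pure_tensor R V W)"
  by (intro bilinearI lin_homI)
    (simp_all add: pure_tensor_add_left[OF assms] pure_tensor_add_right[OF assms]
      pure_tensor_smult_left[OF assms] pure_tensor_smult_right[OF assms])

lemma pure_tensor_lin_left:
  "module R V \<Longrightarrow> module R W \<Longrightarrow> w \<in> carrier W \<Longrightarrow>
    (\<lambda>v. pure_tensor R V W v w) \<in> lin_hom R V (tensor R V W)"
  using pure_tensor_bilinear unfolding bilinear_def by blast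

lemma pure_tensor_lin_right:
  "module R V \<Longrightarrow> module R W \<Longrightarrow> v \<in> carrier V \<Longrightarrow>
    pure_tensor R V W v \<in> lin_hom R W (tensor R V W)"
  using pure_tensor_bilinear unfolding bilinear_def by blast

text \<open>No case for zero or for scalar multiples is required: a scalar moves into the left
  factor, so multiples of pure tensors, and in particular zero, are pure again.\<close>

lemma tensor_induct [consumes 3, case_names pure add]:
  assumes V: "module R V" and W: "module R W" and t: "t \<in> carrier (tensor R V W)"
    and pure: "\<And>v w. v \<in> carrier V \<Longrightarrow> w \<in> carrier W \<Longrightarrow> P (pure_tensor R V W v w)"
    and add: "\<And>s t. s \<in> carrier (tensor R V W) \<Longrightarrow> t \<in> carrier (tensor R V W) \<Longrightarrow>
      P s \<Longrightarrow> P t \<Longrightarrow> P (s \<oplus>\<^bsub>tensor R V W\<^esub> t)"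
  shows "P t"
proof -
  interpret V: module R V by fact
  interpret W: module R W by fact
  interpret T: module R "tensor R V W" using V W by simp
  let ?F = "free_module R (carrier V \<times> carrier W)"
  let ?N = "tensor_null R V W"
  note F = free_module_is_module[of "carrier V \<times> carrier W"]
  note N = tensor_null_submodule[OF V W]
  interpret F: module R ?F by (rule F)
  define p where "p = (\<lambda>x. ?N +>\<^bsub>?F\<^esub> x)"
  have p: "p \<in> lin_hom R ?F (tensor R V W)"
    unfolding p_def tensor_def by (rule coset_lin_hom[OF F N])
  have gen: "P (a \<odot>\<^bsub>tensor R V W\<^esub> pure_tensor R V W v w)"
    if "a \<in> carrier R" "v \<in> carrier V" "w \<in> carrier W" for a v w
    using pure[of "a \<odot>\<^bsub>V\<^esub> v" w] that by (simp add: pure_tensor_smult_left[OF V W])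
  have "P (p f)" if "f \<in> carrier ?F" for f
    using that
  proof (induction f rule: free_module_induct)
    case zero
    have "p (\<lambda>s. \<zero>) = \<zero>\<^bsub>tensor R V W\<^esub>" using lin_hom_zero[OF F T.module_axioms p] by simp
    then show ?case using gen[of \<zero> "\<zero>\<^bsub>V\<^esub>" "\<zero>\<^bsub>W\<^esub>"] by simp
  next
    case (smult a s)
    obtain v w where s: "s = (v, w)" "v \<in> carrier V" "w \<in> carrier W" using smult by auto
    have "p (a \<odot>\<^bsub>?F\<^esub> free_gen R s) = a \<odot>\<^bsub>tensor R V W\<^esub> pure_tensor R V W v w"
      using s smult lin_hom_smult[OF p smult(1) free_gen_closed[OF smult(2)]]
      by (simp add: p_def pure_tensor_def)
    then show ?case using gen s smult by (simp del: free_module_simps)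
  next
    case (add f g)
    then show ?case
      using assms(5) lin_hom_add[OF p] lin_hom_closed[OF p] by (simp del: free_module_simps)
  qed
  moreover obtain f where "f \<in> carrier ?F" "t = p f"
    using t quotient_module_carrierE unfolding p_def tensor_def by metis
  ultimately show ?thesis by simp
qed

lemma lin_hom_tensor_eqI:
  assumes V: "module R V" and W: "module R W" and "module R U"
    and f: "f \<in> lin_hom R (tensor R V W) U" and g: "g \<in> lin_hom R (tensor R V W) U"
    and eq: "\<And>v w. v \<in> carrier V \<Longrightarrow> w \<in> carrier W \<Longrightarrow>
      f (pure_tensor R V W v w) = g (pure_tensor R V W v w)"
    and t: "t \<in> carrier (tensor R V W)"
  shows "f t = g t"
  using V W t by (induction t rule: tensor_induct) (simp_all add: eq lin_hom_add[OF f] lin_hom_add[OF g])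

text \<open>The values of \<open>\<beta>\<close> on generators extend to the free module, and
  bilinearity makes the extension vanish on the four families of relations, hence on their
  span.\<close>

lemma tensor_lift_exists:
  assumes V: "module R V" and W: "module R W" and U: "module R U" and \<beta>: "bilinear R V W U \<beta>"
  shows "\<exists>h. h \<in> lin_hom R (tensor R V W) U \<and>
    (\<forall>v\<in>carrier V. \<forall>w\<in>carrier W. h (pure_tensor R V W v w) = \<beta> v w)"
proof -
  interpret V: module R V by fact
  interpret W: module R W by fact
  interpret U: module R U by fact
  let ?F = "free_module R (carrier V \<times> carrier W)"
  let ?N = "tensor_null R V W"
  note F = free_module_is_module[of "carrier V \<times> carrier W"]
  note N = tensor_null_submodule[OF V W]
  interpret F: module R ?F by (rule F)
  have \<beta>1: "\<beta> v \<in> lin_hom R W U" if "v \<in> carrier V" for v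
    using \<beta> that by (simp add: bilinear_def)
  have \<beta>2: "(\<lambda>v. \<beta> v w) \<in> lin_hom R V U" if "w \<in> carrier W" for w
    using \<beta> that by (simp add: bilinear_def)
  have "\<exists>h \<in> lin_hom R ?F U. \<forall>s\<in>carrier V \<times> carrier W. h (free_gen R s) = (\<lambda>(v, w). \<beta> v w) s"
    using lin_hom_closed[OF \<beta>1] by (intro free_module_lift[OF U]) auto
  then obtain f where f: "f \<in> lin_hom R ?F U"
    and f_gen: "\<And>v w. v \<in> carrier V \<Longrightarrow> w \<in> carrier W \<Longrightarrow> f (free_gen R (v, w)) = \<beta> v w"
    by auto
  have gen: "free_gen R (v, w) \<in> carrier ?F" if "v \<in> carrier V" "w \<in> carrier W" for v w
    using that by (intro free_gen_closed) auto
  have "bilinear_relations R V W \<subseteq> {x \<in> carrier ?F. f x = \<zero>\<^bsub>U\<^esub>}"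
  proof
    fix x assume x: "x \<in> bilinear_relations R V W"
    have xc: "x \<in> carrier ?F" using x bilinear_relations_closed[OF V W] by auto
    have eq: "f (y \<ominus>\<^bsub>?F\<^esub> z) = \<zero>\<^bsub>U\<^esub>" if y: "y \<in> carrier ?F" and z: "z \<in> carrier ?F" and yz: "f y = f z" for y z
    proof -
      have "f (y \<ominus>\<^bsub>?F\<^esub> z) = f y \<ominus>\<^bsub>U\<^esub> f z" by (rule lin_hom_minus[OF F U f y z])
      then show ?thesis using U.r_neg[OF lin_hom_closed[OF f z]] by (simp only: yz a_minus_def)
    qed
    note b = lin_hom_closed[OF \<beta>1] lin_hom_add[OF \<beta>1] lin_hom_smult[OF \<beta>1]
      lin_hom_add[OF \<beta>2] lin_hom_smult[OF \<beta>2]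
    have "f x = \<zero>\<^bsub>U\<^esub>"
      using x unfolding bilinear_relations_def Let_def
    proof (elim UnE CollectE exE conjE, goal_cases)
      case (1 v v' w)
      show ?case unfolding 1(1)
        using 1 gen by (intro eq F.a_closed) (simp_all del: free_module_simps add: f_gen b lin_hom_add[OF f])
    next
      case (2 v w w')
      show ?case unfolding 2(1)
        using 2 gen by (intro eq F.a_closed) (simp_all del: free_module_simps add: f_gen b lin_hom_add[OF f])
    next
      case (3 a v w)
      show ?case unfolding 3(1)
        using 3 gen by (intro eq F.smult_closed)
          (simp_all del: free_module_simps add: f_gen b lin_hom_smult[OF f])
    next
      case (4 a v w)
      show ?case unfolding 4(1)
        using 4 gen by (intro eq F.smult_closed)
          (simp_all del: free_module_simps add: f_gen b lin_hom_smult[OF f])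
    qed
    then show "x \<in> {x \<in> carrier ?F. f x = \<zero>\<^bsub>U\<^esub>}" using xc by simp
  qed
  then have "?N \<subseteq> {x \<in> carrier ?F. f x = \<zero>\<^bsub>U\<^esub>}"
    unfolding tensor_null_def by (intro submodule_span_least submodule_kernel F U f)
  then have "\<And>x. x \<in> ?N \<Longrightarrow> f x = \<zero>\<^bsub>U\<^esub>" by blast
  from quotient_module_lift[OF F N U f this]
  obtain h where h: "h \<in> lin_hom R (quotient_module ?F ?N) U"
    "\<And>x. x \<in> carrier ?F \<Longrightarrow> h (?N +>\<^bsub>?F\<^esub> x) = f x" by blast
  have "h (pure_tensor R V W v w) = \<beta> v w" if "v \<in> carrier V" "w \<in> carrier W" for v w
    using h(2)[OF gen[OF that]] that by (simp add: pure_tensor_def f_gen)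
  then show ?thesis using h(1) unfolding tensor_def by blast
qed

text \<open>\<open>tensor_lift\<close> is a definite description, so nothing is known about it
  before uniqueness is shown. Linear maps that agree on pure tensors agree only on the carrier; the
  extensionality requirement settles the remaining arguments.\<close>

lemma tensor_lift_props:
  assumes V: "module R V" and W: "module R W" and U: "module R U" and \<beta>: "bilinear R V W U \<beta>"
  shows "tensor_lift R V W U \<beta> \<in> lin_hom R (tensor R V W) U \<inter> extensional (carrier (tensor R V W)) \<and>
    (\<forall>v\<in>carrier V. \<forall>w\<in>carrier W. tensor_lift R V W U \<beta> (pure_tensor R V W v w) = \<beta> v w)"
proof -
  interpret T: module R "tensor R V W" using V W by simp
  let ?P = "\<lambda>h. h \<in> lin_hom R (tensor R V W) U \<inter> extensional (carrier (tensor R V W)) \<and>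
    (\<forall>v\<in>carrier V. \<forall>w\<in>carrier W. h (pure_tensor R V W v w) = \<beta> v w)"
  obtain h where h: "h \<in> lin_hom R (tensor R V W) U"
    "\<forall>v\<in>carrier V. \<forall>w\<in>carrier W. h (pure_tensor R V W v w) = \<beta> v w"
    using tensor_lift_exists[OF assms] by blast
  have h': "?P (restrict h (carrier (tensor R V W)))"
    using h(2) by (simp add: lin_hom_cong[OF T.module_axioms h(1)])
  have "g = g'" if g: "?P g" and g': "?P g'" for g g'
  proof (rule extensionalityI)
    show "g \<in> extensional (carrier (tensor R V W))" using g by blast
    show "g' \<in> extensional (carrier (tensor R V W))" using g' by blast
    show "g t = g' t" if "t \<in> carrier (tensor R V W)" for t
      by (rule lin_hom_tensor_eqI[OF V W U _ _ _ that]) (use g g' in simp_all)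
  qed
  then have "\<exists>!h. ?P h" using h' by (intro ex1I)
  then show ?thesis unfolding tensor_lift_def by (rule theI')
qed

lemma tensor_lift_lin:
  assumes "module R V" "module R W" "module R U" "bilinear R V W U \<beta>"
  shows "tensor_lift R V W U \<beta> \<in> lin_hom R (tensor R V W) U"
  using tensor_lift_props[OF assms] by blast

lemma tensor_lift_pure:
  assumes "module R V" "module R W" "module R U" "bilinear R V W U \<beta>"
    "v \<in> carrier V" "w \<in> carrier W"
  shows "tensor_lift R V W U \<beta> (pure_tensor R V W v w) = \<beta> v w"
  using tensor_lift_props[OF assms(1-4)] assms(5,6) by blast

end

section \<open>Functoriality of the tensor product\<close>

context cring
begin

lemma tensor_map_bilinear:
  assumes "module R V" "module R W" "module R V'" "module R W'"
    and f: "f \<in> lin_hom R V V'" and g: "g \<in> lin_hom R W W'"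
  shows "bilinear R V W (tensor R V' W') (\<lambda>v w. pure_tensor R V' W' (f v) (g w))"
  using assms
  by (intro bilinearI lin_homI)
    (simp_all add: pure_tensor_add_left pure_tensor_add_right pure_tensor_smult_left pure_tensor_smult_right
      lin_hom_closed[OF f] lin_hom_closed[OF g] lin_hom_add[OF f] lin_hom_add[OF g]
      lin_hom_smult[OF f] lin_hom_smult[OF g])

lemma tensor_map_lin:
  assumes "module R V" "module R W" "module R V'" "module R W'"
    and f: "f \<in> lin_hom R V V'" and g: "g \<in> lin_hom R W W'"
  shows "tensor_map R V W V' W' f g \<in> lin_hom R (tensor R V W) (tensor R V' W')"
  unfolding tensor_map_def using assms by (intro tensor_lift_lin tensor_map_bilinear) auto

lemma tensor_map_pure:
  assumes "module R V" "module R W" "module R V'" "module R W'"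
    and "f \<in> lin_hom R V V'" "g \<in> lin_hom R W W'" "v \<in> carrier V" "w \<in> carrier W"
  shows "tensor_map R V W V' W' f g (pure_tensor R V W v w) = pure_tensor R V' W' (f v) (g w)"
  unfolding tensor_map_def using assms by (subst tensor_lift_pure) (auto intro: tensor_map_bilinear)

lemma tensor_map_cong:
  assumes M: "module R V" "module R W" "module R V'" "module R W'"
    and fg: "f \<in> lin_hom R V V'" "g \<in> lin_hom R W W'"
    and eq: "\<And>v. v \<in> carrier V \<Longrightarrow> f' v = f v" "\<And>w. w \<in> carrier W \<Longrightarrow> g' w = g w"
    and t: "t \<in> carrier (tensor R V W)"
  shows "tensor_map R V W V' W' f' g' t = tensor_map R V W V' W' f g t"
proof -
  have fg': "f' \<in> lin_hom R V V'" "g' \<in> lin_hom R W W'"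
    using lin_hom_cong[OF M(1) fg(1)] lin_hom_cong[OF M(2) fg(2)] eq by auto
  show ?thesis
    by (rule lin_hom_tensor_eqI[OF M(1,2) _ _ _ _ t, of "tensor R V' W'"])
      (simp_all add: M tensor_map_lin fg fg' tensor_map_pure eq)
qed

lemma tensor_map_comp:
  assumes M: "module R V" "module R W" "module R V'" "module R W'" "module R V''" "module R W''"
    and fg: "f \<in> lin_hom R V V'" "g \<in> lin_hom R W W'" "f' \<in> lin_hom R V' V''" "g' \<in> lin_hom R W' W''"
    and t: "t \<in> carrier (tensor R V W)"
  shows "tensor_map R V' W' V'' W'' f' g' (tensor_map R V W V' W' f g t) =
    tensor_map R V W V'' W'' (\<lambda>x. f' (f x)) (\<lambda>x. g' (g x)) t"
proof -
  note l = tensor_map_lin[OF M(1-4) fg(1,2)] and l' = tensor_map_lin[OF M(3-6) fg(3,4)]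
    and ll = tensor_map_lin[OF M(1,2,5,6) lin_hom_comp[OF fg(1,3)] lin_hom_comp[OF fg(2,4)]]
  show ?thesis
    using M(1,2) t
  proof (induction t rule: tensor_induct)
    case (pure v w)
    then show ?case
      by (simp add: tensor_map_pure[OF M(1-4) fg(1,2)] tensor_map_pure[OF M(3-6) fg(3,4)]
          tensor_map_pure[OF M(1,2,5,6) lin_hom_comp[OF fg(1,3)] lin_hom_comp[OF fg(2,4)]]
          lin_hom_closed[OF fg(1)] lin_hom_closed[OF fg(2)])
  next
    case (add s t)
    then show ?case
      by (simp add: lin_hom_add[OF l] lin_hom_add[OF l'] lin_hom_add[OF ll] lin_hom_closed[OF l])
  qed
qed

lemma tensor_map_id:
  assumes M: "module R V" "module R W" and t: "t \<in> carrier (tensor R V W)"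
  shows "tensor_map R V W V W (\<lambda>x. x) (\<lambda>x. x) t = t"
  by (rule lin_hom_tensor_eqI[OF M(1,2) _ _ lin_hom_id _ t])
    (simp_all add: M tensor_map_lin tensor_map_pure lin_hom_id)

text \<open>The image contains all pure tensors and is closed under sums. This lets identities
  between maps on tensor powers of a quotient be checked on tensors that come from above.\<close>

lemma tensor_map_surj:
  assumes M: "module R V" "module R W" "module R V'" "module R W'"
    and fg: "f \<in> lin_hom R V V'" "g \<in> lin_hom R W W'"
    and surj: "f ` carrier V = carrier V'" "g ` carrier W = carrier W'"
  shows "tensor_map R V W V' W' f g ` carrier (tensor R V W) = carrier (tensor R V' W')"
proof
  note tm = tensor_map_lin[OF M fg]
  interpret T: module R "tensor R V W" using M by simp
  show "tensor_map R V W V' W' f g ` carrier (tensor R V W) \<subseteq> carrier (tensor R V' W')"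
    using lin_hom_closed[OF tm] by auto
  show "carrier (tensor R V' W') \<subseteq> tensor_map R V W V' W' f g ` carrier (tensor R V W)"
  proof
    fix t assume "t \<in> carrier (tensor R V' W')"
    with M(3,4) show "t \<in> tensor_map R V W V' W' f g ` carrier (tensor R V W)"
    proof (induction t rule: tensor_induct)
      case (pure v w)
      then obtain x y where "x \<in> carrier V" "v = f x" "y \<in> carrier W" "w = g y" using surj by blast
      then show ?case
        using tensor_map_pure[OF M fg, of x y] by (intro image_eqI[of _ _ "pure_tensor R V W x y"]) auto
    next
      case (add s t)
      then show ?case by (auto simp: lin_hom_add[OF tm, symmetric])
    qed
  qed
qed

section \<open>Associativity of the tensor product\<close>

lemma tensor_left3_induct [consumes 4, case_names pure add]:
  assumes M: "module R U" "module R V" "module R W" and t: "t \<in> carrier (tensor R (tensor R U V) W)"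
    and pure: "\<And>u v w. u \<in> carrier U \<Longrightarrow> v \<in> carrier V \<Longrightarrow> w \<in> carrier W \<Longrightarrow>
      P (pure_tensor R (tensor R U V) W (pure_tensor R U V u v) w)"
    and add: "\<And>s t. s \<in> carrier (tensor R (tensor R U V) W) \<Longrightarrow> t \<in> carrier (tensor R (tensor R U V) W) \<Longrightarrow>
      P s \<Longrightarrow> P t \<Longrightarrow> P (s \<oplus>\<^bsub>tensor R (tensor R U V) W\<^esub> t)"
  shows "P t"
  using tensor_is_module[OF M(1,2)] M(3) t
proof (induction t rule: tensor_induct)
  case (pure s w)
  from M(1,2) pure(1) show ?case
    by (induction s rule: tensor_induct) (simp_all add: assms pure pure_tensor_add_left)
qed (rule add)

lemma tensor_right3_induct [consumes 4, case_names pure add]: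
  assumes M: "module R U" "module R V" "module R W" and t: "t \<in> carrier (tensor R U (tensor R V W))"
    and pure: "\<And>u v w. u \<in> carrier U \<Longrightarrow> v \<in> carrier V \<Longrightarrow> w \<in> carrier W \<Longrightarrow>
      P (pure_tensor R U (tensor R V W) u (pure_tensor R V W v w))"
    and add: "\<And>s t. s \<in> carrier (tensor R U (tensor R V W)) \<Longrightarrow> t \<in> carrier (tensor R U (tensor R V W)) \<Longrightarrow>
      P s \<Longrightarrow> P t \<Longrightarrow> P (s \<oplus>\<^bsub>tensor R U (tensor R V W)\<^esub> t)"
  shows "P t"
  using M(1) tensor_is_module[OF M(2,3)] t
proof (induction t rule: tensor_induct)
  case (pure u s)
  from M(2,3) pure(2) show ?case
    by (induction s rule: tensor_induct) (simp_all add: assms pure pure_tensor_add_right)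
qed (rule add)

lemma tensor_assoc_lift:
  assumes M: "module R U" "module R V" "module R W"
  shows "tensor_assoc R U V W \<in> lin_hom R (tensor R (tensor R U V) W) (tensor R U (tensor R V W)) \<and>
    (\<forall>u\<in>carrier U. \<forall>v\<in>carrier V. \<forall>w\<in>carrier W.
      tensor_assoc R U V W (pure_tensor R (tensor R U V) W (pure_tensor R U V u v) w) =
      pure_tensor R U (tensor R V W) u (pure_tensor R V W v w))"
proof -
  let ?T = "tensor R U (tensor R V W)"
  let ?L = "\<lambda>t w. tensor_lift R U V ?T (\<lambda>u v. pure_tensor R U (tensor R V W) u (pure_tensor R V W v w)) t"
  interpret T: module R ?T using M by simp
  have b: "bilinear R U V ?T (\<lambda>u v. pure_tensor R U (tensor R V W) u (pure_tensor R V W v w))"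
    if "w \<in> carrier W" for w
    using M that by (intro bilinearI lin_homI) (simp_all add: pure_tensor_add_left pure_tensor_add_right
      pure_tensor_smult_left pure_tensor_smult_right)
  have lin: "(\<lambda>t. ?L t w) \<in> lin_hom R (tensor R U V) ?T" if "w \<in> carrier W" for w
    using M b[OF that] by (intro tensor_lift_lin) auto
  have L: "?L (pure_tensor R U V u v) w = pure_tensor R U (tensor R V W) u (pure_tensor R V W v w)"
    if "u \<in> carrier U" "v \<in> carrier V" "w \<in> carrier W" for u v w
    using M b that by (subst tensor_lift_pure) auto
  interpret W: module R W by fact
  have bb: "bilinear R (tensor R U V) W ?T ?L"
  proof (rule bilinearI[OF lin_homI lin])
    fix t assume t: "t \<in> carrier (tensor R U V)"
    show "?L t w \<in> carrier ?T" if "w \<in> carrier W" for w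
      using lin_hom_closed[OF lin[OF that] t] .
    \<comment> \<open>Additivity in \<open>w\<close> is obtained by fixing \<open>w\<close> and
      \<open>w'\<close> and comparing both sides as linear maps in \<open>t\<close>, where pure
      tensors suffice.\<close>
    show "?L t (w \<oplus>\<^bsub>W\<^esub> w') = ?L t w \<oplus>\<^bsub>?T\<^esub> ?L t w'" if w: "w \<in> carrier W" "w' \<in> carrier W" for w w'
      by (rule lin_hom_tensor_eqI[OF M(1,2) T.module_axioms _ _ _ t])
        (use M w in \<open>simp_all add: lin lin_hom_plus L pure_tensor_add_right\<close>)
    show "?L t (a \<odot>\<^bsub>W\<^esub> w) = a \<odot>\<^bsub>?T\<^esub> ?L t w" if a: "a \<in> carrier R" and w: "w \<in> carrier W" for a w
      using M(1,2) t
    proof (induction t rule: tensor_induct)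
      case (pure u v)
      then show ?case
        using M a w by (simp add: L pure_tensor_smult_right)
    next
      case (add s t)
      then show ?case
        using a w by (simp add: lin_hom_add[OF lin] lin_hom_closed[OF lin] T.smult_r_distr)
    qed
  qed
  have "tensor_assoc R U V W = tensor_lift R (tensor R U V) W ?T ?L" by (simp add: tensor_assoc_def)
  then show ?thesis
    using M by (auto simp: tensor_lift_pure[OF _ _ _ bb] L intro!: tensor_lift_lin[OF _ _ _ bb])
qed

lemma tensor_assoc_lin:
  assumes "module R U" "module R V" "module R W"
  shows "tensor_assoc R U V W \<in> lin_hom R (tensor R (tensor R U V) W) (tensor R U (tensor R V W))"
  using tensor_assoc_lift[OF assms] by (rule conjunct1)

lemma tensor_assoc_pure:
  assumes "module R U" "module R V" "module R W" "u \<in> carrier U" "v \<in> carrier V" "w \<in> carrier W"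
  shows "tensor_assoc R U V W (pure_tensor R (tensor R U V) W (pure_tensor R U V u v) w) =
      pure_tensor R U (tensor R V W) u (pure_tensor R V W v w)"
  using conjunct2[OF tensor_assoc_lift[OF assms(1-3)]] assms(4-6) by simp

text \<open>A candidate for the inverse of \<open>tensor_assoc\<close>, built by the universal
  property: \<open>tensor_assoc_inv\<close> is an \<open>inv_into\<close>, from which neither
  linearity nor values can be read off.\<close>

lemma tensor_reassoc_exists:
  assumes M: "module R U" "module R V" "module R W"
  shows "\<exists>h \<in> lin_hom R (tensor R U (tensor R V W)) (tensor R (tensor R U V) W).
    \<forall>u\<in>carrier U. \<forall>v\<in>carrier V. \<forall>w\<in>carrier W.
      h (pure_tensor R U (tensor R V W) u (pure_tensor R V W v w)) =
      pure_tensor R (tensor R U V) W (pure_tensor R U V u v) w"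
proof -
  let ?T = "tensor R (tensor R U V) W"
  let ?L = "\<lambda>u. tensor_lift R V W ?T (\<lambda>v w. pure_tensor R (tensor R U V) W (pure_tensor R U V u v) w)"
  interpret T: module R ?T using M by simp
  interpret U: module R U by fact
  have b: "bilinear R V W ?T (\<lambda>v w. pure_tensor R (tensor R U V) W (pure_tensor R U V u v) w)"
    if "u \<in> carrier U" for u
    using M that by (intro bilinearI lin_homI) (simp_all add: pure_tensor_add_left pure_tensor_add_right
      pure_tensor_smult_left pure_tensor_smult_right)
  have lin: "?L u \<in> lin_hom R (tensor R V W) ?T" if "u \<in> carrier U" for u
    using M b[OF that] by (intro tensor_lift_lin) auto
  have L: "?L u (pure_tensor R V W v w) = pure_tensor R (tensor R U V) W (pure_tensor R U V u v) w"
    if "u \<in> carrier U" "v \<in> carrier V" "w \<in> carrier W" for u v w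
    using M b that by (subst tensor_lift_pure) auto
  have bb: "bilinear R U (tensor R V W) ?T ?L"
  proof (rule bilinearI[OF lin lin_homI])
    fix t assume t: "t \<in> carrier (tensor R V W)"
    show "?L u t \<in> carrier ?T" if "u \<in> carrier U" for u
      using lin_hom_closed[OF lin[OF that] t] .
    show "?L (u \<oplus>\<^bsub>U\<^esub> u') t = ?L u t \<oplus>\<^bsub>?T\<^esub> ?L u' t" if w: "u \<in> carrier U" "u' \<in> carrier U" for u u'
      by (rule lin_hom_tensor_eqI[OF M(2,3) T.module_axioms _ _ _ t])
        (use M w in \<open>simp_all add: lin lin_hom_plus L pure_tensor_add_left\<close>)
    show "?L (a \<odot>\<^bsub>U\<^esub> u) t = a \<odot>\<^bsub>?T\<^esub> ?L u t" if a: "a \<in> carrier R" and w: "u \<in> carrier U" for a u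
      using M(2,3) t
    proof (induction t rule: tensor_induct)
      case (pure v w)
      then show ?case
        using M a w by (simp add: L pure_tensor_smult_left)
    next
      case (add s t)
      then show ?case
        using a w by (simp add: lin_hom_add[OF lin] lin_hom_closed[OF lin] T.smult_r_distr)
    qed
  qed
  show ?thesis
    using M by (intro bexI[of _ "tensor_lift R U (tensor R V W) ?T ?L"])
      (auto simp: tensor_lift_pure[OF _ _ _ bb] L intro!: tensor_lift_lin[OF _ _ _ bb])
qed

lemma
  assumes M: "module R U" "module R V" "module R W"
  shows tensor_assoc_inv_lin:
      "tensor_assoc_inv R U V W \<in> lin_hom R (tensor R U (tensor R V W)) (tensor R (tensor R U V) W)"
    and tensor_assoc_inv_pure: "\<And>u v w. u \<in> carrier U \<Longrightarrow> v \<in> carrier V \<Longrightarrow> w \<in> carrier W \<Longrightarrow>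
      tensor_assoc_inv R U V W (pure_tensor R U (tensor R V W) u (pure_tensor R V W v w)) =
      pure_tensor R (tensor R U V) W (pure_tensor R U V u v) w"
proof -
  let ?L = "tensor R (tensor R U V) W" and ?R = "tensor R U (tensor R V W)"
  obtain h where h: "h \<in> lin_hom R ?R ?L"
    and hp: "\<And>u v w. u \<in> carrier U \<Longrightarrow> v \<in> carrier V \<Longrightarrow> w \<in> carrier W \<Longrightarrow>
      h (pure_tensor R U (tensor R V W) u (pure_tensor R V W v w)) =
      pure_tensor R (tensor R U V) W (pure_tensor R U V u v) w"
    using tensor_reassoc_exists[OF M] by blast
  note a = tensor_assoc_lin[OF M]
  \<comment> \<open>One composite makes \<open>tensor_assoc\<close> injective, the other exhibits
    \<open>h t\<close> as a preimage of \<open>t\<close>; together they identify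
    \<open>inv_into\<close> with \<open>h\<close> on the carrier.\<close>
  have ha: "h (tensor_assoc R U V W t) = t" if "t \<in> carrier ?L" for t
    using M that by (induction t rule: tensor_left3_induct)
      (simp_all add: M tensor_assoc_pure hp lin_hom_add[OF a] lin_hom_add[OF h] lin_hom_closed[OF a])
  have ah: "tensor_assoc R U V W (h t) = t" if "t \<in> carrier ?R" for t
    using M that by (induction t rule: tensor_right3_induct)
      (simp_all add: M tensor_assoc_pure hp lin_hom_add[OF a] lin_hom_add[OF h] lin_hom_closed[OF h])
  have inj: "inj_on (tensor_assoc R U V W) (carrier ?L)" by (rule inj_on_inverseI[of _ h]) (rule ha)
  have eq: "tensor_assoc_inv R U V W t = h t" if "t \<in> carrier ?R" for t
    unfolding tensor_assoc_inv_def
    using inv_into_f_f[OF inj lin_hom_closed[OF h that]] ah[OF that] by simp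
  show "tensor_assoc_inv R U V W \<in> lin_hom R ?R ?L"
    by (rule lin_hom_cong[OF _ h eq]) (simp_all add: M)
  show "tensor_assoc_inv R U V W (pure_tensor R U (tensor R V W) u (pure_tensor R V W v w)) =
      pure_tensor R (tensor R U V) W (pure_tensor R U V u v) w"
    if "u \<in> carrier U" "v \<in> carrier V" "w \<in> carrier W" for u v w
    using that M by (simp add: eq hp)
qed

text \<open>\<open>braid_right\<close> and \<open>comult_right\<close> pass through a change of
  bracketing, so this and its inverse form are needed before a morphism can be commuted with
  them.\<close>

lemma tensor_assoc_natural:
  assumes M: "module R U" "module R V" "module R W" "module R U'" "module R V'" "module R W'"
    and f: "f \<in> lin_hom R U U'" "g \<in> lin_hom R V V'" "h \<in> lin_hom R W W'"
    and t: "t \<in> carrier (tensor R (tensor R U V) W)"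
  shows "tensor_assoc R U' V' W'
      (tensor_map R (tensor R U V) W (tensor R U' V') W' (tensor_map R U V U' V' f g) h t) =
    tensor_map R U (tensor R V W) U' (tensor R V' W') f (tensor_map R V W V' W' g h) (tensor_assoc R U V W t)"
proof -
  note fg = tensor_map_lin[OF M(1,2,4,5) f(1,2)] and gh = tensor_map_lin[OF M(2,3,5,6) f(2,3)]
  note l = tensor_map_lin[OF tensor_is_module[OF M(1,2)] M(3) tensor_is_module[OF M(4,5)] M(6) fg f(3)]
  note r = tensor_map_lin[OF M(1) tensor_is_module[OF M(2,3)] M(4) tensor_is_module[OF M(5,6)] f(1) gh]
  note a = tensor_assoc_lin[OF M(1-3)] and a' = tensor_assoc_lin[OF M(4-6)]
  show ?thesis
    using M(1-3) t
  proof (induction t rule: tensor_left3_induct)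
    case (pure u v w)
    then show ?case
      by (simp add: M f fg gh tensor_map_pure tensor_assoc_pure lin_hom_closed[OF f(1)]
          lin_hom_closed[OF f(2)] lin_hom_closed[OF f(3)])
  next
    case (add s t)
    then show ?case
      by (simp add: lin_hom_add[OF l] lin_hom_add[OF r] lin_hom_add[OF a] lin_hom_add[OF a']
          lin_hom_closed[OF l] lin_hom_closed[OF a])
  qed
qed

lemma tensor_assoc_inv_natural:
  assumes M: "module R U" "module R V" "module R W" "module R U'" "module R V'" "module R W'"
    and f: "f \<in> lin_hom R U U'" "g \<in> lin_hom R V V'" "h \<in> lin_hom R W W'"
    and t: "t \<in> carrier (tensor R U (tensor R V W))"
  shows "tensor_assoc_inv R U' V' W'
      (tensor_map R U (tensor R V W) U' (tensor R V' W') f (tensor_map R V W V' W' g h) t) =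
    tensor_map R (tensor R U V) W (tensor R U' V') W' (tensor_map R U V U' V' f g) h (tensor_assoc_inv R U V W t)"
proof -
  note fg = tensor_map_lin[OF M(1,2,4,5) f(1,2)] and gh = tensor_map_lin[OF M(2,3,5,6) f(2,3)]
  note l = tensor_map_lin[OF tensor_is_module[OF M(1,2)] M(3) tensor_is_module[OF M(4,5)] M(6) fg f(3)]
  note r = tensor_map_lin[OF M(1) tensor_is_module[OF M(2,3)] M(4) tensor_is_module[OF M(5,6)] f(1) gh]
  note a = tensor_assoc_inv_lin[OF M(1-3)] and a' = tensor_assoc_inv_lin[OF M(4-6)]
  show ?thesis
    using M(1-3) t
  proof (induction t rule: tensor_right3_induct)
    case (pure u v w)
    then show ?case
      by (simp add: M f fg gh tensor_map_pure tensor_assoc_inv_pure lin_hom_closed[OF f(1)]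
          lin_hom_closed[OF f(2)] lin_hom_closed[OF f(3)])
  next
    case (add s t)
    then show ?case
      by (simp add: lin_hom_add[OF l] lin_hom_add[OF r] lin_hom_add[OF a] lin_hom_add[OF a']
          lin_hom_closed[OF r] lin_hom_closed[OF a])
  qed
qed

end

section \<open>Subspaces of tensor products over a field\<close>

text \<open>The subspace X \<otimes> Y inside M \<otimes> N, realized by the embedding that
  \<open>braiding_on\<close> also uses. Inclusions such as c(P \<otimes> B) \<subseteq> B \<otimes>
  P thereby become statements about subsets of one ambient space.\<close>

definition tensor_sub ::
  "('k, 'r) ring_scheme \<Rightarrow> ('k, 'a, 'm) module_scheme \<Rightarrow> ('k, 'b, 'n) module_scheme
    \<Rightarrow> 'a set \<Rightarrow> 'b set \<Rightarrow> ('k, 'a, 'b) tensor set"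
  where "tensor_sub K M N X Y =
    tensor_map K (M\<lparr>carrier := X\<rparr>) (N\<lparr>carrier := Y\<rparr>) M N (\<lambda>x. x) (\<lambda>x. x)
      ` carrier (tensor K (M\<lparr>carrier := X\<rparr>) (N\<lparr>carrier := Y\<rparr>))"

lemma submodule_module: "module K M \<Longrightarrow> submodule X K M \<Longrightarrow> module K (M\<lparr>carrier := X\<rparr>)"
  by (rule submodule.submodule_is_module)

lemma submodule_incl_lin:
  assumes "module K M" "submodule X K M"
  shows "(\<lambda>x. x) \<in> lin_hom K (M\<lparr>carrier := X\<rparr>) M"
  using module.submoduleE(1)[OF assms] by (intro lin_homI) auto

lemma lin_hom_corestrict:
  assumes "f \<in> lin_hom K M N" "\<And>x. x \<in> carrier M \<Longrightarrow> f x \<in> Y"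
  shows "f \<in> lin_hom K M (N\<lparr>carrier := Y\<rparr>)"
  using assms by (auto simp: lin_hom_def)

lemma lin_hom_widen:
  assumes "module K N" "submodule Y K N" "f \<in> lin_hom K M (N\<lparr>carrier := Y\<rparr>)"
  shows "f \<in> lin_hom K M N"
  using lin_hom_comp[OF assms(3) submodule_incl_lin[OF assms(1,2)]] by simp

context cring
begin

lemma tensor_sub_incl_lin:
  assumes "module R M" "module R N" "submodule X R M" "submodule Y R N"
  shows "tensor_map R (M\<lparr>carrier := X\<rparr>) (N\<lparr>carrier := Y\<rparr>) M N (\<lambda>x. x) (\<lambda>x. x)
    \<in> lin_hom R (tensor R (M\<lparr>carrier := X\<rparr>) (N\<lparr>carrier := Y\<rparr>)) (tensor R M N)"
  using assms by (intro tensor_map_lin submodule_module submodule_incl_lin)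

lemma tensor_sub_submodule:
  assumes "module R M" "module R N" "submodule X R M" "submodule Y R N"
  shows "submodule (tensor_sub R M N X Y) R (tensor R M N)"
  unfolding tensor_sub_def
  by (rule submodule_image[OF _ _ tensor_sub_incl_lin]) (simp_all add: assms submodule_module)

lemma tensor_sub_incl_pure:
  assumes "module R M" "module R N" "submodule X R M" "submodule Y R N" "x \<in> X" "y \<in> Y"
  shows "tensor_map R (M\<lparr>carrier := X\<rparr>) (N\<lparr>carrier := Y\<rparr>) M N (\<lambda>x. x) (\<lambda>x. x)
    (pure_tensor R (M\<lparr>carrier := X\<rparr>) (N\<lparr>carrier := Y\<rparr>) x y) = pure_tensor R M N x y"
  using assms by (subst tensor_map_pure) (simp_all add: submodule_module submodule_incl_lin)

lemma tensor_sub_pure: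
  assumes "module R M" "module R N" "submodule X R M" "submodule Y R N" "x \<in> X" "y \<in> Y"
  shows "pure_tensor R M N x y \<in> tensor_sub R M N X Y"
  unfolding tensor_sub_def
  using tensor_sub_incl_pure[OF assms] assms(5,6)
  by (intro image_eqI[of _ _ "pure_tensor R (M\<lparr>carrier := X\<rparr>) (N\<lparr>carrier := Y\<rparr>) x y"]) simp_all

lemma tensor_sub_closed:
  assumes "module R M" "module R N" "submodule X R M" "submodule Y R N" "t \<in> tensor_sub R M N X Y"
  shows "t \<in> carrier (tensor R M N)"
  using assms(5) lin_hom_closed[OF tensor_sub_incl_lin[OF assms(1-4)]] unfolding tensor_sub_def by auto

lemma tensor_sub_induct [consumes 5, case_names pure add]:
  assumes M: "module R M" "module R N" "submodule X R M" "submodule Y R N" and t: "t \<in> tensor_sub R M N X Y"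
    and pure: "\<And>x y. x \<in> X \<Longrightarrow> y \<in> Y \<Longrightarrow> P (pure_tensor R M N x y)"
    and add: "\<And>s t. s \<in> tensor_sub R M N X Y \<Longrightarrow> t \<in> tensor_sub R M N X Y \<Longrightarrow>
      P s \<Longrightarrow> P t \<Longrightarrow> P (s \<oplus>\<^bsub>tensor R M N\<^esub> t)"
  shows "P t"
proof -
  let ?MX = "M\<lparr>carrier := X\<rparr>" and ?NY = "N\<lparr>carrier := Y\<rparr>"
  let ?i = "tensor_map R ?MX ?NY M N (\<lambda>x. x) (\<lambda>x. x)"
  obtain s where s: "s \<in> carrier (tensor R ?MX ?NY)" "t = ?i s" using t unfolding tensor_sub_def by blast
  from submodule_module[OF M(1,3)] submodule_module[OF M(2,4)] s(1) have "P (?i s)"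
  proof (induction s rule: tensor_induct)
    case (pure v w)
    then show ?case using assms(6) by (simp add: tensor_sub_incl_pure[OF M])
  next
    case (add s t)
    have "?i s \<in> tensor_sub R M N X Y" "?i t \<in> tensor_sub R M N X Y"
      unfolding tensor_sub_def using add by auto
    then show ?case using add assms(7) by (simp add: lin_hom_add[OF tensor_sub_incl_lin[OF M]])
  qed
  then show ?thesis using s by simp
qed

lemma tensor_map_sub:
  assumes M: "module R M" "module R N" "module R M'" "module R N'"
    and X: "submodule X R M" "submodule Y R N" "submodule X' R M'" "submodule Y' R N'"
    and f: "f \<in> lin_hom R M M'" "g \<in> lin_hom R N N'"
    and fX: "\<And>x. x \<in> X \<Longrightarrow> f x \<in> X'" "\<And>y. y \<in> Y \<Longrightarrow> g y \<in> Y'"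
    and t: "t \<in> tensor_sub R M N X Y"
  shows "tensor_map R M N M' N' f g t \<in> tensor_sub R M' N' X' Y'"
  using M(1,2) X(1,2) t
proof (induction t rule: tensor_sub_induct)
  case (pure x y)
  then have "x \<in> carrier M" "y \<in> carrier N" using X M module.submoduleE(1) by blast+
  then show ?case using pure by (simp add: tensor_map_pure[OF M f] tensor_sub_pure M X fX)
next
  case (add s t)
  have "s \<in> carrier (tensor R M N)" "t \<in> carrier (tensor R M N)"
    using add(1,2) tensor_sub_closed[OF M(1,2) X(1,2)] by auto
  then have "tensor_map R M N M' N' f g (s \<oplus>\<^bsub>tensor R M N\<^esub> t) =
    tensor_map R M N M' N' f g s \<oplus>\<^bsub>tensor R M' N'\<^esub> tensor_map R M N M' N' f g t"
    by (rule lin_hom_add[OF tensor_map_lin[OF M f]])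
  then show ?case
    using add(3,4) module.submoduleE(5)[OF tensor_is_module[OF M(3,4)] tensor_sub_submodule[OF M(3,4) X(3,4)]]
    by simp
qed

lemma tensor_sub_full:
  assumes "module R M" "module R N"
  shows "tensor_sub R M N (carrier M) (carrier N) = carrier (tensor R M N)"
proof -
  have "M\<lparr>carrier := carrier M\<rparr> = M" "N\<lparr>carrier := carrier N\<rparr> = N" by simp_all
  then show ?thesis
    unfolding tensor_sub_def using tensor_map_id[OF assms] by simp
qed

lemma tensor_map_into_sub:
  assumes M: "module R M" "module R N" "module R M'" "module R N'"
    and X: "submodule X' R M'" "submodule Y' R N'"
    and f: "f \<in> lin_hom R M M'" "g \<in> lin_hom R N N'"
    and fX: "\<And>x. x \<in> carrier M \<Longrightarrow> f x \<in> X'" "\<And>y. y \<in> carrier N \<Longrightarrow> g y \<in> Y'"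
    and t: "t \<in> carrier (tensor R M N)"
  shows "tensor_map R M N M' N' f g t \<in> tensor_sub R M' N' X' Y'"
  using tensor_map_sub[OF M module.carrier_is_submodule[OF M(1)] module.carrier_is_submodule[OF M(2)]
      X f fX] t by (simp add: tensor_sub_full[OF M(1,2)])

end

section \<open>Complements, projections and generalized inverses\<close>

lemma (in abelian_group) add_cancel_middle:
  assumes "x \<in> carrier G" "y \<in> carrier G"
  shows "x \<oplus> (y \<oplus> \<ominus> x) = y"
    and "z \<in> carrier G \<Longrightarrow> x \<oplus> (y \<oplus> (\<ominus> x \<oplus> z)) = y \<oplus> z"
proof -
  show "x \<oplus> (y \<oplus> \<ominus> x) = y" using assms r_neg1 a_comm[of x y] by (simp add: a_assoc[symmetric] r_neg) (simp add: a_assoc r_neg)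
  show "x \<oplus> (y \<oplus> (\<ominus> x \<oplus> z)) = y \<oplus> z" if "z \<in> carrier G"
    using assms that a_lcomm[of y "\<ominus> x" z] by (simp add: r_neg2)
qed

context field
begin

text \<open>Dimensions may be infinite, so Zorn's lemma supplies a subspace maximal among those
  meeting \<open>X\<close> trivially. If some \<open>m\<close> were outside X + Y, adjoining the
  line through \<open>m\<close> would contradict maximality.\<close>

lemma submodule_complement_exists:
  assumes M: "module R M" and X: "submodule X R M"
  shows "\<exists>Y. submodule Y R M \<and> X \<inter> Y \<subseteq> {\<zero>\<^bsub>M\<^esub>} \<and>
    (\<forall>m\<in>carrier M. \<exists>x\<in>X. \<exists>y\<in>Y. m = x \<oplus>\<^bsub>M\<^esub> y)"
proof -
  interpret M: module R M by fact
  define A where "A = {Y. submodule Y R M \<and> X \<inter> Y \<subseteq> {\<zero>\<^bsub>M\<^esub>}}"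
  have zero: "submodule {\<zero>\<^bsub>M\<^esub>} R M" by (rule M.submoduleI) auto
  have "\<exists>Y\<in>A. \<forall>Z\<in>A. Y \<subseteq> Z \<longrightarrow> Z = Y"
  proof (rule subset_Zorn_nonempty)
    show "A \<noteq> {}" using zero by (auto simp: A_def)
    fix C assume C: "C \<noteq> {}" "subset.chain A C"
    have sub: "submodule Z R M" and int: "X \<inter> Z \<subseteq> {\<zero>\<^bsub>M\<^esub>}" if "Z \<in> C" for Z
      using C(2) that by (auto simp: A_def subset_chain_def)
    have "submodule (\<Union>C) R M"
    proof (rule M.submoduleI)
      show "\<Union>C \<subseteq> carrier M" using sub M.submoduleE(1) by blast
      show "\<zero>\<^bsub>M\<^esub> \<in> \<Union>C" using C(1) sub submodule_zeroD by blast
      show "\<ominus>\<^bsub>M\<^esub> a \<in> \<Union>C" if "a \<in> \<Union>C" for a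
        using that sub M.submoduleE(3) by blast
      show "a \<odot>\<^bsub>M\<^esub> x \<in> \<Union>C" if "a \<in> carrier R" "x \<in> \<Union>C" for a x
        using that sub M.submoduleE(4) by blast
      show "x \<oplus>\<^bsub>M\<^esub> y \<in> \<Union>C" if xy: "x \<in> \<Union>C" "y \<in> \<Union>C" for x y
      proof -
        obtain Z Z' where Z: "Z \<in> C" "Z' \<in> C" "x \<in> Z" "y \<in> Z'" using xy by blast
        then have "Z \<subseteq> Z' \<or> Z' \<subseteq> Z" using C(2) by (auto simp: subset_chain_def)
        then obtain D where "D \<in> C" "x \<in> D" "y \<in> D" using Z by blast
        then show ?thesis using M.submoduleE(5)[OF sub] by blast
      qed
    qed
    moreover have "X \<inter> \<Union>C \<subseteq> {\<zero>\<^bsub>M\<^esub>}" using int by blast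
    ultimately show "\<Union>C \<in> A" by (simp add: A_def)
  qed
  then obtain Y where YA: "Y \<in> A" and maxA: "\<forall>Z\<in>A. Y \<subseteq> Z \<longrightarrow> Z = Y" by (rule bexE)
  have Y: "submodule Y R M" "X \<inter> Y \<subseteq> {\<zero>\<^bsub>M\<^esub>}" using YA by (simp_all add: A_def)
  have max: "Z = Y" if "submodule Z R M" "X \<inter> Z \<subseteq> {\<zero>\<^bsub>M\<^esub>}" "Y \<subseteq> Z" for Z
    using maxA that by (simp add: A_def)
  note Xc = M.submoduleE(1)[OF X, THEN subsetD] and Yc = M.submoduleE(1)[OF Y(1), THEN subsetD]
  have "\<exists>x\<in>X. \<exists>y\<in>Y. m = x \<oplus>\<^bsub>M\<^esub> y" if m: "m \<in> carrier M" for m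
  proof (rule ccontr)
    assume none: "\<not> (\<exists>x\<in>X. \<exists>y\<in>Y. m = x \<oplus>\<^bsub>M\<^esub> y)"
    define Z where "Z = {z. \<exists>y\<in>Y. \<exists>a\<in>carrier R. z = y \<oplus>\<^bsub>M\<^esub> a \<odot>\<^bsub>M\<^esub> m}"
    have "submodule Z R M"
    proof (rule M.submoduleI)
      show "Z \<subseteq> carrier M"
      proof
        fix z assume "z \<in> Z"
        then obtain y a where "y \<in> Y" "a \<in> carrier R" "z = y \<oplus>\<^bsub>M\<^esub> a \<odot>\<^bsub>M\<^esub> m" unfolding Z_def by blast
        then show "z \<in> carrier M" using m Yc[of y] by simp
      qed
      have "\<zero>\<^bsub>M\<^esub> = \<zero>\<^bsub>M\<^esub> \<oplus>\<^bsub>M\<^esub> \<zero> \<odot>\<^bsub>M\<^esub> m" using m by simp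
      then show "\<zero>\<^bsub>M\<^esub> \<in> Z" unfolding Z_def using submodule_zeroD[OF Y(1)] by blast
      show "\<ominus>\<^bsub>M\<^esub> z \<in> Z" if z: "z \<in> Z" for z
      proof -
        obtain y a where ya: "y \<in> Y" "a \<in> carrier R" "z = y \<oplus>\<^bsub>M\<^esub> a \<odot>\<^bsub>M\<^esub> m" using z unfolding Z_def by blast
        have "\<ominus>\<^bsub>M\<^esub> z = \<ominus>\<^bsub>M\<^esub> y \<oplus>\<^bsub>M\<^esub> (\<ominus> a) \<odot>\<^bsub>M\<^esub> m"
          using ya m Yc[OF ya(1)] by (simp add: M.minus_add M.smult_l_minus)
        then show ?thesis unfolding Z_def using ya M.submoduleE(3)[OF Y(1)] by blast
      qed
      show "z \<oplus>\<^bsub>M\<^esub> z' \<in> Z" if z: "z \<in> Z" "z' \<in> Z" for z z'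
      proof -
        obtain y a where ya: "y \<in> Y" "a \<in> carrier R" "z = y \<oplus>\<^bsub>M\<^esub> a \<odot>\<^bsub>M\<^esub> m" using z unfolding Z_def by blast
        obtain y' a' where ya': "y' \<in> Y" "a' \<in> carrier R" "z' = y' \<oplus>\<^bsub>M\<^esub> a' \<odot>\<^bsub>M\<^esub> m" using z unfolding Z_def by blast
        have "z \<oplus>\<^bsub>M\<^esub> z' = (y \<oplus>\<^bsub>M\<^esub> y') \<oplus>\<^bsub>M\<^esub> (a \<oplus> a') \<odot>\<^bsub>M\<^esub> m"
          using ya ya' m Yc[OF ya(1)] Yc[OF ya'(1)] by (simp add: M.smult_l_distr M.a_ac)
        then show ?thesis unfolding Z_def using ya ya' M.submoduleE(5)[OF Y(1)] by blast
      qed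
      show "c \<odot>\<^bsub>M\<^esub> z \<in> Z" if c: "c \<in> carrier R" and z: "z \<in> Z" for c z
      proof -
        obtain y a where ya: "y \<in> Y" "a \<in> carrier R" "z = y \<oplus>\<^bsub>M\<^esub> a \<odot>\<^bsub>M\<^esub> m" using z unfolding Z_def by blast
        have "c \<odot>\<^bsub>M\<^esub> z = c \<odot>\<^bsub>M\<^esub> y \<oplus>\<^bsub>M\<^esub> (c \<otimes> a) \<odot>\<^bsub>M\<^esub> m"
          using ya m c Yc[OF ya(1)] by (simp add: M.smult_r_distr M.smult_assoc1)
        then show ?thesis unfolding Z_def using ya c M.submoduleE(4)[OF Y(1)] by blast
      qed
    qed
    moreover have "X \<inter> Z \<subseteq> {\<zero>\<^bsub>M\<^esub>}"
    proof
      fix x assume "x \<in> X \<inter> Z"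
      then obtain y a where x: "x \<in> X" and y: "y \<in> Y" and a: "a \<in> carrier R" and e: "x = y \<oplus>\<^bsub>M\<^esub> a \<odot>\<^bsub>M\<^esub> m"
        unfolding Z_def by blast
      show "x \<in> {\<zero>\<^bsub>M\<^esub>}"
      proof (cases "a = \<zero>")
        case True
        then have "x = y" using e m Yc[OF y] by simp
        then show ?thesis using Y(2) x y by blast
      next
        case False
        \<comment> \<open>Division by the coefficient of \<open>m\<close> would put \<open>m\<close>
          into X + Y; this is the use of the field.\<close>
        then have u: "inv a \<in> carrier R" "inv a \<otimes> a = \<one>" using a field_Units by auto
        have am: "a \<odot>\<^bsub>M\<^esub> m = x \<oplus>\<^bsub>M\<^esub> \<ominus>\<^bsub>M\<^esub> y"
          unfolding e using Yc[OF y] m a by (simp add: M.a_assoc M.add_cancel_middle)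
        have "m = (inv a \<otimes> a) \<odot>\<^bsub>M\<^esub> m" using u m by simp
        also have "\<dots> = inv a \<odot>\<^bsub>M\<^esub> (x \<oplus>\<^bsub>M\<^esub> \<ominus>\<^bsub>M\<^esub> y)" using M.smult_assoc1[OF u(1) a m] am by (simp only:)
        also have "\<dots> = inv a \<odot>\<^bsub>M\<^esub> x \<oplus>\<^bsub>M\<^esub> inv a \<odot>\<^bsub>M\<^esub> (\<ominus>\<^bsub>M\<^esub> y)"
          using u Xc[OF x] Yc[OF y] by (simp add: M.smult_r_distr)
        finally have "\<exists>x\<in>X. \<exists>y\<in>Y. m = x \<oplus>\<^bsub>M\<^esub> y"
          using M.submoduleE(4)[OF X u(1) x] M.submoduleE(4)[OF Y(1) u(1) M.submoduleE(3)[OF Y(1) y]] by blast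
        then show ?thesis using none by blast
      qed
    qed
    moreover have "Y \<subseteq> Z"
    proof
      fix y assume y: "y \<in> Y"
      have "y = y \<oplus>\<^bsub>M\<^esub> \<zero> \<odot>\<^bsub>M\<^esub> m" using m Yc[OF y] by simp
      then show "y \<in> Z" unfolding Z_def using y by blast
    qed
    ultimately have "Z = Y" by (rule max)
    \<comment> \<open>Maximality has forced \<open>m\<close> into \<open>Y\<close>, and then m = 0 +
      m is a forbidden decomposition.\<close>
    moreover have "m = \<zero>\<^bsub>M\<^esub> \<oplus>\<^bsub>M\<^esub> \<one> \<odot>\<^bsub>M\<^esub> m" using m by simp
    then have "m \<in> Z" unfolding Z_def using submodule_zeroD[OF Y(1)] by blast
    ultimately have "m = \<zero>\<^bsub>M\<^esub> \<oplus>\<^bsub>M\<^esub> m" "m \<in> Y" using m by simp_all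
    then show False using none submodule_zeroD[OF X] by blast
  qed
  then show ?thesis using Y by blast
qed

text \<open>The projection along a complement. Being an identity between linear maps, r x = x on
  \<open>X\<close> survives tensoring, which is how subspaces of tensor products are controlled
  below.\<close>

lemma retraction_exists:
  assumes M: "module R M" and X: "submodule X R M"
  shows "\<exists>r\<in>lin_hom R M M. (\<forall>m\<in>carrier M. r m \<in> X) \<and> (\<forall>x\<in>X. r x = x)"
proof -
  interpret M: module R M by fact
  obtain Y where Y: "submodule Y R M" "X \<inter> Y \<subseteq> {\<zero>\<^bsub>M\<^esub>}"
    and ex: "\<And>m. m \<in> carrier M \<Longrightarrow> \<exists>x\<in>X. \<exists>y\<in>Y. m = x \<oplus>\<^bsub>M\<^esub> y"
    using submodule_complement_exists[OF assms] by blast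
  note Xc = M.submoduleE(1)[OF X, THEN subsetD] and Yc = M.submoduleE(1)[OF Y(1), THEN subsetD]
  define r where "r m = (SOME x. x \<in> X \<and> (\<exists>y\<in>Y. m = x \<oplus>\<^bsub>M\<^esub> y))" for m
  have r: "r m \<in> X \<and> (\<exists>y\<in>Y. m = r m \<oplus>\<^bsub>M\<^esub> y)" if "m \<in> carrier M" for m
    unfolding r_def by (rule someI_ex) (use ex[OF that] in blast)
  \<comment> \<open>The difference x - x' = y' - y lies in both summands and hence vanishes.\<close>
  have unique: "x = x'" if x: "x \<in> X" "x' \<in> X" and y: "y \<in> Y" "y' \<in> Y" and e: "x \<oplus>\<^bsub>M\<^esub> y = x' \<oplus>\<^bsub>M\<^esub> y'" for x x' y y'
  proof -
    note c = Xc[OF x(1)] Xc[OF x(2)] Yc[OF y(1)] Yc[OF y(2)]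
    have "x \<ominus>\<^bsub>M\<^esub> x' = (x \<oplus>\<^bsub>M\<^esub> y) \<oplus>\<^bsub>M\<^esub> (\<ominus>\<^bsub>M\<^esub> x' \<oplus>\<^bsub>M\<^esub> \<ominus>\<^bsub>M\<^esub> y)"
      using c by (simp add: a_minus_def M.a_assoc M.add_cancel_middle)
    also have "\<dots> = y' \<ominus>\<^bsub>M\<^esub> y"
      unfolding e using c by (simp add: a_minus_def M.a_assoc M.add_cancel_middle)
    finally have "x \<ominus>\<^bsub>M\<^esub> x' = y' \<ominus>\<^bsub>M\<^esub> y" .
    moreover have "x \<ominus>\<^bsub>M\<^esub> x' \<in> X" unfolding a_minus_def
      using x M.submoduleE(3,5)[OF X] by blast
    moreover have "y' \<ominus>\<^bsub>M\<^esub> y \<in> Y" unfolding a_minus_def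
      using y M.submoduleE(3,5)[OF Y(1)] by blast
    ultimately have "x \<ominus>\<^bsub>M\<^esub> x' = \<zero>\<^bsub>M\<^esub>" using Y(2) by auto
    then show ?thesis using minus_eq_zeroD[OF M.abelian_group_axioms _ c(1,2)] by blast
  qed
  have req: "r m = x" if "x \<in> X" "y \<in> Y" "m = x \<oplus>\<^bsub>M\<^esub> y" for m x y
  proof -
    have "m \<in> carrier M" using that Xc Yc by simp
    then obtain y' where "r m \<in> X" "y' \<in> Y" "m = r m \<oplus>\<^bsub>M\<^esub> y'" using r by blast
    then show ?thesis using unique[of "r m" x y' y] that by simp
  qed
  have "r \<in> lin_hom R M M"
  proof (rule lin_homI)
    fix m assume m: "m \<in> carrier M"
    show "r m \<in> carrier M" using r[OF m] Xc by blast
    obtain y where y: "r m \<in> X" "y \<in> Y" "m = r m \<oplus>\<^bsub>M\<^esub> y" using r[OF m] by blast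
    note c = Xc[OF y(1)] Yc[OF y(2)]
    show "r (m \<oplus>\<^bsub>M\<^esub> m') = r m \<oplus>\<^bsub>M\<^esub> r m'" if m': "m' \<in> carrier M" for m'
    proof -
      obtain y' where y': "r m' \<in> X" "y' \<in> Y" "m' = r m' \<oplus>\<^bsub>M\<^esub> y'" using r[OF m'] by blast
      note c' = Xc[OF y'(1)] Yc[OF y'(2)]
      have "m \<oplus>\<^bsub>M\<^esub> m' = (r m \<oplus>\<^bsub>M\<^esub> y) \<oplus>\<^bsub>M\<^esub> (r m' \<oplus>\<^bsub>M\<^esub> y')" using y(3) y'(3) by simp
      also have "\<dots> = (r m \<oplus>\<^bsub>M\<^esub> r m') \<oplus>\<^bsub>M\<^esub> (y \<oplus>\<^bsub>M\<^esub> y')"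
        using c c' by (simp add: M.a_ac)
      finally show ?thesis
        using M.submoduleE(5)[OF X y(1) y'(1)] M.submoduleE(5)[OF Y(1) y(2) y'(2)] by (intro req)
    qed
    show "r (a \<odot>\<^bsub>M\<^esub> m) = a \<odot>\<^bsub>M\<^esub> r m" if a: "a \<in> carrier R" for a
    proof -
      have "a \<odot>\<^bsub>M\<^esub> m = a \<odot>\<^bsub>M\<^esub> (r m \<oplus>\<^bsub>M\<^esub> y)" using y(3) by simp
      also have "\<dots> = a \<odot>\<^bsub>M\<^esub> r m \<oplus>\<^bsub>M\<^esub> a \<odot>\<^bsub>M\<^esub> y" using a c by (simp add: M.smult_r_distr)
      finally show ?thesis
        using M.submoduleE(4)[OF X a y(1)] M.submoduleE(4)[OF Y(1) a y(2)] by (intro req)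
    qed
  qed
  moreover have "r x = x" if "x \<in> X" for x
    by (rule req[OF that submodule_zeroD[OF Y(1)]]) (use Xc[OF that] in simp)
  ultimately show ?thesis using r by blast
qed

text \<open>Von Neumann regularity of linear maps stands in for flatness: it keeps kernels under tensoring.\<close>

lemma generalized_inverse_exists:
  assumes M: "module R M" and N: "module R N" and f: "f \<in> lin_hom R M N"
  shows "\<exists>g\<in>lin_hom R N M. \<forall>m\<in>carrier M. f (g (f m)) = f m"
proof -
  interpret M: module R M by fact
  interpret N: module R N by fact
  obtain k where k: "k \<in> lin_hom R M M" "\<And>m. m \<in> carrier M \<Longrightarrow> f (k m) = \<zero>\<^bsub>N\<^esub>"
    "\<And>m. m \<in> carrier M \<Longrightarrow> f m = \<zero>\<^bsub>N\<^esub> \<Longrightarrow> k m = m"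
    using retraction_exists[OF M submodule_kernel[OF M N f]] by blast
  obtain p where p: "p \<in> lin_hom R N N" "\<And>n. n \<in> carrier N \<Longrightarrow> p n \<in> f ` carrier M"
    "\<And>n. n \<in> f ` carrier M \<Longrightarrow> p n = n"
    using retraction_exists[OF N submodule_image[OF M N f]] by blast
  \<comment> \<open>Subtracting the projection onto the kernel does not change values under
    \<open>f\<close>, but makes \<open>q\<close> vanish on that kernel; hence \<open>q m\<close>
    depends only on \<open>f m\<close>.\<close>
  define q where "q m = m \<ominus>\<^bsub>M\<^esub> k m" for m
  have q: "q \<in> lin_hom R M M"
    unfolding q_def by (rule lin_hom_diff[OF M M lin_hom_id k(1)])
  have fq: "f (q m) = f m" if "m \<in> carrier M" for m
    unfolding q_def lin_hom_minus[OF M N f that lin_hom_closed[OF k(1) that]] k(2)[OF that]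
    using lin_hom_closed[OF f that] by (simp add: a_minus_def)
  have q_eq: "q m = q m'" if m: "m \<in> carrier M" "m' \<in> carrier M" and e: "f m = f m'" for m m'
  proof -
    have "f (m \<ominus>\<^bsub>M\<^esub> m') = \<zero>\<^bsub>N\<^esub>"
      unfolding lin_hom_minus[OF M N f m] e using lin_hom_closed[OF f m(2)] by (simp add: a_minus_def N.r_neg)
    then have "q (m \<ominus>\<^bsub>M\<^esub> m') = \<zero>\<^bsub>M\<^esub>"
      unfolding q_def using k(3) m by (simp add: a_minus_def M.r_neg)
    then have "q m \<ominus>\<^bsub>M\<^esub> q m' = \<zero>\<^bsub>M\<^esub>" unfolding lin_hom_minus[OF M M q m] .
    then show ?thesis using minus_eq_zeroD[OF M.abelian_group_axioms] lin_hom_closed[OF q] m by blast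
  qed
  \<comment> \<open>\<open>s\<close> is an arbitrary choice of preimages and not linear; composing
    with \<open>q\<close> removes the ambiguity, which lies in the kernel of
    \<open>f\<close>.\<close>
  define s where "s n = (SOME m. m \<in> carrier M \<and> f m = p n)" for n
  have s: "s n \<in> carrier M" "f (s n) = p n" if "n \<in> carrier N" for n
  proof -
    have "\<exists>m. m \<in> carrier M \<and> f m = p n" using p(2)[OF that] by (metis imageE)
    then have "s n \<in> carrier M \<and> f (s n) = p n" unfolding s_def by (rule someI_ex)
    then show "s n \<in> carrier M" "f (s n) = p n" by auto
  qed
  define g where "g n = q (s n)" for n
  have g_eq: "g n = q m" if "n \<in> carrier N" "m \<in> carrier M" "p n = f m" for n m
    unfolding g_def using s[OF that(1)] that by (intro q_eq) auto
  have "g \<in> lin_hom R N M"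
  proof (rule lin_homI)
    fix n assume n: "n \<in> carrier N"
    show "g n \<in> carrier M" unfolding g_def using lin_hom_closed[OF q] s[OF n] by blast
    show "g (n \<oplus>\<^bsub>N\<^esub> n') = g n \<oplus>\<^bsub>M\<^esub> g n'" if n': "n' \<in> carrier N" for n'
    proof -
      have "g (n \<oplus>\<^bsub>N\<^esub> n') = q (s n \<oplus>\<^bsub>M\<^esub> s n')"
        using n n' s by (intro g_eq) (simp_all add: lin_hom_add[OF p(1)] lin_hom_add[OF f])
      then show ?thesis using n n' s by (simp add: lin_hom_add[OF q] g_def)
    qed
    show "g (a \<odot>\<^bsub>N\<^esub> n) = a \<odot>\<^bsub>M\<^esub> g n" if a: "a \<in> carrier R" for a
    proof -
      have "g (a \<odot>\<^bsub>N\<^esub> n) = q (a \<odot>\<^bsub>M\<^esub> s n)"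
        using n a s by (intro g_eq) (simp_all add: lin_hom_smult[OF p(1)] lin_hom_smult[OF f])
      then show ?thesis using n a s by (simp add: lin_hom_smult[OF q] g_def)
    qed
  qed
  moreover have "f (g (f m)) = f m" if m: "m \<in> carrier M" for m
  proof -
    have "g (f m) = q m"
      using m p(3) lin_hom_closed[OF f m] by (intro g_eq) auto
    then show ?thesis using fq[OF m] by simp
  qed
  ultimately show ?thesis by blast
qed

text \<open>Let r be a projection onto \<open>X\<close>. Then r \<otimes> Id fixes t because t lies
  in X \<otimes> N, and it sends t into X \<otimes> Y because t lies in M \<otimes> Y.\<close>

lemma tensor_sub_Int:
  assumes M: "module R M" "module R N" and X: "submodule X R M" and Y: "submodule Y R N"
    and t: "t \<in> tensor_sub R M N X (carrier N)" "t \<in> tensor_sub R M N (carrier M) Y"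
  shows "t \<in> tensor_sub R M N X Y"
proof -
  interpret M: module R M by fact
  interpret N: module R N by fact
  note fM = M.carrier_is_submodule and fN = N.carrier_is_submodule
  note Xc = M.submoduleE(1)[OF X, THEN subsetD] and Yc = N.submoduleE(1)[OF Y, THEN subsetD]
  obtain r where r: "r \<in> lin_hom R M M" "\<And>m. m \<in> carrier M \<Longrightarrow> r m \<in> X" "\<And>x. x \<in> X \<Longrightarrow> r x = x"
    using retraction_exists[OF M(1) X] by blast
  let ?r = "tensor_map R M N M N r (\<lambda>x. x)"
  note rl = tensor_map_lin[OF M M r(1) lin_hom_id]
  have "?r t = t"
    using M X fN t(1)
  proof (induction t rule: tensor_sub_induct)
    case (pure x y)
    then show ?case using Xc by (simp add: tensor_map_pure[OF M M r(1) lin_hom_id] r)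
  next
    case (add s t)
    then show ?case
      using tensor_sub_closed[OF M X fN] by (simp add: lin_hom_add[OF rl])
  qed
  moreover have "?r t \<in> tensor_sub R M N X Y"
    by (rule tensor_map_sub[OF M M fM Y X Y r(1) lin_hom_id r(2) _ t(2)])
  ultimately show ?thesis by simp
qed

text \<open>With d = f - g and d h d = d, the map r = Id - h d takes values in the equalizer, and Id
  \<otimes> r fixes t because Id \<otimes> d kills it. So equalizers survive tensoring without any
  appeal to bases.\<close>

lemma tensor_sub_equalizer:
  assumes M: "module R M" "module R N" "module R L" and f: "f \<in> lin_hom R N L" and g: "g \<in> lin_hom R N L"
    and t: "t \<in> carrier (tensor R M N)"
    and eq: "tensor_map R M N M L (\<lambda>x. x) f t = tensor_map R M N M L (\<lambda>x. x) g t"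
  shows "t \<in> tensor_sub R M N (carrier M) {y \<in> carrier N. f y = g y}"
proof -
  interpret M: module R M by fact
  interpret N: module R N by fact
  interpret L: module R L by fact
  interpret T: module R "tensor R M N" using M by simp
  define d where "d y = f y \<ominus>\<^bsub>L\<^esub> g y" for y
  have d: "d \<in> lin_hom R N L" unfolding d_def by (rule lin_hom_diff[OF M(2,3) f g])
  obtain h where h: "h \<in> lin_hom R L N" "\<And>y. y \<in> carrier N \<Longrightarrow> d (h (d y)) = d y"
    using generalized_inverse_exists[OF M(2,3) d] by blast
  define r where "r y = y \<ominus>\<^bsub>N\<^esub> h (d y)" for y
  have r: "r \<in> lin_hom R N N"
    unfolding r_def by (rule lin_hom_diff[OF M(2,2) lin_hom_id lin_hom_comp[OF d h(1)]])
  have r_eq: "f (r y) = g (r y)" "r y \<in> carrier N" if y: "y \<in> carrier N" for y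
  proof -
    have hd: "h (d y) \<in> carrier N" using y by (intro lin_hom_closed[OF h(1)] lin_hom_closed[OF d])
    have "d (r y) = \<zero>\<^bsub>L\<^esub>"
      unfolding r_def lin_hom_minus[OF M(2,3) d y hd] h(2)[OF y]
      using lin_hom_closed[OF d y] by (simp add: a_minus_def L.r_neg)
    moreover show "r y \<in> carrier N" by (rule lin_hom_closed[OF r y])
    ultimately show "f (r y) = g (r y)"
      unfolding d_def using minus_eq_zeroD[OF L.abelian_group_axioms] lin_hom_closed[OF f] lin_hom_closed[OF g]
      by blast
  qed
  let ?T = "tensor R M N"
  let ?r = "tensor_map R M N M N (\<lambda>x. x) r" and ?h = "tensor_map R M L M N (\<lambda>x. x) h"
    and ?f = "tensor_map R M N M L (\<lambda>x. x) f" and ?g = "tensor_map R M N M L (\<lambda>x. x) g"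
  note rl = tensor_map_lin[OF M(1,2,1,2) lin_hom_id r] and hl = tensor_map_lin[OF M(1,3,1,2) lin_hom_id h(1)]
    and fl = tensor_map_lin[OF M(1,2,1,3) lin_hom_id f] and gl = tensor_map_lin[OF M(1,2,1,3) lin_hom_id g]
  \<comment> \<open>The identity r + h f = Id + h g is tensored with Id; written with sums only, it
    passes directly through the induction. Then \<open>eq\<close> cancels the terms with
    \<open>h\<close>.\<close>
  have "?r t \<oplus>\<^bsub>?T\<^esub> ?h (?f t) = t \<oplus>\<^bsub>?T\<^esub> ?h (?g t)"
    using M(1,2) t
  proof (induction t rule: tensor_induct)
    case (pure x y)
    note c = lin_hom_closed[OF f pure(2)] lin_hom_closed[OF g pure(2)]
    note hc = lin_hom_closed[OF h(1) c(1)] lin_hom_closed[OF h(1) c(2)] lin_hom_closed[OF r pure(2)]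
    have "r y \<oplus>\<^bsub>N\<^esub> h (f y) = y \<oplus>\<^bsub>N\<^esub> h (g y)"
      unfolding r_def d_def lin_hom_minus[OF M(3,2) h(1) c]
      using pure hc by (simp add: a_minus_def N.minus_add N.a_ac N.add_cancel_middle N.r_neg1 N.r_neg2 N.r_neg)
    then have "pure_tensor R M N x (r y \<oplus>\<^bsub>N\<^esub> h (f y)) = pure_tensor R M N x (y \<oplus>\<^bsub>N\<^esub> h (g y))" by simp
    then show ?case
      using pure c hc
      by (simp add: tensor_map_pure[OF M(1,2,1,2) lin_hom_id r] tensor_map_pure[OF M(1,3,1,2) lin_hom_id h(1)]
          tensor_map_pure[OF M(1,2,1,3) lin_hom_id f] tensor_map_pure[OF M(1,2,1,3) lin_hom_id g]
          pure_tensor_add_right[OF M(1,2)])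
  next
    case (add s t)
    note c = lin_hom_closed[OF rl add(1)] lin_hom_closed[OF rl add(2)]
      lin_hom_closed[OF hl lin_hom_closed[OF fl add(1)]] lin_hom_closed[OF hl lin_hom_closed[OF fl add(2)]]
      lin_hom_closed[OF hl lin_hom_closed[OF gl add(1)]] lin_hom_closed[OF hl lin_hom_closed[OF gl add(2)]]
    have "?r (s \<oplus>\<^bsub>?T\<^esub> t) \<oplus>\<^bsub>?T\<^esub> ?h (?f (s \<oplus>\<^bsub>?T\<^esub> t)) = (?r s \<oplus>\<^bsub>?T\<^esub> ?h (?f s)) \<oplus>\<^bsub>?T\<^esub> (?r t \<oplus>\<^bsub>?T\<^esub> ?h (?f t))"
      using add(1,2) c by (simp add: lin_hom_add[OF rl] lin_hom_add[OF hl] lin_hom_add[OF fl]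
          lin_hom_closed[OF fl] T.a_ac)
    also have "\<dots> = s \<oplus>\<^bsub>?T\<^esub> t \<oplus>\<^bsub>?T\<^esub> ?h (?g (s \<oplus>\<^bsub>?T\<^esub> t))"
      unfolding add(3,4) using add(1,2) c
      by (simp add: lin_hom_add[OF hl] lin_hom_add[OF gl] lin_hom_closed[OF gl] T.a_ac)
    finally show ?case .
  qed
  then have "?r t = t"
    unfolding eq using lin_hom_closed[OF rl t] lin_hom_closed[OF hl lin_hom_closed[OF gl t]] t by simp
  moreover have "?r t \<in> tensor_sub R M N (carrier M) {y \<in> carrier N. f y = g y}"
    by (rule tensor_map_into_sub[OF M(1,2,1,2) M.carrier_is_submodule submodule_equalizer[OF M(2,3) f g]
        lin_hom_id r _ _ t]) (use r_eq in auto)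
  ultimately show ?thesis by simp
qed

lemma tensor_twist_exists:
  assumes M: "module R M" "module R N"
  shows "\<exists>h \<in> lin_hom R (tensor R M N) (tensor R N M). \<forall>x\<in>carrier M. \<forall>y\<in>carrier N.
    h (pure_tensor R M N x y) = pure_tensor R N M y x"
proof -
  have b: "bilinear R M N (tensor R N M) (\<lambda>x y. pure_tensor R N M y x)"
    using M by (intro bilinearI) (simp_all add: pure_tensor_lin_left pure_tensor_lin_right)
  show ?thesis
    using tensor_lift_exists[OF M tensor_is_module[OF M(2,1)] b] by blast
qed

text \<open>Reduced to the other side by the ordinary flip of factors, which is unrelated to any
  braiding.\<close>

lemma tensor_sub_equalizer_left:
  assumes M: "module R M" "module R N" "module R L" and f: "f \<in> lin_hom R N L" and g: "g \<in> lin_hom R N L"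
    and t: "t \<in> carrier (tensor R N M)"
    and eq: "tensor_map R N M L M f (\<lambda>x. x) t = tensor_map R N M L M g (\<lambda>x. x) t"
  shows "t \<in> tensor_sub R N M {y \<in> carrier N. f y = g y} (carrier M)"
proof -
  obtain w where w: "w \<in> lin_hom R (tensor R N M) (tensor R M N)"
    "\<And>y x. y \<in> carrier N \<Longrightarrow> x \<in> carrier M \<Longrightarrow> w (pure_tensor R N M y x) = pure_tensor R M N x y"
    using tensor_twist_exists[OF M(2,1)] by blast
  obtain v where v: "v \<in> lin_hom R (tensor R M N) (tensor R N M)"
    "\<And>x y. x \<in> carrier M \<Longrightarrow> y \<in> carrier N \<Longrightarrow> v (pure_tensor R M N x y) = pure_tensor R N M y x"
    using tensor_twist_exists[OF M(1,2)] by blast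
  obtain l where l: "l \<in> lin_hom R (tensor R L M) (tensor R M L)"
    "\<And>y x. y \<in> carrier L \<Longrightarrow> x \<in> carrier M \<Longrightarrow> l (pure_tensor R L M y x) = pure_tensor R M L x y"
    using tensor_twist_exists[OF M(3,1)] by blast
  have nat: "tensor_map R M N M L (\<lambda>x. x) d (w s) = l (tensor_map R N M L M d (\<lambda>x. x) s)"
    if d: "d \<in> lin_hom R N L" and s: "s \<in> carrier (tensor R N M)" for d s
  proof -
    note r = tensor_map_lin[OF M(1,2,1,3) lin_hom_id d] and r' = tensor_map_lin[OF M(2,1,3,1) d lin_hom_id]
    show ?thesis
      using M(2,1) s
    proof (induction s rule: tensor_induct)
      case (pure y x)
      then show ?case
        by (simp add: w l lin_hom_closed[OF d] tensor_map_pure[OF M(1,2,1,3) lin_hom_id d]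
            tensor_map_pure[OF M(2,1,3,1) d lin_hom_id])
    next
      case (add s t)
      then show ?case
        by (simp add: lin_hom_add[OF r] lin_hom_add[OF r'] lin_hom_add[OF w(1)] lin_hom_add[OF l(1)]
            lin_hom_closed[OF r'] lin_hom_closed[OF w(1)])
    qed
  qed
  let ?E = "{y \<in> carrier N. f y = g y}"
  note E = submodule_equalizer[OF M(2,3) f g] and fM = module.carrier_is_submodule[OF M(1)]
  have wt: "w t \<in> tensor_sub R M N (carrier M) ?E"
    by (rule tensor_sub_equalizer[OF M f g lin_hom_closed[OF w(1) t]])
      (simp add: nat[OF f t] nat[OF g t] eq)
  have "v u \<in> tensor_sub R N M ?E (carrier M)" if "u \<in> tensor_sub R M N (carrier M) ?E" for u
    using M(1,2) fM E that
  proof (induction u rule: tensor_sub_induct)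
    case (pure x y)
    then have "v (pure_tensor R M N x y) = pure_tensor R N M y x" by (intro v(2)) auto
    then show ?case using tensor_sub_pure[OF M(2,1) E fM pure(2,1)] by simp
  next
    case (add s u)
    have "v (s \<oplus>\<^bsub>tensor R M N\<^esub> u) = v s \<oplus>\<^bsub>tensor R N M\<^esub> v u"
      by (intro lin_hom_add[OF v(1)] tensor_sub_closed[OF M(1,2) fM E] add(1,2))
    then show ?case
      using module.submoduleE(5)[OF tensor_is_module[OF M(2,1)] tensor_sub_submodule[OF M(2,1) E fM] add(3,4)]
      by simp
  qed
  note this[OF wt]
  moreover have "v (w t) = t"
    using M(2,1) t by (induction t rule: tensor_induct)
      (simp_all add: v w lin_hom_add[OF w(1)] lin_hom_add[OF v(1)] lin_hom_closed[OF w(1)])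
  ultimately show ?thesis by simp
qed

text \<open>Projections onto \<open>X\<close> and \<open>Y\<close> tensor to a left inverse of the
  embedding. Equations in X \<otimes> Y may therefore be checked in the ambient space, where
  restricted braidings are easier to handle.\<close>

lemma tensor_sub_incl_inj:
  assumes M: "module R M" "module R N" and X: "submodule X R M" and Y: "submodule Y R N"
  shows "inj_on (tensor_map R (M\<lparr>carrier := X\<rparr>) (N\<lparr>carrier := Y\<rparr>) M N (\<lambda>x. x) (\<lambda>x. x))
    (carrier (tensor R (M\<lparr>carrier := X\<rparr>) (N\<lparr>carrier := Y\<rparr>)))"
proof -
  let ?X = "M\<lparr>carrier := X\<rparr>" and ?Y = "N\<lparr>carrier := Y\<rparr>"
  note m = submodule_module[OF M(1) X] submodule_module[OF M(2) Y]
  note i = submodule_incl_lin[OF M(1) X] submodule_incl_lin[OF M(2) Y]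
  obtain r where r: "r \<in> lin_hom R M M" "\<And>m. m \<in> carrier M \<Longrightarrow> r m \<in> X" "\<And>x. x \<in> X \<Longrightarrow> r x = x"
    using retraction_exists[OF M(1) X] by blast
  obtain q where q: "q \<in> lin_hom R N N" "\<And>m. m \<in> carrier N \<Longrightarrow> q m \<in> Y" "\<And>x. x \<in> Y \<Longrightarrow> q x = x"
    using retraction_exists[OF M(2) Y] by blast
  have rq: "r \<in> lin_hom R M ?X" "q \<in> lin_hom R N ?Y"
    using lin_hom_corestrict r q by blast+
  show ?thesis
  proof (rule inj_on_inverseI)
    fix t assume t: "t \<in> carrier (tensor R ?X ?Y)"
    have "tensor_map R M N ?X ?Y r q (tensor_map R ?X ?Y M N (\<lambda>x. x) (\<lambda>x. x) t) =
      tensor_map R ?X ?Y ?X ?Y r q t"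
      using tensor_map_comp[OF m M m i rq t] by simp
    also have "\<dots> = tensor_map R ?X ?Y ?X ?Y (\<lambda>x. x) (\<lambda>x. x) t"
      by (rule tensor_map_cong[OF m m lin_hom_id lin_hom_id _ _ t]) (simp_all add: r q)
    also have "\<dots> = t" by (rule tensor_map_id[OF m t])
    finally show "tensor_map R M N ?X ?Y r q (tensor_map R ?X ?Y M N (\<lambda>x. x) (\<lambda>x. x) t) = t" .
  qed
qed

end

section \<open>Braidings and subspaces\<close>

lemma submodule_preimage_family:
  assumes "module K M" "module K N" "submodule H K N" "Z \<noteq> {}"
    and f: "\<And>z. z \<in> Z \<Longrightarrow> f z \<in> lin_hom K M N"
  shows "submodule {y \<in> carrier M. \<forall>z\<in>Z. f z y \<in> H} K M"
proof -
  have "{y \<in> carrier M. \<forall>z\<in>Z. f z y \<in> H} = \<Inter> ((\<lambda>z. {y \<in> carrier M. f z y \<in> H}) ` Z)"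
    using assms(4) by auto
  also have "submodule \<dots> K M"
    using assms(4) submodule_preimage[OF assms(1,2) f assms(3)] by (intro submodule_Inter[OF assms(1)]) auto
  finally show ?thesis .
qed

text \<open>Additivity reduces inclusions of this kind to pure tensors; most descent arguments below
  end here.\<close>

lemma (in cring) tensor_sub_image_into:
  assumes M: "module R M" "module R N" "module R L" and X: "submodule X R M" "submodule Y R N"
    and f: "f \<in> lin_hom R (tensor R M N) L" and H: "submodule H R L"
    and pure: "\<And>x y. x \<in> X \<Longrightarrow> y \<in> Y \<Longrightarrow> f (pure_tensor R M N x y) \<in> H"
    and t: "t \<in> tensor_sub R M N X Y"
  shows "f t \<in> H"
  using M(1,2) X t
proof (induction t rule: tensor_sub_induct)
  case (add s t)
  then have "f (s \<oplus>\<^bsub>tensor R M N\<^esub> t) = f s \<oplus>\<^bsub>L\<^esub> f t"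
    by (intro lin_hom_add[OF f] tensor_sub_closed[OF M(1,2) X])
  then show ?case using module.submoduleE(5)[OF M(3) H add(3,4)] by simp
qed (rule pure)

lemma (in cring) tensor_assoc_assoc_inv:
  assumes M: "module R U" "module R V" "module R W" and t: "t \<in> carrier (tensor R U (tensor R V W))"
  shows "tensor_assoc R U V W (tensor_assoc_inv R U V W t) = t"
  using M t by (induction t rule: tensor_right3_induct)
    (simp_all add: M tensor_assoc_pure tensor_assoc_inv_pure lin_hom_add[OF tensor_assoc_lin[OF M]]
      lin_hom_add[OF tensor_assoc_inv_lin[OF M]] lin_hom_closed[OF tensor_assoc_inv_lin[OF M]])

section \<open>Braidings on three and four factors\<close>

context braided_vector_space
begin

abbreviation "VV \<equiv> tensor K V V"
abbreviation "VVV \<equiv> tensor K VV V"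

lemma mods: "module K V" "module K VV" "module K VVV" "module K (tensor K V VV)"
  by (simp_all add: module_axioms)

lemma braiding_pure_lin_left:
  "y \<in> carrier V \<Longrightarrow> (\<lambda>x. braiding V (pure_tensor K V V x y)) \<in> lin_hom K V VV"
  using lin_hom_comp[OF pure_tensor_lin_left[OF mods(1,1)] braiding_linear] .

lemma braiding_pure_lin_right:
  "x \<in> carrier V \<Longrightarrow> (\<lambda>y. braiding V (pure_tensor K V V x y)) \<in> lin_hom K V VV"
  using lin_hom_comp[OF pure_tensor_lin_right[OF mods(1,1)] braiding_linear] .

lemma braiding_closed: "t \<in> carrier VV \<Longrightarrow> braiding V t \<in> carrier VV"
  by (rule lin_hom_closed[OF braiding_linear])

lemma braid_left_lin: "braid_left K V \<in> lin_hom K VVV VVV"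
  unfolding braid_left_def by (intro tensor_map_lin mods braiding_linear lin_hom_id)

lemma braid_left_pure:
  "t \<in> carrier VV \<Longrightarrow> z \<in> carrier V \<Longrightarrow>
    braid_left K V (pure_tensor K VV V t z) = pure_tensor K VV V (braiding V t) z"
  unfolding braid_left_def by (simp add: tensor_map_pure mods braiding_linear lin_hom_id)

lemma braid_right_lin: "braid_right K V \<in> lin_hom K VVV VVV"
proof -
  have m: "tensor_map K V VV V VV (\<lambda>x. x) (braiding V) \<in> lin_hom K (tensor K V VV) (tensor K V VV)"
    by (intro tensor_map_lin mods braiding_linear lin_hom_id)
  show ?thesis
    unfolding braid_right_def
    by (rule lin_hom_comp[OF lin_hom_comp[OF tensor_assoc_lin m] tensor_assoc_inv_lin]) (simp_all add: mods)
qed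

text \<open>Braiding the last two factors is transparent in the right bracketing. The inverse
  reassociation stays in the result because \<open>braiding V s\<close> is in general not a pure
  tensor.\<close>

lemma braid_right_assoc_inv:
  assumes "x \<in> carrier V" "s \<in> carrier VV"
  shows "braid_right K V (tensor_assoc_inv K V V V (pure_tensor K V VV x s)) =
    tensor_assoc_inv K V V V (pure_tensor K V VV x (braiding V s))"
  unfolding braid_right_def using assms
  by (simp add: tensor_assoc_assoc_inv mods tensor_map_pure braiding_linear lin_hom_id)

lemma braid_right_pure:
  assumes "x \<in> carrier V" "y \<in> carrier V" "z \<in> carrier V"
  shows "braid_right K V (pure_tensor K VV V (pure_tensor K V V x y) z) =
    tensor_assoc_inv K V V V (pure_tensor K V VV x (braiding V (pure_tensor K V V y z)))"
  using braid_right_assoc_inv[of x "pure_tensor K V V y z"] assms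
  by (simp add: tensor_assoc_inv_pure mods)

lemma braid_middle_lin: "braid_middle K V \<in> lin_hom K (tensor K VV VV) (tensor K VV VV)"
  unfolding braid_middle_def Let_def
  by (rule lin_hom_comp[OF lin_hom_comp[OF tensor_assoc_inv_lin[OF mods(2,1,1)]
        tensor_map_lin[OF mods(3,1,3,1) braid_right_lin lin_hom_id]] tensor_assoc_lin[OF mods(2,1,1)]])

lemmas assoc_inv_lin = tensor_assoc_inv_lin[OF mods(1,1,1)]
lemmas assoc_lin = tensor_assoc_lin[OF mods(1,1,1)]
lemmas assoc_inv_pure = tensor_assoc_inv_pure[OF mods(1,1,1)]
lemmas assoc_pure = tensor_assoc_pure[OF mods(1,1,1)]

end

section \<open>Moving subspaces and ideals through the braiding\<close>

context braided_algebra
begin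

lemma mult_bilinear: "bilinear K A A A (\<lambda>x y. x \<otimes>\<^bsub>A\<^esub> y)"
  by (intro bilinearI lin_homI) (simp_all add: l_distr r_distr smult_mult_left smult_mult_right)

lemma mult_lin: "mult_map K A \<in> lin_hom K VV A"
  unfolding mult_map_def by (intro tensor_lift_lin mods mult_bilinear)

lemma mult_pure: "x \<in> carrier A \<Longrightarrow> y \<in> carrier A \<Longrightarrow> mult_map K A (pure_tensor K A A x y) = x \<otimes>\<^bsub>A\<^esub> y"
  unfolding mult_map_def by (simp add: tensor_lift_pure mods mult_bilinear)

lemma mult_lin_left: "y \<in> carrier A \<Longrightarrow> (\<lambda>x. x \<otimes>\<^bsub>A\<^esub> y) \<in> lin_hom K A A"
  using mult_bilinear by (simp add: bilinear_def)

lemma mult_lin_right: "x \<in> carrier A \<Longrightarrow> (\<lambda>y. x \<otimes>\<^bsub>A\<^esub> y) \<in> lin_hom K A A"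
  using mult_bilinear by (simp add: bilinear_def)

text \<open>For fixed x, \<Psi> is (A \<otimes> m)(c \<otimes> A) applied to x \<otimes> s. It turns
  the axiom for c(m \<otimes> A) into a recursion c(x x' \<otimes> y) = \<Psi>(c(x' \<otimes> y)),
  and its values on pure tensors involve only c(x \<otimes> -). Closure under products can then be
  tested on pure tensors although c(x' \<otimes> y) is not pure.\<close>

lemma braiding_mult_left_factor:
  assumes x: "x \<in> carrier A"
  obtains \<Psi> where "\<Psi> \<in> lin_hom K VV VV"
    and "\<And>y x'. y \<in> carrier A \<Longrightarrow> x' \<in> carrier A \<Longrightarrow> \<Psi> (pure_tensor K A A y x') =
      tensor_map K A A A A (\<lambda>a. a) (\<lambda>a. a \<otimes>\<^bsub>A\<^esub> x') (braiding A (pure_tensor K A A x y))"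
    and "\<And>x' y. x' \<in> carrier A \<Longrightarrow> y \<in> carrier A \<Longrightarrow>
      braiding A (pure_tensor K A A (x \<otimes>\<^bsub>A\<^esub> x') y) = \<Psi> (braiding A (pure_tensor K A A x' y))"
proof -
  let ?m = "tensor_map K A VV A A (\<lambda>a. a) (mult_map K A)"
  have m: "?m \<in> lin_hom K (tensor K A VV) VV" by (intro tensor_map_lin mods mult_lin lin_hom_id)
  define \<Psi> where "\<Psi> s = ?m (tensor_assoc K A A A (braid_left K A
    (tensor_assoc_inv K A A A (pure_tensor K A VV x s))))" for s
  have lin: "\<Psi> \<in> lin_hom K VV VV"
    unfolding \<Psi>_def
    by (rule lin_hom_comp[OF lin_hom_comp[OF lin_hom_comp[OF lin_hom_comp[OF
      pure_tensor_lin_right[OF mods(1,2) x] assoc_inv_lin] braid_left_lin] assoc_lin] m])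
  \<comment> \<open>After reassociation, multiplying the last two factors is right multiplication by
    \<open>x'\<close> on the second factor of \<open>t\<close>.\<close>
  have ml: "?m (tensor_assoc K A A A (pure_tensor K VV A t x')) =
      tensor_map K A A A A (\<lambda>a. a) (\<lambda>a. a \<otimes>\<^bsub>A\<^esub> x') t" if t: "t \<in> carrier VV" and x': "x' \<in> carrier A" for t x'
  proof -
    note r = tensor_map_lin[OF mods(1,1,1,1) lin_hom_id mult_lin_left[OF x']]
    show ?thesis
      using mods(1,1) t
    proof (induction t rule: tensor_induct)
      case (pure u v)
      then show ?case
        using x' by (simp add: assoc_pure tensor_map_pure mods mult_lin lin_hom_id mult_lin_left mult_pure)
    next
      case (add s t)
      then show ?case
        using x' by (simp add: lin_hom_add[OF r] pure_tensor_add_left mods lin_hom_add[OF assoc_lin]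
            lin_hom_add[OF m] lin_hom_closed[OF assoc_lin])
    qed
  qed
  show ?thesis
  proof
    show "\<Psi> \<in> lin_hom K VV VV" by (rule lin)
    show "\<Psi> (pure_tensor K A A y x') =
      tensor_map K A A A A (\<lambda>a. a) (\<lambda>a. a \<otimes>\<^bsub>A\<^esub> x') (braiding A (pure_tensor K A A x y))"
      if "y \<in> carrier A" "x' \<in> carrier A" for y x'
      using that x by (simp add: \<Psi>_def assoc_inv_pure braid_left_pure ml braiding_closed)
    show "braiding A (pure_tensor K A A (x \<otimes>\<^bsub>A\<^esub> x') y) = \<Psi> (braiding A (pure_tensor K A A x' y))"
      if "x' \<in> carrier A" "y \<in> carrier A" for x' y
      using braiding_mult_left[of "pure_tensor K VV A (pure_tensor K A A x x') y"] that x
      by (simp add: \<Psi>_def tensor_map_pure mods mult_lin lin_hom_id mult_pure braid_right_pure)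
  qed
qed

text \<open>The counterpart for c(A \<otimes> m): here the right factor \<open>y'\<close> is fixed
  and \<Psi> is (m \<otimes> A)(A \<otimes> c) applied to s \<otimes> y'.\<close>

lemma braiding_mult_right_factor:
  assumes y': "y' \<in> carrier A"
  obtains \<Psi> where "\<Psi> \<in> lin_hom K VV VV"
    and "\<And>y x. y \<in> carrier A \<Longrightarrow> x \<in> carrier A \<Longrightarrow> \<Psi> (pure_tensor K A A y x) =
      tensor_map K A A A A (\<lambda>a. y \<otimes>\<^bsub>A\<^esub> a) (\<lambda>a. a) (braiding A (pure_tensor K A A x y'))"
    and "\<And>x y. x \<in> carrier A \<Longrightarrow> y \<in> carrier A \<Longrightarrow>
      braiding A (pure_tensor K A A x (y \<otimes>\<^bsub>A\<^esub> y')) = \<Psi> (braiding A (pure_tensor K A A x y))"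
proof -
  let ?m = "tensor_map K VV A A A (mult_map K A) (\<lambda>a. a)"
  have m: "?m \<in> lin_hom K VVV VV" by (intro tensor_map_lin mods mult_lin lin_hom_id)
  define \<Psi> where "\<Psi> s = ?m (braid_right K A (pure_tensor K VV A s y'))" for s
  have lin: "\<Psi> \<in> lin_hom K VV VV"
    unfolding \<Psi>_def
    by (rule lin_hom_comp[OF lin_hom_comp[OF pure_tensor_lin_left[OF mods(2,1) y'] braid_right_lin] m])
  have mr: "?m (tensor_assoc_inv K A A A (pure_tensor K A VV y t)) =
      tensor_map K A A A A (\<lambda>a. y \<otimes>\<^bsub>A\<^esub> a) (\<lambda>a. a) t" if t: "t \<in> carrier VV" and y: "y \<in> carrier A" for t y
  proof -
    note r = tensor_map_lin[OF mods(1,1,1,1) mult_lin_right[OF y] lin_hom_id]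
    show ?thesis
      using mods(1,1) t
    proof (induction t rule: tensor_induct)
      case (pure u v)
      then show ?case
        using y by (simp add: assoc_inv_pure tensor_map_pure mods mult_lin lin_hom_id mult_lin_right mult_pure)
    next
      case (add s t)
      then show ?case
        using y by (simp add: lin_hom_add[OF r] pure_tensor_add_right mods lin_hom_add[OF assoc_inv_lin]
            lin_hom_add[OF m] lin_hom_closed[OF assoc_inv_lin])
    qed
  qed
  show ?thesis
  proof
    show "\<Psi> \<in> lin_hom K VV VV" by (rule lin)
    show "\<Psi> (pure_tensor K A A y x) =
      tensor_map K A A A A (\<lambda>a. y \<otimes>\<^bsub>A\<^esub> a) (\<lambda>a. a) (braiding A (pure_tensor K A A x y'))"
      if "y \<in> carrier A" "x \<in> carrier A" for y x
      using that y' by (simp add: \<Psi>_def braid_right_pure mr braiding_closed)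
    show "braiding A (pure_tensor K A A x (y \<otimes>\<^bsub>A\<^esub> y')) = \<Psi> (braiding A (pure_tensor K A A x y))"
      if "x \<in> carrier A" "y \<in> carrier A" for x y
      using braiding_mult_right[of "pure_tensor K VV A (pure_tensor K A A x y) y'"] that y'
      by (simp add: \<Psi>_def tensor_map_pure mods mult_lin lin_hom_id mult_pure assoc_pure braid_left_pure
          braiding_closed)
  qed
qed

lemma generated_subalgebra_eqD:
  assumes "generated_subalgebra K A S = carrier A" "subring H A" "submodule H K A" "S \<subseteq> H"
  shows "carrier A \<subseteq> H"
proof -
  have "generated_subalgebra K A S \<subseteq> H" unfolding generated_subalgebra_def using assms(2-4) by blast
  then show ?thesis using assms(1) by simp
qed

lemma subringI_submodule:
  assumes H: "submodule H K A" and one: "\<one>\<^bsub>A\<^esub> \<in> H"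
    and mult: "\<And>x y. x \<in> H \<Longrightarrow> y \<in> H \<Longrightarrow> x \<otimes>\<^bsub>A\<^esub> y \<in> H"
  shows "subring H A"
  using submoduleE[OF H] one mult by (intro subringI) auto

text \<open>The elements past which the braiding moves \<open>Z\<close> form a subalgebra.\<close>

lemma braiding_sub_right_generated:
  assumes Z: "submodule Z K A" and gen: "generated_subalgebra K A S = carrier A" and S: "S \<subseteq> carrier A"
    and swap: "\<And>y z. y \<in> S \<Longrightarrow> z \<in> Z \<Longrightarrow>
      braiding A (pure_tensor K A A y z) \<in> tensor_sub K A A Z (carrier A)"
    and y: "y \<in> carrier A" and z: "z \<in> Z"
  shows "braiding A (pure_tensor K A A y z) \<in> tensor_sub K A A Z (carrier A)"
proof -
  note fA = carrier_is_submodule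
  note Zc = submoduleE(1)[OF Z, THEN subsetD]
  let ?T = "tensor_sub K A A Z (carrier A)"
  note T = tensor_sub_submodule[OF mods(1,1) Z fA]
  define H where "H = {y \<in> carrier A. \<forall>z\<in>Z. braiding A (pure_tensor K A A y z) \<in> ?T}"
  have H: "submodule H K A"
    unfolding H_def using z Zc
    by (intro submodule_preimage_family[OF mods(1,2) T] braiding_pure_lin_left) auto
  have "subring H A"
  proof (rule subringI_submodule[OF H])
    show "\<one>\<^bsub>A\<^esub> \<in> H"
      unfolding H_def using Zc tensor_sub_pure[OF mods(1,1) Z fA] by (simp add: braiding_unit_left)
    fix x x' assume x: "x \<in> H" and x': "x' \<in> H"
    then have xc: "x \<in> carrier A" "x' \<in> carrier A" by (auto simp: H_def)
    obtain \<Psi> where \<Psi>: "\<Psi> \<in> lin_hom K VV VV"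
      and \<Psi>_pure: "\<And>y x'. y \<in> carrier A \<Longrightarrow> x' \<in> carrier A \<Longrightarrow> \<Psi> (pure_tensor K A A y x') =
        tensor_map K A A A A (\<lambda>a. a) (\<lambda>a. a \<otimes>\<^bsub>A\<^esub> x') (braiding A (pure_tensor K A A x y))"
      and eq: "\<And>x' y. x' \<in> carrier A \<Longrightarrow> y \<in> carrier A \<Longrightarrow>
        braiding A (pure_tensor K A A (x \<otimes>\<^bsub>A\<^esub> x') y) = \<Psi> (braiding A (pure_tensor K A A x' y))"
      by (rule braiding_mult_left_factor[OF xc(1)]) blast
    \<comment> \<open>\<Psi> preserves Z \<otimes> A: for u in \<open>Z\<close> the tensor c(x
      \<otimes> u) lies in Z \<otimes> A since x is in \<open>H\<close>, and the multiplication by v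
      touches only the second factor.\<close>
    have "\<Psi> t \<in> ?T" if "t \<in> ?T" for t
    proof (rule tensor_sub_image_into[OF mods(1,1,2) Z fA \<Psi> T _ that])
      fix u v assume u: "u \<in> Z" and v: "v \<in> carrier A"
      show "\<Psi> (pure_tensor K A A u v) \<in> ?T"
        unfolding \<Psi>_pure[OF Zc[OF u] v]
        by (rule tensor_map_sub[OF mods(1,1,1,1) Z fA Z fA lin_hom_id mult_lin_left[OF v]])
          (use x u v in \<open>simp_all add: H_def\<close>)
    qed
    then show "x \<otimes>\<^bsub>A\<^esub> x' \<in> H"
      using x x' xc Zc unfolding H_def by (simp add: eq)
  qed
  moreover have "S \<subseteq> H" using S swap by (auto simp: H_def)
  ultimately have "carrier A \<subseteq> H" using generated_subalgebra_eqD[OF gen _ H] by blast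
  then show ?thesis using y z by (auto simp: H_def)
qed

text \<open>The same closure argument with \<open>Z\<close> on the other side, so the product to be
  resolved sits in the right factor and \<open>braiding_mult_right_factor\<close> applies.\<close>

lemma braiding_sub_left_generated:
  assumes Z: "submodule Z K A" and gen: "generated_subalgebra K A S = carrier A" and S: "S \<subseteq> carrier A"
    and swap: "\<And>y z. y \<in> S \<Longrightarrow> z \<in> Z \<Longrightarrow>
      braiding A (pure_tensor K A A z y) \<in> tensor_sub K A A (carrier A) Z"
    and y: "y \<in> carrier A" and z: "z \<in> Z"
  shows "braiding A (pure_tensor K A A z y) \<in> tensor_sub K A A (carrier A) Z"
proof -
  note fA = carrier_is_submodule
  note Zc = submoduleE(1)[OF Z, THEN subsetD]
  let ?T = "tensor_sub K A A (carrier A) Z"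
  note T = tensor_sub_submodule[OF mods(1,1) fA Z]
  define H where "H = {y \<in> carrier A. \<forall>z\<in>Z. braiding A (pure_tensor K A A z y) \<in> ?T}"
  have H: "submodule H K A"
    unfolding H_def using z Zc
    by (intro submodule_preimage_family[OF mods(1,2) T] braiding_pure_lin_right) auto
  have "subring H A"
  proof (rule subringI_submodule[OF H])
    show "\<one>\<^bsub>A\<^esub> \<in> H"
      unfolding H_def using Zc tensor_sub_pure[OF mods(1,1) fA Z] by (simp add: braiding_unit_right)
    fix x y' assume x: "x \<in> H" and y': "y' \<in> H"
    then have xc: "x \<in> carrier A" "y' \<in> carrier A" by (auto simp: H_def)
    obtain \<Psi> where \<Psi>: "\<Psi> \<in> lin_hom K VV VV"
      and \<Psi>_pure: "\<And>y x. y \<in> carrier A \<Longrightarrow> x \<in> carrier A \<Longrightarrow> \<Psi> (pure_tensor K A A y x) =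
        tensor_map K A A A A (\<lambda>a. y \<otimes>\<^bsub>A\<^esub> a) (\<lambda>a. a) (braiding A (pure_tensor K A A x y'))"
      and eq: "\<And>x y. x \<in> carrier A \<Longrightarrow> y \<in> carrier A \<Longrightarrow>
        braiding A (pure_tensor K A A x (y \<otimes>\<^bsub>A\<^esub> y')) = \<Psi> (braiding A (pure_tensor K A A x y))"
      by (rule braiding_mult_right_factor[OF xc(2)]) blast
    have "\<Psi> t \<in> ?T" if "t \<in> ?T" for t
    proof (rule tensor_sub_image_into[OF mods(1,1,2) fA Z \<Psi> T _ that])
      fix u v assume u: "u \<in> carrier A" and v: "v \<in> Z"
      show "\<Psi> (pure_tensor K A A u v) \<in> ?T"
        unfolding \<Psi>_pure[OF u Zc[OF v]]
        by (rule tensor_map_sub[OF mods(1,1,1,1) fA Z fA Z mult_lin_right[OF u] lin_hom_id])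
          (use y' u v in \<open>simp_all add: H_def\<close>)
    qed
    then show "x \<otimes>\<^bsub>A\<^esub> y' \<in> H"
      using x xc Zc unfolding H_def by (simp add: eq)
  qed
  moreover have "S \<subseteq> H" using S swap by (auto simp: H_def)
  ultimately have "carrier A \<subseteq> H" using generated_subalgebra_eqD[OF gen _ H] by blast
  then show ?thesis using y z by (auto simp: H_def)
qed

text \<open>Scalars act as multiplication by \<open>a \<odot> \<one>\<close>, so absorption of ring
  elements already gives closure under scalars.\<close>

lemma ideal_submodule:
  assumes "ideal I A"
  shows "submodule I K A"
proof -
  interpret I: ideal I A by fact
  show ?thesis
  proof (rule submoduleI)
    show "a \<odot>\<^bsub>A\<^esub> x \<in> I" if a: "a \<in> carrier K" and x: "x \<in> I" for a x
    proof -
      have xc: "x \<in> carrier A" using x by (rule I.a_Hcarr)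
      have "(a \<odot>\<^bsub>A\<^esub> \<one>\<^bsub>A\<^esub>) \<otimes>\<^bsub>A\<^esub> x \<in> I" using a x by (intro I.I_l_closed) auto
      then show ?thesis using a xc by (simp add: smult_mult_left)
    qed
  qed (use I.a_subset I.a_closed in auto)
qed

lemma submodule_idealI:
  assumes "submodule I K A"
    and "\<And>a x. a \<in> I \<Longrightarrow> x \<in> carrier A \<Longrightarrow> x \<otimes>\<^bsub>A\<^esub> a \<in> I"
    and "\<And>a x. a \<in> I \<Longrightarrow> x \<in> carrier A \<Longrightarrow> a \<otimes>\<^bsub>A\<^esub> x \<in> I"
  shows "ideal I A"
  using assms by (intro idealI ring_axioms) (auto simp: submodule_def)

text \<open>The elements that the braiding moves into the ideal form an ideal themselves.\<close>

lemma braiding_ideal_left: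
  assumes D: "D \<subseteq> carrier A"
    and swap: "\<And>d y. d \<in> D \<Longrightarrow> y \<in> carrier A \<Longrightarrow>
      braiding A (pure_tensor K A A d y) \<in> tensor_sub K A A (carrier A) (Idl\<^bsub>A\<^esub> D)"
    and x: "x \<in> Idl\<^bsub>A\<^esub> D" and y: "y \<in> carrier A"
  shows "braiding A (pure_tensor K A A x y) \<in> tensor_sub K A A (carrier A) (Idl\<^bsub>A\<^esub> D)"
proof -
  let ?I = "Idl\<^bsub>A\<^esub> D"
  note fA = carrier_is_submodule
  note I = genideal_ideal[OF D]
  interpret I: ideal ?I A by (rule I)
  note Is = ideal_submodule[OF I]
  let ?T = "tensor_sub K A A (carrier A) ?I"
  note T = tensor_sub_submodule[OF mods(1,1) fA Is]
  define J where "J = {x \<in> carrier A. \<forall>y\<in>carrier A. braiding A (pure_tensor K A A x y) \<in> ?T}"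
  have J: "submodule J K A"
    unfolding J_def using y by (intro submodule_preimage_family[OF mods(1,2) T] braiding_pure_lin_left) auto
  have mult: "x \<otimes>\<^bsub>A\<^esub> x' \<in> J"
    if xc: "x \<in> carrier A" "x' \<in> carrier A" and x: "x \<in> J \<or> x' \<in> J" for x x'
  proof -
    obtain \<Psi> where \<Psi>: "\<Psi> \<in> lin_hom K VV VV"
      and \<Psi>_pure: "\<And>y x'. y \<in> carrier A \<Longrightarrow> x' \<in> carrier A \<Longrightarrow> \<Psi> (pure_tensor K A A y x') =
        tensor_map K A A A A (\<lambda>a. a) (\<lambda>a. a \<otimes>\<^bsub>A\<^esub> x') (braiding A (pure_tensor K A A x y))"
      and eq: "\<And>x' y. x' \<in> carrier A \<Longrightarrow> y \<in> carrier A \<Longrightarrow>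
        braiding A (pure_tensor K A A (x \<otimes>\<^bsub>A\<^esub> x') y) = \<Psi> (braiding A (pure_tensor K A A x' y))"
      by (rule braiding_mult_left_factor[OF xc(1)]) blast
    have "\<Psi> (braiding A (pure_tensor K A A x' y)) \<in> ?T" if y: "y \<in> carrier A" for y
    \<comment> \<open>If x is in \<open>J\<close>, then c(x \<otimes> u) already lies in A \<otimes>
      I and right multiplication by v keeps it there. If x' is in \<open>J\<close>, then v can be
      taken in the ideal, and multiplication by v moves any second factor into it.\<close>
    proof (cases "x \<in> J")
      case True
      have "braiding A (pure_tensor K A A x' y) \<in> tensor_sub K A A (carrier A) (carrier A)"
        using xc y by (simp add: tensor_sub_full mods braiding_closed)
      then show ?thesis
      proof (rule tensor_sub_image_into[OF mods(1,1,2) fA fA \<Psi> T, rotated])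
        fix u v assume u: "u \<in> carrier A" and v: "v \<in> carrier A"
        show "\<Psi> (pure_tensor K A A u v) \<in> ?T"
          unfolding \<Psi>_pure[OF u v]
          by (rule tensor_map_sub[OF mods(1,1,1,1) fA Is fA Is lin_hom_id mult_lin_left[OF v]])
            (use True u v I.I_r_closed in \<open>simp_all add: J_def\<close>)
      qed
    next
      case False
      then have "x' \<in> J" using x by blast
      then have "braiding A (pure_tensor K A A x' y) \<in> ?T" using y by (simp add: J_def)
      then show ?thesis
      proof (rule tensor_sub_image_into[OF mods(1,1,2) fA Is \<Psi> T, rotated])
        fix u v assume u: "u \<in> carrier A" and v: "v \<in> ?I"
        have vc: "v \<in> carrier A" using v by (rule I.a_Hcarr)
        show "\<Psi> (pure_tensor K A A u v) \<in> ?T"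
          unfolding \<Psi>_pure[OF u vc]
          by (rule tensor_map_into_sub[OF mods(1,1,1,1) fA Is lin_hom_id mult_lin_left[OF vc]])
            (use xc u v I.I_l_closed in \<open>simp_all add: braiding_closed\<close>)
      qed
    qed
    then show ?thesis using xc by (simp add: J_def eq)
  qed
  have "ideal J A"
    by (rule submodule_idealI[OF J]) (use mult in \<open>auto simp: J_def\<close>)
  moreover have "D \<subseteq> J" using D swap by (auto simp: J_def)
  ultimately have "?I \<subseteq> J" by (rule genideal_minimal)
  then show ?thesis using x y by (auto simp: J_def)
qed

text \<open>The mirror case. The product now sits in the right factor, so x' determines \<Psi> and
  the two cases exchange their roles.\<close>

lemma braiding_ideal_right:
  assumes D: "D \<subseteq> carrier A"
    and swap: "\<And>d y. d \<in> D \<Longrightarrow> y \<in> carrier A \<Longrightarrow>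
      braiding A (pure_tensor K A A y d) \<in> tensor_sub K A A (Idl\<^bsub>A\<^esub> D) (carrier A)"
    and x: "x \<in> Idl\<^bsub>A\<^esub> D" and y: "y \<in> carrier A"
  shows "braiding A (pure_tensor K A A y x) \<in> tensor_sub K A A (Idl\<^bsub>A\<^esub> D) (carrier A)"
proof -
  let ?I = "Idl\<^bsub>A\<^esub> D"
  note fA = carrier_is_submodule
  note I = genideal_ideal[OF D]
  interpret I: ideal ?I A by (rule I)
  note Is = ideal_submodule[OF I]
  let ?T = "tensor_sub K A A ?I (carrier A)"
  note T = tensor_sub_submodule[OF mods(1,1) Is fA]
  define J where "J = {x \<in> carrier A. \<forall>y\<in>carrier A. braiding A (pure_tensor K A A y x) \<in> ?T}"
  have J: "submodule J K A"
    unfolding J_def using y by (intro submodule_preimage_family[OF mods(1,2) T] braiding_pure_lin_right) auto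
  have mult: "x \<otimes>\<^bsub>A\<^esub> x' \<in> J"
    if xc: "x \<in> carrier A" "x' \<in> carrier A" and x: "x \<in> J \<or> x' \<in> J" for x x'
  proof -
    obtain \<Psi> where \<Psi>: "\<Psi> \<in> lin_hom K VV VV"
      and \<Psi>_pure: "\<And>y u. y \<in> carrier A \<Longrightarrow> u \<in> carrier A \<Longrightarrow> \<Psi> (pure_tensor K A A y u) =
        tensor_map K A A A A (\<lambda>a. y \<otimes>\<^bsub>A\<^esub> a) (\<lambda>a. a) (braiding A (pure_tensor K A A u x'))"
      and eq: "\<And>u y. u \<in> carrier A \<Longrightarrow> y \<in> carrier A \<Longrightarrow>
        braiding A (pure_tensor K A A u (y \<otimes>\<^bsub>A\<^esub> x')) = \<Psi> (braiding A (pure_tensor K A A u y))"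
      by (rule braiding_mult_right_factor[OF xc(2)]) blast
    have "\<Psi> (braiding A (pure_tensor K A A y x)) \<in> ?T" if y: "y \<in> carrier A" for y
    proof (cases "x' \<in> J")
      case True
      have "braiding A (pure_tensor K A A y x) \<in> tensor_sub K A A (carrier A) (carrier A)"
        using xc y by (simp add: tensor_sub_full mods braiding_closed)
      then show ?thesis
      proof (rule tensor_sub_image_into[OF mods(1,1,2) fA fA \<Psi> T, rotated])
        fix u v assume u: "u \<in> carrier A" and v: "v \<in> carrier A"
        show "\<Psi> (pure_tensor K A A u v) \<in> ?T"
          unfolding \<Psi>_pure[OF u v]
          by (rule tensor_map_sub[OF mods(1,1,1,1) Is fA Is fA mult_lin_right[OF u] lin_hom_id])
            (use True u v I.I_l_closed in \<open>simp_all add: J_def\<close>)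
      qed
    next
      case False
      then have "x \<in> J" using x by blast
      then have "braiding A (pure_tensor K A A y x) \<in> ?T" using y by (simp add: J_def)
      then show ?thesis
      proof (rule tensor_sub_image_into[OF mods(1,1,2) Is fA \<Psi> T, rotated])
        fix u v assume u: "u \<in> ?I" and v: "v \<in> carrier A"
        have uc: "u \<in> carrier A" using u by (rule I.a_Hcarr)
        show "\<Psi> (pure_tensor K A A u v) \<in> ?T"
          unfolding \<Psi>_pure[OF uc v]
          by (rule tensor_map_into_sub[OF mods(1,1,1,1) Is fA mult_lin_right[OF uc] lin_hom_id])
            (use xc u v I.I_r_closed in \<open>simp_all add: braiding_closed\<close>)
      qed
    qed
    then show ?thesis using xc by (simp add: J_def eq)
  qed
  have "ideal J A"
    by (rule submodule_idealI[OF J]) (use mult in \<open>auto simp: J_def\<close>)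
  moreover have "D \<subseteq> J" using D swap by (auto simp: J_def)
  ultimately have "?I \<subseteq> J" by (rule genideal_minimal)
  then show ?thesis using x y by (auto simp: J_def)
qed

end

lemma (in cring) tensor_sub_mono:
  assumes M: "module R M" "module R N" and X: "submodule X R M" "submodule Y R N"
    and X': "submodule X' R M" "submodule Y' R N" and le: "X \<subseteq> X'" "Y \<subseteq> Y'"
  shows "tensor_sub R M N X Y \<subseteq> tensor_sub R M N X' Y'"
proof
  fix t assume "t \<in> tensor_sub R M N X Y"
  then show "t \<in> tensor_sub R M N X' Y'"
    by (rule tensor_sub_image_into[OF M tensor_is_module[OF M] X lin_hom_id tensor_sub_submodule[OF M X'], rotated])
      (use le M X' in \<open>auto intro: tensor_sub_pure\<close>)
qed

text \<open>Tensor products depend only on carrier, zero, addition and scalar multiplication.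
  Records that differ in product or braiding yield the very same sets, which allows structures on
  one vector space to be compared by plain equality.\<close>

lemma tensor_same_vector_space:
  assumes "same_vector_space M M'" "same_vector_space N N'"
  shows "tensor K M N = tensor K M' N'" "pure_tensor K M N = pure_tensor K M' N'"
  using assms
  unfolding tensor_def pure_tensor_def tensor_null_def bilinear_relations_def same_vector_space_def
  by simp_all

lemma lin_hom_same_vector_space:
  assumes "same_vector_space M M'" "same_vector_space N N'"
  shows "lin_hom K M N = lin_hom K M' N'"
  using assms unfolding lin_hom_def same_vector_space_def by simp

lemma same_vector_space_refl: "same_vector_space M M"
  by (simp add: same_vector_space_def)

lemma tensor_lift_same_vector_space:
  assumes "same_vector_space M M'" "same_vector_space N N'" "same_vector_space L L'"
  shows "tensor_lift K M N L = tensor_lift K M' N' L'"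
  unfolding tensor_lift_def tensor_same_vector_space[OF assms(1,2)]
    lin_hom_same_vector_space[OF same_vector_space_refl assms(3)]
  using assms(1,2) by (simp add: same_vector_space_def)

lemma tensor_map_same_vector_space:
  assumes "same_vector_space M M'" "same_vector_space N N'" "same_vector_space L L'" "same_vector_space H H'"
  shows "tensor_map K M N L H = tensor_map K M' N' L' H'"
  unfolding tensor_map_def tensor_same_vector_space[OF assms(3,4)]
    tensor_lift_same_vector_space[OF assms(1,2) same_vector_space_refl] by simp

context braided_vector_space
begin

text \<open>\<open>swap\<close> places the braided tensor in the range of the embedding, and only
  then is the \<open>inv_into\<close> in \<open>braiding_on\<close> a true preimage. Each restricted
  braiding below needs such an inclusion first.\<close>

lemma braiding_on_incl:
  assumes X: "submodule X K V" and Y: "submodule Y K V"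
    and swap: "\<And>x y. x \<in> X \<Longrightarrow> y \<in> Y \<Longrightarrow> braiding V (pure_tensor K V V x y) \<in> tensor_sub K V V Y X"
    and t: "t \<in> carrier (tensor K (V\<lparr>carrier := X\<rparr>) (V\<lparr>carrier := Y\<rparr>))"
  shows "braiding_on K V X Y t \<in> carrier (tensor K (V\<lparr>carrier := Y\<rparr>) (V\<lparr>carrier := X\<rparr>))"
    and "tensor_map K (V\<lparr>carrier := Y\<rparr>) (V\<lparr>carrier := X\<rparr>) V V (\<lambda>x. x) (\<lambda>x. x) (braiding_on K V X Y t) =
      braiding V (tensor_map K (V\<lparr>carrier := X\<rparr>) (V\<lparr>carrier := Y\<rparr>) V V (\<lambda>x. x) (\<lambda>x. x) t)"
proof -
  let ?i = "tensor_map K (V\<lparr>carrier := Y\<rparr>) (V\<lparr>carrier := X\<rparr>) V V (\<lambda>x. x) (\<lambda>x. x)"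
  let ?j = "tensor_map K (V\<lparr>carrier := X\<rparr>) (V\<lparr>carrier := Y\<rparr>) V V (\<lambda>x. x) (\<lambda>x. x)"
  let ?C = "carrier (tensor K (V\<lparr>carrier := Y\<rparr>) (V\<lparr>carrier := X\<rparr>))"
  have "?j t \<in> tensor_sub K V V X Y" unfolding tensor_sub_def using t by blast
  then have "braiding V (?j t) \<in> tensor_sub K V V Y X"
    by (rule tensor_sub_image_into[OF mods(1,1,2) X Y braiding_linear
        tensor_sub_submodule[OF mods(1,1) Y X] swap, rotated 2])
  then have im: "braiding V (?j t) \<in> ?i ` ?C" by (simp add: tensor_sub_def)
  have eq: "braiding_on K V X Y t = inv_into ?C ?i (braiding V (?j t))"
    by (simp add: braiding_on_def Let_def)
  show "braiding_on K V X Y t \<in> ?C" unfolding eq by (rule inv_into_into[OF im])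
  show "?i (braiding_on K V X Y t) = braiding V (?j t)" unfolding eq by (rule f_inv_into_f[OF im])
qed

end

section \<open>Primitive elements under the braiding\<close>

context braided_bialgebra
begin

lemma primitive_coproduct_lin:
  "(\<lambda>x. pure_tensor K B B x \<one>\<^bsub>B\<^esub> \<oplus>\<^bsub>VV\<^esub> pure_tensor K B B \<one>\<^bsub>B\<^esub> x) \<in> lin_hom K B VV"
  by (intro lin_hom_plus mods pure_tensor_lin_left pure_tensor_lin_right one_closed)

lemma primitives_submodule: "submodule (primitives K B) K B"
  unfolding primitives_def
  by (rule submodule_equalizer[OF mods(1,2) comult_linear primitive_coproduct_lin])

lemma primitives_closed: "x \<in> primitives K B \<Longrightarrow> x \<in> carrier B"
  by (simp add: primitives_def)

lemma comult_closed: "x \<in> carrier B \<Longrightarrow> comult B x \<in> carrier VV"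
  by (rule lin_hom_closed[OF comult_linear])

text \<open>
  For primitive \<open>x\<close>, the compatibility of the comultiplication with the braiding, evaluated at
  \<open>x \<otimes> y\<close>, says that the second factor of its image lies in the equalizer defining the primitives.
\<close>

lemma braiding_primitive_left:
  assumes x: "x \<in> primitives K B" and y: "y \<in> carrier B"
  shows "braiding B (pure_tensor K B B x y) \<in> tensor_sub K B B (carrier B) (primitives K B)"
proof -
  have xc: "x \<in> carrier B" by (rule primitives_closed[OF x])
  interpret T: module K VVV by (rule mods)
  let ?p = "pure_tensor K B B"
  let ?g = "\<lambda>x. ?p x \<one>\<^bsub>B\<^esub> \<oplus>\<^bsub>VV\<^esub> ?p \<one>\<^bsub>B\<^esub> x"
  let ?r = "tensor_assoc_inv K B B B"
  note g = primitive_coproduct_lin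
  note gl = tensor_map_lin[OF mods(1,1,1,2) lin_hom_id g] and cl = tensor_map_lin[OF mods(1,1,1,2) lin_hom_id comult_linear]
  define s where "s = braiding B (?p x y)"
  have s: "s \<in> carrier VV" unfolding s_def using xc y by (intro braiding_closed) simp
  \<comment> \<open>Since c(1 \<otimes> v) = v \<otimes> 1, the two terms that come from x \<otimes>
    1 + 1 \<otimes> x reassemble, for an arbitrary tensor u, into the primitive coproduct applied to
    its second factor.\<close>
  have 1: "pure_tensor K VV B u \<one>\<^bsub>B\<^esub> \<oplus>\<^bsub>VVV\<^esub> braid_left K B (?r (pure_tensor K B VV \<one>\<^bsub>B\<^esub> u)) =
      ?r (tensor_map K B B B VV (\<lambda>x. x) ?g u)" if "u \<in> carrier VV" for u
    using mods(1,1) that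
  proof (induction u rule: tensor_induct)
    case (pure v w)
    then show ?case
      by (simp add: tensor_map_pure[OF mods(1,1,1,2) lin_hom_id g] pure_tensor_add_right mods
          lin_hom_add[OF assoc_inv_lin] assoc_inv_pure braid_left_pure braiding_unit_left)
  next
    case (add u u')
    have "pure_tensor K VV B (u \<oplus>\<^bsub>VV\<^esub> u') \<one>\<^bsub>B\<^esub> \<oplus>\<^bsub>VVV\<^esub> braid_left K B (?r (pure_tensor K B VV \<one>\<^bsub>B\<^esub> (u \<oplus>\<^bsub>VV\<^esub> u'))) =
      (pure_tensor K VV B u \<one>\<^bsub>B\<^esub> \<oplus>\<^bsub>VVV\<^esub> braid_left K B (?r (pure_tensor K B VV \<one>\<^bsub>B\<^esub> u))) \<oplus>\<^bsub>VVV\<^esub>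
      (pure_tensor K VV B u' \<one>\<^bsub>B\<^esub> \<oplus>\<^bsub>VVV\<^esub> braid_left K B (?r (pure_tensor K B VV \<one>\<^bsub>B\<^esub> u')))"
      using add(1,2)
      by (simp add: pure_tensor_add_left pure_tensor_add_right mods lin_hom_add[OF assoc_inv_lin]
          lin_hom_add[OF braid_left_lin] lin_hom_closed[OF assoc_inv_lin] lin_hom_closed[OF braid_left_lin]
          T.a_ac)
    then show ?case
      unfolding add(3,4) using add(1,2)
      by (simp add: lin_hom_add[OF gl] lin_hom_add[OF assoc_inv_lin] lin_hom_closed[OF gl])
  qed
  have "?r (tensor_map K B B B VV (\<lambda>x. x) (comult B) s) = comult_right K B s"
    by (simp add: comult_right_def)
  \<comment> \<open>The axiom (B \<otimes> \<Delta>) c = (c \<otimes> B)(B \<otimes> c)(\<Delta>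
    \<otimes> B), into which the coproduct of the primitive x is then substituted.\<close>
  also have "\<dots> = braid_left K B (braid_right K B (comult_left K B (?p x y)))"
    unfolding s_def using xc y by (intro comult_right_braiding) simp
  also have "comult_left K B (?p x y) = pure_tensor K VV B (?g x) y"
    using x xc y by (simp add: comult_left_def tensor_map_pure mods comult_linear lin_hom_id primitives_def)
  also have "\<dots> = pure_tensor K VV B (?p x \<one>\<^bsub>B\<^esub>) y \<oplus>\<^bsub>VVV\<^esub> pure_tensor K VV B (?p \<one>\<^bsub>B\<^esub> x) y"
    using xc y by (simp add: pure_tensor_add_left mods)
  also have "braid_right K B \<dots> = pure_tensor K VV B (?p x y) \<one>\<^bsub>B\<^esub> \<oplus>\<^bsub>VVV\<^esub> ?r (pure_tensor K B VV \<one>\<^bsub>B\<^esub> s)"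
    using xc y by (simp add: lin_hom_add[OF braid_right_lin] braid_right_pure braiding_unit_left assoc_inv_pure s_def)
  also have "braid_left K B \<dots> = pure_tensor K VV B s \<one>\<^bsub>B\<^esub> \<oplus>\<^bsub>VVV\<^esub> braid_left K B (?r (pure_tensor K B VV \<one>\<^bsub>B\<^esub> s))"
    using xc y s by (simp add: lin_hom_add[OF braid_left_lin] braid_left_pure lin_hom_closed[OF assoc_inv_lin] s_def)
  also have "\<dots> = ?r (tensor_map K B B B VV (\<lambda>x. x) ?g s)" by (rule 1[OF s])
  finally have "tensor_assoc K B B B (?r (tensor_map K B B B VV (\<lambda>x. x) (comult B) s)) =
    tensor_assoc K B B B (?r (tensor_map K B B B VV (\<lambda>x. x) ?g s))" by simp
  then have "tensor_map K B B B VV (\<lambda>x. x) (comult B) s = tensor_map K B B B VV (\<lambda>x. x) ?g s"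
    using s lin_hom_closed[OF gl] lin_hom_closed[OF cl] by (simp add: tensor_assoc_assoc_inv mods)
  then have "s \<in> tensor_sub K B B (carrier B) {y \<in> carrier B. comult B y = ?g y}"
    by (rule tensor_sub_equalizer[OF mods(1,1,2) comult_linear g s])
  then show ?thesis by (simp add: s_def primitives_def)
qed

text \<open>The mirror argument from (\<Delta> \<otimes> B) c = (B \<otimes> c)(c \<otimes> B)(B
  \<otimes> \<Delta>). Both sides are left-bracketed at the end, so the left equalizer applies
  without removing a reassociation.\<close>

lemma braiding_primitive_right:
  assumes x: "x \<in> primitives K B" and y: "y \<in> carrier B"
  shows "braiding B (pure_tensor K B B y x) \<in> tensor_sub K B B (primitives K B) (carrier B)"
proof -
  have xc: "x \<in> carrier B" by (rule primitives_closed[OF x])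
  interpret T: module K VVV by (rule mods)
  let ?p = "pure_tensor K B B"
  let ?g = "\<lambda>x. ?p x \<one>\<^bsub>B\<^esub> \<oplus>\<^bsub>VV\<^esub> ?p \<one>\<^bsub>B\<^esub> x"
  let ?r = "tensor_assoc_inv K B B B"
  note g = primitive_coproduct_lin
  note gl = tensor_map_lin[OF mods(1,1,2,1) g lin_hom_id]
  define s where "s = braiding B (?p y x)"
  have s: "s \<in> carrier VV" unfolding s_def using xc y by (intro braiding_closed) simp
  have 1: "braid_right K B (pure_tensor K VV B u \<one>\<^bsub>B\<^esub>) \<oplus>\<^bsub>VVV\<^esub> ?r (pure_tensor K B VV \<one>\<^bsub>B\<^esub> u) =
      tensor_map K B B VV B ?g (\<lambda>x. x) u" if "u \<in> carrier VV" for u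
    using mods(1,1) that
  proof (induction u rule: tensor_induct)
    case (pure v w)
    then show ?case
      by (simp add: tensor_map_pure[OF mods(1,1,2,1) g lin_hom_id] pure_tensor_add_left mods
          assoc_inv_pure braid_right_pure braiding_unit_right)
  next
    case (add u u')
    have "braid_right K B (pure_tensor K VV B (u \<oplus>\<^bsub>VV\<^esub> u') \<one>\<^bsub>B\<^esub>) \<oplus>\<^bsub>VVV\<^esub> ?r (pure_tensor K B VV \<one>\<^bsub>B\<^esub> (u \<oplus>\<^bsub>VV\<^esub> u')) =
      (braid_right K B (pure_tensor K VV B u \<one>\<^bsub>B\<^esub>) \<oplus>\<^bsub>VVV\<^esub> ?r (pure_tensor K B VV \<one>\<^bsub>B\<^esub> u)) \<oplus>\<^bsub>VVV\<^esub>
      (braid_right K B (pure_tensor K VV B u' \<one>\<^bsub>B\<^esub>) \<oplus>\<^bsub>VVV\<^esub> ?r (pure_tensor K B VV \<one>\<^bsub>B\<^esub> u'))"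
      using add(1,2)
      by (simp add: pure_tensor_add_left pure_tensor_add_right mods lin_hom_add[OF assoc_inv_lin]
          lin_hom_add[OF braid_right_lin] lin_hom_closed[OF assoc_inv_lin] lin_hom_closed[OF braid_right_lin]
          T.a_ac)
    then show ?case
      unfolding add(3,4) using add(1,2) by (simp add: lin_hom_add[OF gl])
  qed
  have "tensor_map K B B VV B (comult B) (\<lambda>x. x) s = comult_left K B s"
    by (simp add: comult_left_def)
  also have "\<dots> = braid_right K B (braid_left K B (comult_right K B (?p y x)))"
    unfolding s_def using xc y by (intro comult_left_braiding) simp
  also have "comult_right K B (?p y x) = ?r (pure_tensor K B VV y (?g x))"
    using x xc y by (simp add: comult_right_def tensor_map_pure mods comult_linear lin_hom_id primitives_def)
  also have "\<dots> = pure_tensor K VV B (?p y x) \<one>\<^bsub>B\<^esub> \<oplus>\<^bsub>VVV\<^esub> pure_tensor K VV B (?p y \<one>\<^bsub>B\<^esub>) x"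
    using xc y by (simp add: pure_tensor_add_right mods lin_hom_add[OF assoc_inv_lin] assoc_inv_pure)
  also have "braid_left K B \<dots> = pure_tensor K VV B s \<one>\<^bsub>B\<^esub> \<oplus>\<^bsub>VVV\<^esub> pure_tensor K VV B (?p \<one>\<^bsub>B\<^esub> y) x"
    using xc y by (simp add: lin_hom_add[OF braid_left_lin] braid_left_pure braiding_unit_right s_def)
  also have "braid_right K B \<dots> = braid_right K B (pure_tensor K VV B s \<one>\<^bsub>B\<^esub>) \<oplus>\<^bsub>VVV\<^esub> ?r (pure_tensor K B VV \<one>\<^bsub>B\<^esub> s)"
    using xc y s by (simp add: lin_hom_add[OF braid_right_lin] braid_right_pure s_def)
  also have "\<dots> = tensor_map K B B VV B ?g (\<lambda>x. x) s" by (rule 1[OF s])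
  finally have "s \<in> tensor_sub K B B {y \<in> carrier B. comult B y = ?g y} (carrier B)"
    by (rule tensor_sub_equalizer_left[OF mods(1,1,2) comult_linear g s])
  then show ?thesis by (simp add: s_def primitives_def)
qed

text \<open>Each primitive confines one factor, and the two inclusions intersect in P \<otimes> P.
  This makes the braiding of \<open>infinitesimal_part\<close> a true restriction.\<close>

lemma braiding_primitives:
  assumes x: "x \<in> primitives K B" and y: "y \<in> primitives K B"
  shows "braiding B (pure_tensor K B B x y) \<in> tensor_sub K B B (primitives K B) (primitives K B)"
  by (rule tensor_sub_Int[OF mods(1,1) primitives_submodule primitives_submodule
      braiding_primitive_right[OF y primitives_closed[OF x]] braiding_primitive_left[OF x primitives_closed[OF y]]])

end

section \<open>Braiding primitives with the image of \<gamma>\<close>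

context vc_bialgebra
begin

abbreviation "PB \<equiv> primitives K B"
abbreviation "GV \<equiv> \<gamma> ` carrier V"

lemma infinitesimal_same: "same_vector_space (infinitesimal_part K B) (B\<lparr>carrier := PB\<rparr>)"
  by (simp add: same_vector_space_def infinitesimal_part_def)

lemma gamma_lin_primitives: "\<gamma> \<in> lin_hom K V (B\<lparr>carrier := PB\<rparr>)"
  using gamma_hom
  by (simp add: braided_hom_def lin_hom_same_vector_space[OF same_vector_space_refl infinitesimal_same])

lemma gamma_lin: "\<gamma> \<in> lin_hom K V B"
  by (rule lin_hom_widen[OF B.mods(1) B.primitives_submodule gamma_lin_primitives])

lemma gamma_primitive: "v \<in> carrier V \<Longrightarrow> \<gamma> v \<in> PB"
  using lin_hom_closed[OF gamma_lin_primitives] by simp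

lemma gamma_image_submodule: "submodule GV K B"
  by (rule submodule_image[OF V.mods(1) B.mods(1) gamma_lin])

lemma gamma_image_closed: "g \<in> GV \<Longrightarrow> g \<in> carrier B"
  using lin_hom_closed[OF gamma_lin] by auto

text \<open>The hypothesis on \<gamma> is an equation in P \<otimes> P with a restricted braiding;
  applying the embedding into B \<otimes> B replaces that braiding by c.\<close>

lemma gamma_braiding:
  assumes t: "t \<in> carrier (tensor K V V)"
  shows "braiding B (tensor_map K V V B B \<gamma> \<gamma> t) = tensor_map K V V B B \<gamma> \<gamma> (braiding V t)"
proof -
  let ?P = "B\<lparr>carrier := PB\<rparr>"
  let ?i = "tensor_map K ?P ?P B B (\<lambda>x. x) (\<lambda>x. x)"
  let ?g = "tensor_map K V V ?P ?P \<gamma> \<gamma>"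
  note P = submodule_module[OF B.mods(1) B.primitives_submodule]
  note i = submodule_incl_lin[OF B.mods(1) B.primitives_submodule]
  note gl = V.tensor_map_lin[OF V.mods(1,1) P P gamma_lin_primitives gamma_lin_primitives]
  have comp: "?i (?g s) = tensor_map K V V B B \<gamma> \<gamma> s" if "s \<in> carrier (tensor K V V)" for s
    by (rule V.tensor_map_comp[OF V.mods(1,1) P P B.mods(1,1) gamma_lin_primitives gamma_lin_primitives i i that])
  have "braiding (infinitesimal_part K B) (?g t) = ?g (braiding V t)"
    using gamma_hom t
    by (simp add: braided_hom_def tensor_map_same_vector_space[OF same_vector_space_refl
          same_vector_space_refl infinitesimal_same infinitesimal_same])
  then have "braiding_on K B PB PB (?g t) = ?g (braiding V t)"
    by (simp add: infinitesimal_part_def)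
  then have "?i (braiding_on K B PB PB (?g t)) = ?i (?g (braiding V t))" by simp
  then show ?thesis
    using B.braiding_on_incl(2)[OF B.primitives_submodule B.primitives_submodule B.braiding_primitives
        lin_hom_closed[OF gl t]]
    by (simp add: comp t V.braiding_closed)
qed

lemma braiding_gamma_image:
  assumes "g \<in> GV" "h \<in> GV"
  shows "braiding B (pure_tensor K B B g h) \<in> tensor_sub K B B GV GV"
proof -
  obtain v w where vw: "v \<in> carrier V" "w \<in> carrier V" "g = \<gamma> v" "h = \<gamma> w" using assms by blast
  have "braiding B (pure_tensor K B B g h) =
    tensor_map K V V B B \<gamma> \<gamma> (braiding V (pure_tensor K V V v w))"
    using gamma_braiding[of "pure_tensor K V V v w"] vw
    by (simp add: V.tensor_map_pure[OF V.mods(1,1) B.mods(1,1) gamma_lin gamma_lin])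
  also have "\<dots> \<in> tensor_sub K B B GV GV"
    using vw by (intro V.tensor_map_into_sub[OF V.mods(1,1) B.mods(1,1) gamma_image_submodule
        gamma_image_submodule gamma_lin gamma_lin]) (auto intro: V.braiding_closed)
  finally show ?thesis .
qed

lemma gamma_image_subset: "GV \<subseteq> carrier B"
  using gamma_image_closed by blast

text \<open>Here the image of \<gamma> is both the subspace being moved and the generating set, and
  the start of the argument is that c preserves its tensor square.\<close>

lemma braiding_into_gamma_image:
  assumes y: "y \<in> carrier B" and g: "g \<in> GV"
  shows "braiding B (pure_tensor K B B y g) \<in> tensor_sub K B B GV (carrier B)"
    and "braiding B (pure_tensor K B B g y) \<in> tensor_sub K B B (carrier B) GV"
proof -
  note fB = B.carrier_is_submodule
  note mono = V.tensor_sub_mono[OF B.mods(1,1) gamma_image_submodule gamma_image_submodule]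
  show "braiding B (pure_tensor K B B y g) \<in> tensor_sub K B B GV (carrier B)"
    by (rule B.braiding_sub_right_generated[OF gamma_image_submodule gamma_generates gamma_image_subset _ y g])
      (rule subsetD[OF mono[OF gamma_image_submodule fB subset_refl gamma_image_subset]], rule braiding_gamma_image)
  show "braiding B (pure_tensor K B B g y) \<in> tensor_sub K B B (carrier B) GV"
    by (rule B.braiding_sub_left_generated[OF gamma_image_submodule gamma_generates gamma_image_subset _ y g])
      (rule subsetD[OF mono[OF fB gamma_image_submodule gamma_image_subset subset_refl]], rule braiding_gamma_image)
qed

text \<open>Generation confines one factor to the image of \<gamma>, primitivity confines the other
  to P. With this the restricted braidings in the conditions on \<open>b\<close> become true
  restrictions.\<close>

lemma braiding_primitive_gamma:
  assumes x: "x \<in> PB" and g: "g \<in> GV"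
  shows "braiding B (pure_tensor K B B x g) \<in> tensor_sub K B B GV PB"
    and "braiding B (pure_tensor K B B g x) \<in> tensor_sub K B B PB GV"
  by (rule V.tensor_sub_Int[OF B.mods(1,1) gamma_image_submodule B.primitives_submodule
        braiding_into_gamma_image(1)[OF B.primitives_closed[OF x] g]
        B.braiding_primitive_left[OF x gamma_image_closed[OF g]]])
    (rule V.tensor_sub_Int[OF B.mods(1,1) B.primitives_submodule gamma_image_submodule
        B.braiding_primitive_right[OF x gamma_image_closed[OF g]]
        braiding_into_gamma_image(2)[OF B.primitives_closed[OF x] g]])

end

section \<open>The subspace D and the ideal it generates\<close>

locale vc_bialgebra_section = vc_bialgebra K V B \<gamma>
  for K :: "('k, 'r) ring_scheme" and V :: "('k, 'v, 'm) braided_space_scheme"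
    and B :: "('k, 'b, 'n) braided_bialg_scheme" and \<gamma> :: "'v \<Rightarrow> 'b" +
  fixes b :: "'b \<Rightarrow> 'v"
  assumes b_lin: "b \<in> lin_hom K (B\<lparr>carrier := primitives K B\<rparr>) V"
    and b_braiding_left: "t \<in> carrier (tensor K (B\<lparr>carrier := primitives K B\<rparr>) (B\<lparr>carrier := \<gamma> ` carrier V\<rparr>)) \<Longrightarrow>
      braiding_on K B (\<gamma> ` carrier V) (\<gamma> ` carrier V)
        (tensor_map K (B\<lparr>carrier := primitives K B\<rparr>) (B\<lparr>carrier := \<gamma> ` carrier V\<rparr>)
          (B\<lparr>carrier := \<gamma> ` carrier V\<rparr>) (B\<lparr>carrier := \<gamma> ` carrier V\<rparr>) (\<lambda>x. \<gamma> (b x)) (\<lambda>x. x) t) =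
      tensor_map K (B\<lparr>carrier := \<gamma> ` carrier V\<rparr>) (B\<lparr>carrier := primitives K B\<rparr>)
        (B\<lparr>carrier := \<gamma> ` carrier V\<rparr>) (B\<lparr>carrier := \<gamma> ` carrier V\<rparr>) (\<lambda>x. x) (\<lambda>x. \<gamma> (b x))
        (braiding_on K B (primitives K B) (\<gamma> ` carrier V) t)"
    and b_braiding_right: "t \<in> carrier (tensor K (B\<lparr>carrier := \<gamma> ` carrier V\<rparr>) (B\<lparr>carrier := primitives K B\<rparr>)) \<Longrightarrow>
      braiding_on K B (\<gamma> ` carrier V) (\<gamma> ` carrier V)
        (tensor_map K (B\<lparr>carrier := \<gamma> ` carrier V\<rparr>) (B\<lparr>carrier := primitives K B\<rparr>)
          (B\<lparr>carrier := \<gamma> ` carrier V\<rparr>) (B\<lparr>carrier := \<gamma> ` carrier V\<rparr>) (\<lambda>x. x) (\<lambda>x. \<gamma> (b x)) t) =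
      tensor_map K (B\<lparr>carrier := primitives K B\<rparr>) (B\<lparr>carrier := \<gamma> ` carrier V\<rparr>)
        (B\<lparr>carrier := \<gamma> ` carrier V\<rparr>) (B\<lparr>carrier := \<gamma> ` carrier V\<rparr>) (\<lambda>x. \<gamma> (b x)) (\<lambda>x. x)
        (braiding_on K B (\<gamma> ` carrier V) (primitives K B) t)"
begin

abbreviation "P \<equiv> B\<lparr>carrier := PB\<rparr>"
abbreviation "G \<equiv> B\<lparr>carrier := GV\<rparr>"
text \<open>\<delta> measures how far \<open>b\<close> is from choosing preimages under \<gamma>. In
  the quotient by its values every primitive x of B becomes equal to \<gamma>(b x), so
  \<open>b\<close> acts there like a section of \<gamma>.\<close>

abbreviation "\<delta> \<equiv> \<lambda>x. x \<ominus>\<^bsub>B\<^esub> \<gamma> (b x)"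
abbreviation "D \<equiv> \<delta> ` PB"

lemma sub_mods: "module K P" "module K G"
  by (simp_all add: submodule_module B.mods B.primitives_submodule gamma_image_submodule)

lemma sub_incl: "(\<lambda>x. x) \<in> lin_hom K P B" "(\<lambda>x. x) \<in> lin_hom K G B"
  by (simp_all add: submodule_incl_lin B.mods B.primitives_submodule gamma_image_submodule)

lemma gamma_b_lin: "(\<lambda>x. \<gamma> (b x)) \<in> lin_hom K P B" "(\<lambda>x. \<gamma> (b x)) \<in> lin_hom K P G"
proof -
  show "(\<lambda>x. \<gamma> (b x)) \<in> lin_hom K P B" by (rule lin_hom_comp[OF b_lin gamma_lin])
  then show "(\<lambda>x. \<gamma> (b x)) \<in> lin_hom K P G"
    by (rule lin_hom_corestrict) (use lin_hom_closed[OF b_lin] in auto)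
qed

lemma b_closed: "x \<in> PB \<Longrightarrow> b x \<in> carrier V"
  using lin_hom_closed[OF b_lin] by simp

lemma delta_lin: "\<delta> \<in> lin_hom K P B"
  by (rule lin_hom_diff[OF sub_mods(1) B.mods(1) sub_incl(1) gamma_b_lin(1)])

lemma D_submodule: "submodule D K B"
  using submodule_image[OF sub_mods(1) B.mods(1) delta_lin] by simp

lemma D_subset: "D \<subseteq> carrier B"
  using lin_hom_closed[OF delta_lin] by auto

lemma delta_add: "x \<in> PB \<Longrightarrow> \<delta> x \<oplus>\<^bsub>B\<^esub> \<gamma> (b x) = x"
  using B.primitives_closed[of x] lin_hom_closed[OF gamma_b_lin(1)]
  by (simp add: a_minus_def B.a_assoc B.l_neg)

text \<open>The conditions on \<open>b\<close> say exactly that \<open>\<delta> = Id - \<gamma> b\<close> can be pulled through the braiding.\<close>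

lemma braiding_delta_gamma_left:
  assumes d: "d \<in> D" and g: "g \<in> GV"
  shows "braiding B (pure_tensor K B B d g) \<in> tensor_sub K B B (carrier B) D"
proof -
  let ?p = "pure_tensor K B B"
  obtain x where x: "x \<in> PB" "d = \<delta> x" using d by blast
  have c: "x \<in> carrier B" "g \<in> carrier B" "d \<in> carrier B" "\<gamma> (b x) \<in> carrier B"
    using B.primitives_closed x gamma_image_closed g D_subset d lin_hom_closed[OF gamma_b_lin(1)] by auto
  note GP = sub_mods(2,1)
  let ?i = "tensor_map K G P B B (\<lambda>x. x) (\<lambda>x. x)" and ?e = "tensor_map K G P B B (\<lambda>x. x) \<delta>"
    and ?h = "tensor_map K G P B B (\<lambda>x. x) (\<lambda>x. \<gamma> (b x))" and ?j = "tensor_map K G G B B (\<lambda>x. x) (\<lambda>x. x)"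
  note il = V.tensor_map_lin[OF GP B.mods(1,1) sub_incl(2,1)]
    and el = V.tensor_map_lin[OF GP B.mods(1,1) sub_incl(2) delta_lin]
    and hl = V.tensor_map_lin[OF GP B.mods(1,1) sub_incl(2) gamma_b_lin(1)]
  interpret T: module K "tensor K B B" by (rule B.mods)
  define t where "t = pure_tensor K P G x g"
  have t: "t \<in> carrier (tensor K P G)" unfolding t_def using x g by simp
  define s where "s = braiding_on K B PB GV t"
  have s: "s \<in> carrier (tensor K G P)"
    and iota: "?i s = braiding B (tensor_map K P G B B (\<lambda>x. x) (\<lambda>x. x) t)"
    unfolding s_def
    by (rule B.braiding_on_incl(1)[OF B.primitives_submodule gamma_image_submodule braiding_primitive_gamma(1) t],
        assumption, assumption,
        rule B.braiding_on_incl(2)[OF B.primitives_submodule gamma_image_submodule braiding_primitive_gamma(1) t])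
  have i: "?i s = braiding B (?p x g)"
    unfolding iota t_def using x g by (simp add: V.tensor_map_pure sub_mods B.mods sub_incl)
  \<comment> \<open>The decomposition Id = \<delta> + \<gamma> b on P, tensored with the inclusion
    of G.\<close>
  have ieh: "?i u = ?e u \<oplus>\<^bsub>tensor K B B\<^esub> ?h u" if "u \<in> carrier (tensor K G P)" for u
    using GP that
  proof (induction u rule: V.tensor_induct)
    case (pure v w)
    then have "v \<in> carrier B" "\<delta> w \<in> carrier B" "\<gamma> (b w) \<in> carrier B" "w \<in> PB"
      using gamma_image_closed D_subset lin_hom_closed[OF gamma_b_lin(1)] by auto
    then show ?case
      using pure by (simp add: V.tensor_map_pure sub_mods B.mods sub_incl delta_lin gamma_b_lin
          V.pure_tensor_add_right[symmetric] delta_add)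
  next
    case (add u u')
    then show ?case
      by (simp add: lin_hom_add[OF il] lin_hom_add[OF el] lin_hom_add[OF hl] lin_hom_closed[OF el]
          lin_hom_closed[OF hl] T.a_ac)
  qed
  define u where "u = tensor_map K P G G G (\<lambda>x. \<gamma> (b x)) (\<lambda>x. x) t"
  have u_eq: "u = pure_tensor K G G (\<gamma> (b x)) g"
    unfolding u_def t_def using x g by (simp add: V.tensor_map_pure sub_mods gamma_b_lin lin_hom_id)
  have u: "u \<in> carrier (tensor K G G)"
    unfolding u_eq using x g by (simp add: b_closed)
  \<comment> \<open>The condition on \<open>b\<close> is an equation in G \<otimes> G. The embedding
    \<open>?j\<close> carries it to B \<otimes> B, where it computes c(\<gamma>(b x) \<otimes> g)
    from s, the restricted braiding of x \<otimes> g.\<close>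
  have "?j (braiding_on K B GV GV u) = braiding B (tensor_map K G G B B (\<lambda>x. x) (\<lambda>x. x) u)"
    by (rule B.braiding_on_incl(2)[OF gamma_image_submodule gamma_image_submodule braiding_gamma_image u])
  also have "\<dots> = braiding B (?p (\<gamma> (b x)) g)"
    unfolding u_eq using x g by (simp add: V.tensor_map_pure sub_mods B.mods sub_incl b_closed)
  finally have "braiding B (?p (\<gamma> (b x)) g) = ?j (tensor_map K G P G G (\<lambda>x. x) (\<lambda>x. \<gamma> (b x)) s)"
    using b_braiding_left[OF t] by (simp add: u_def s_def)
  also have "\<dots> = ?h s"
    by (rule V.tensor_map_comp[OF GP sub_mods(2,2) B.mods(1,1) lin_hom_id gamma_b_lin(2) sub_incl(2,2) s])
  finally have h: "braiding B (?p (\<gamma> (b x)) g) = ?h s" .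
  \<comment> \<open>Both sides equal c(x \<otimes> g), decomposed before and after braiding. The
    parts with \<gamma> b agree by the condition on \<open>b\<close> and cancel, which leaves c(d
    \<otimes> g) = (Id \<otimes> \<delta>) s.\<close>
  have "braiding B (?p d g) \<oplus>\<^bsub>tensor K B B\<^esub> ?h s = braiding B (?p (d \<oplus>\<^bsub>B\<^esub> \<gamma> (b x)) g)"
    using c by (simp add: h[symmetric] V.pure_tensor_add_left B.mods lin_hom_add[OF B.braiding_linear])
  also have "\<dots> = ?e s \<oplus>\<^bsub>tensor K B B\<^esub> ?h s"
    using ieh[OF s] x by (simp add: delta_add i)
  finally have "braiding B (?p d g) = ?e s"
    using c lin_hom_closed[OF el s] lin_hom_closed[OF hl s] by (simp add: B.braiding_closed)
  also have "\<dots> \<in> tensor_sub K B B (carrier B) D"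
    by (rule V.tensor_map_into_sub[OF GP B.mods(1,1) B.carrier_is_submodule D_submodule sub_incl(2) delta_lin _ _ s])
      (use gamma_image_closed in auto)
  finally show ?thesis .
qed

text \<open>The mirror image, in which the second condition on \<open>b\<close> cancels the \<gamma>
  b part.\<close>

lemma braiding_delta_gamma_right:
  assumes d: "d \<in> D" and g: "g \<in> GV"
  shows "braiding B (pure_tensor K B B g d) \<in> tensor_sub K B B D (carrier B)"
proof -
  let ?p = "pure_tensor K B B"
  obtain x where x: "x \<in> PB" "d = \<delta> x" using d by blast
  have c: "x \<in> carrier B" "g \<in> carrier B" "d \<in> carrier B" "\<gamma> (b x) \<in> carrier B"
    using B.primitives_closed x gamma_image_closed g D_subset d lin_hom_closed[OF gamma_b_lin(1)] by auto
  note PG = sub_mods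
  let ?i = "tensor_map K P G B B (\<lambda>x. x) (\<lambda>x. x)" and ?e = "tensor_map K P G B B \<delta> (\<lambda>x. x)"
    and ?h = "tensor_map K P G B B (\<lambda>x. \<gamma> (b x)) (\<lambda>x. x)" and ?j = "tensor_map K G G B B (\<lambda>x. x) (\<lambda>x. x)"
  note il = V.tensor_map_lin[OF PG B.mods(1,1) sub_incl]
    and el = V.tensor_map_lin[OF PG B.mods(1,1) delta_lin sub_incl(2)]
    and hl = V.tensor_map_lin[OF PG B.mods(1,1) gamma_b_lin(1) sub_incl(2)]
  interpret T: module K "tensor K B B" by (rule B.mods)
  define t where "t = pure_tensor K G P g x"
  have t: "t \<in> carrier (tensor K G P)" unfolding t_def using x g by simp
  define s where "s = braiding_on K B GV PB t"
  have s: "s \<in> carrier (tensor K P G)"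
    and iota: "?i s = braiding B (tensor_map K G P B B (\<lambda>x. x) (\<lambda>x. x) t)"
    unfolding s_def
    by (rule B.braiding_on_incl(1)[OF gamma_image_submodule B.primitives_submodule braiding_primitive_gamma(2) t],
        assumption, assumption,
        rule B.braiding_on_incl(2)[OF gamma_image_submodule B.primitives_submodule braiding_primitive_gamma(2) t])
  have i: "?i s = braiding B (?p g x)"
    unfolding iota t_def using x g by (simp add: V.tensor_map_pure sub_mods B.mods sub_incl)
  have ieh: "?i u = ?e u \<oplus>\<^bsub>tensor K B B\<^esub> ?h u" if "u \<in> carrier (tensor K P G)" for u
    using PG that
  proof (induction u rule: V.tensor_induct)
    case (pure w v)
    then have "v \<in> carrier B" "\<delta> w \<in> carrier B" "\<gamma> (b w) \<in> carrier B" "w \<in> PB"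
      using gamma_image_closed D_subset lin_hom_closed[OF gamma_b_lin(1)] by auto
    then show ?case
      using pure by (simp add: V.tensor_map_pure sub_mods B.mods sub_incl delta_lin gamma_b_lin
          V.pure_tensor_add_left[symmetric] delta_add)
  next
    case (add u u')
    then show ?case
      by (simp add: lin_hom_add[OF il] lin_hom_add[OF el] lin_hom_add[OF hl] lin_hom_closed[OF el]
          lin_hom_closed[OF hl] T.a_ac)
  qed
  define u where "u = tensor_map K G P G G (\<lambda>x. x) (\<lambda>x. \<gamma> (b x)) t"
  have u_eq: "u = pure_tensor K G G g (\<gamma> (b x))"
    unfolding u_def t_def using x g by (simp add: V.tensor_map_pure sub_mods gamma_b_lin lin_hom_id)
  have u: "u \<in> carrier (tensor K G G)"
    unfolding u_eq using x g by (simp add: b_closed)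
  have "?j (braiding_on K B GV GV u) = braiding B (tensor_map K G G B B (\<lambda>x. x) (\<lambda>x. x) u)"
    by (rule B.braiding_on_incl(2)[OF gamma_image_submodule gamma_image_submodule braiding_gamma_image u])
  also have "\<dots> = braiding B (?p g (\<gamma> (b x)))"
    unfolding u_eq using x g by (simp add: V.tensor_map_pure sub_mods B.mods sub_incl b_closed)
  finally have "braiding B (?p g (\<gamma> (b x))) = ?j (tensor_map K P G G G (\<lambda>x. \<gamma> (b x)) (\<lambda>x. x) s)"
    using b_braiding_right[OF t] by (simp add: u_def s_def)
  also have "\<dots> = ?h s"
    by (rule V.tensor_map_comp[OF PG sub_mods(2,2) B.mods(1,1) gamma_b_lin(2) lin_hom_id sub_incl(2,2) s])
  finally have h: "braiding B (?p g (\<gamma> (b x))) = ?h s" .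
  have "braiding B (?p g d) \<oplus>\<^bsub>tensor K B B\<^esub> ?h s = braiding B (?p g (d \<oplus>\<^bsub>B\<^esub> \<gamma> (b x)))"
    using c by (simp add: h[symmetric] V.pure_tensor_add_right B.mods lin_hom_add[OF B.braiding_linear])
  also have "\<dots> = ?e s \<oplus>\<^bsub>tensor K B B\<^esub> ?h s"
    using ieh[OF s] x by (simp add: delta_add i)
  finally have "braiding B (?p g d) = ?e s"
    using c lin_hom_closed[OF el s] lin_hom_closed[OF hl s] by (simp add: B.braiding_closed)
  also have "\<dots> \<in> tensor_sub K B B D (carrier B)"
    by (rule V.tensor_map_into_sub[OF PG B.mods(1,1) D_submodule B.carrier_is_submodule delta_lin sub_incl(2) _ _ s])
      (use gamma_image_closed in auto)
  finally show ?thesis .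
qed

abbreviation "I \<equiv> Idl\<^bsub>B\<^esub> D"

lemma I_ideal: "ideal I B"
  by (rule B.genideal_ideal[OF D_subset])

lemma I_submodule: "submodule I K B"
  by (rule B.ideal_submodule[OF I_ideal])

lemma D_subset_I: "D \<subseteq> I"
  by (rule B.genideal_self[OF D_subset])

text \<open>The order of the two extensions matters. D must pass all of B before it is enlarged to
  the ideal, since braiding a product produces intermediate tensors with arbitrary factors, not only
  generators.\<close>

lemma braiding_I_left:
  assumes x: "x \<in> I" and y: "y \<in> carrier B"
  shows "braiding B (pure_tensor K B B x y) \<in> tensor_sub K B B (carrier B) I"
proof (rule B.braiding_ideal_left[OF D_subset _ x y])
  fix d y assume d: "d \<in> D" and y: "y \<in> carrier B"
  have "braiding B (pure_tensor K B B d y) \<in> tensor_sub K B B (carrier B) D"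
    by (rule B.braiding_sub_left_generated[OF D_submodule gamma_generates gamma_image_subset _ y d])
      (rule braiding_delta_gamma_left)
  then show "braiding B (pure_tensor K B B d y) \<in> tensor_sub K B B (carrier B) I"
    by (rule subsetD[OF V.tensor_sub_mono[OF B.mods(1,1) B.carrier_is_submodule D_submodule
          B.carrier_is_submodule I_submodule subset_refl D_subset_I]])
qed

lemma braiding_I_right:
  assumes x: "x \<in> I" and y: "y \<in> carrier B"
  shows "braiding B (pure_tensor K B B y x) \<in> tensor_sub K B B I (carrier B)"
proof (rule B.braiding_ideal_right[OF D_subset _ x y])
  fix d y assume d: "d \<in> D" and y: "y \<in> carrier B"
  have "braiding B (pure_tensor K B B y d) \<in> tensor_sub K B B D (carrier B)"
    by (rule B.braiding_sub_right_generated[OF D_submodule gamma_generates gamma_image_subset _ y d])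
      (rule braiding_delta_gamma_right)
  then show "braiding B (pure_tensor K B B y d) \<in> tensor_sub K B B I (carrier B)"
    by (rule subsetD[OF V.tensor_sub_mono[OF B.mods(1,1) D_submodule B.carrier_is_submodule
          I_submodule B.carrier_is_submodule D_subset_I subset_refl]])
qed

end

section \<open>Transport of structure along surjections\<close>

text \<open>\<open>counit_left\<close> and \<open>counit_right\<close> are tensor lifts, so their
  values are available only through bilinearity of the underlying forms.\<close>

lemma (in cring) bilinear_scalar_form:
  assumes C: "module R C" and e: "e \<in> lin_hom R C (scalars R)"
  shows "bilinear R C C C (\<lambda>x y. e x \<odot>\<^bsub>C\<^esub> y)" and "bilinear R C C C (\<lambda>x y. e y \<odot>\<^bsub>C\<^esub> x)"
proof -
  interpret C: module R C by fact
  have e_closed: "e x \<in> carrier R" if "x \<in> carrier C" for x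
    using lin_hom_closed[OF e that] by (simp add: scalars_def)
  have e_add: "e (x \<oplus>\<^bsub>C\<^esub> y) = e x \<oplus> e y" if "x \<in> carrier C" "y \<in> carrier C" for x y
    using lin_hom_add[OF e that] by (simp add: scalars_def)
  have e_smult: "e (a \<odot>\<^bsub>C\<^esub> x) = a \<otimes> e x" if "a \<in> carrier R" "x \<in> carrier C" for a x
    using lin_hom_smult[OF e that] by (simp add: scalars_def)
  have l: "(\<lambda>x. e x \<odot>\<^bsub>C\<^esub> y) \<in> lin_hom R C C" if "y \<in> carrier C" for y
    using that by (intro lin_homI) (simp_all add: e_closed e_add e_smult C.smult_l_distr C.smult_assoc1)
  have r: "(\<lambda>y. e x \<odot>\<^bsub>C\<^esub> y) \<in> lin_hom R C C" if x: "x \<in> carrier C" for x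
  proof (rule lin_homI)
    fix a y assume a: "a \<in> carrier R" and y: "y \<in> carrier C"
    have "e x \<odot>\<^bsub>C\<^esub> (a \<odot>\<^bsub>C\<^esub> y) = (e x \<otimes> a) \<odot>\<^bsub>C\<^esub> y" using a x y by (simp add: e_closed C.smult_assoc1)
    also have "\<dots> = a \<odot>\<^bsub>C\<^esub> (e x \<odot>\<^bsub>C\<^esub> y)"
      using a x y by (simp add: e_closed C.smult_assoc1 m_comm[of "e x" a])
    finally show "e x \<odot>\<^bsub>C\<^esub> (a \<odot>\<^bsub>C\<^esub> y) = a \<odot>\<^bsub>C\<^esub> (e x \<odot>\<^bsub>C\<^esub> y)" .
  qed (use x in \<open>simp_all add: e_closed C.smult_r_distr\<close>)
  show "bilinear R C C C (\<lambda>x y. e x \<odot>\<^bsub>C\<^esub> y)" "bilinear R C C C (\<lambda>x y. e y \<odot>\<^bsub>C\<^esub> x)"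
    using l r by (auto intro: bilinearI)
qed

text \<open>The target is assumed to be only a vector space and a ring with a linear candidate
  braiding; compatibility of scalars with products and all braiding axioms are inherited along the
  surjection. No comultiplication occurs, because that of the quotient is shown to be well defined
  only with the help of this stage.\<close>

locale braided_algebra_surjection = braided_algebra K B + S: module K S + S: ring S
  for K :: "('k, 'r) ring_scheme" and B :: "('k, 'b, 'm) braided_space_scheme"
    and S :: "('k, 's, 'n) braided_space_scheme" and f :: "'b \<Rightarrow> 's" +
  assumes f_lin: "f \<in> lin_hom K B S" and f_surj: "f ` carrier B = carrier S"
    and f_ring_hom: "f \<in> ring_hom B S"
    and S_braiding_lin: "braiding S \<in> lin_hom K (tensor K S S) (tensor K S S)"
    and f_braiding: "t \<in> carrier (tensor K B B) \<Longrightarrow>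
      braiding S (tensor_map K B B S S f f t) = tensor_map K B B S S f f (braiding B t)"
begin

abbreviation "SS \<equiv> tensor K S S"
abbreviation "SSS \<equiv> tensor K SS S"
abbreviation "f2 \<equiv> tensor_map K B B S S f f"
abbreviation "f3 \<equiv> tensor_map K VV B SS S f2 f"
abbreviation "f3' \<equiv> tensor_map K B VV S SS f f2"
abbreviation "f4 \<equiv> tensor_map K VV VV SS SS f2 f2"

lemma smods: "module K S" "module K SS" "module K SSS" "module K (tensor K S SS)"
  by (simp_all add: S.module_axioms)

lemma f2_lin: "f2 \<in> lin_hom K VV SS"
  by (rule tensor_map_lin[OF mods(1,1) smods(1,1) f_lin f_lin])

lemma f3_lin: "f3 \<in> lin_hom K VVV SSS"
  by (rule tensor_map_lin[OF mods(2,1) smods(2,1) f2_lin f_lin])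

lemma f2_pure: "x \<in> carrier B \<Longrightarrow> y \<in> carrier B \<Longrightarrow> f2 (pure_tensor K B B x y) = pure_tensor K S S (f x) (f y)"
  by (rule tensor_map_pure[OF mods(1,1) smods(1,1) f_lin f_lin])

lemma f2_surj: "f2 ` carrier VV = carrier SS"
  by (rule tensor_map_surj[OF mods(1,1) smods(1,1) f_lin f_lin f_surj f_surj])

lemma f3_surj: "f3 ` carrier VVV = carrier SSS"
  by (rule tensor_map_surj[OF mods(2,1) smods(2,1) f2_lin f_lin f2_surj f_surj])

lemma S_obtain:
  assumes "x \<in> carrier S" obtains u where "u \<in> carrier B" "x = f u"
proof -
  have "x \<in> f ` carrier B" unfolding f_surj by fact
  then show ?thesis using that by (elim imageE)
qed

lemma SS_obtain:
  assumes "t \<in> carrier SS" obtains s where "s \<in> carrier VV" "t = f2 s"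
proof -
  have "t \<in> f2 ` carrier VV" unfolding f2_surj by fact
  then show ?thesis using that by (elim imageE)
qed

lemma SSS_obtain:
  assumes "t \<in> carrier SSS" obtains s where "s \<in> carrier VVV" "t = f3 s"
proof -
  have "t \<in> f3 ` carrier VVV" unfolding f3_surj by fact
  then show ?thesis using that by (elim imageE)
qed

text \<open>Commuting squares in the two factors tensor to a commuting square. Many compatibilities
  of \<open>f2\<close>, \<open>f3\<close> and \<open>f4\<close> with the structure maps are
  instances of this.\<close>

lemma tensor_map_square:
  assumes M: "module K M" "module K N" "module K M1" "module K N1" "module K M2" "module K N2" "module K M3" "module K N3"
    and g1: "g1 \<in> lin_hom K M M1" "h1 \<in> lin_hom K N N1" and g2: "g2 \<in> lin_hom K M1 M3" "h2 \<in> lin_hom K N1 N3"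
    and g3: "g3 \<in> lin_hom K M M2" "h3 \<in> lin_hom K N N2" and g4: "g4 \<in> lin_hom K M2 M3" "h4 \<in> lin_hom K N2 N3"
    and eq: "\<And>x. x \<in> carrier M \<Longrightarrow> g2 (g1 x) = g4 (g3 x)" "\<And>y. y \<in> carrier N \<Longrightarrow> h2 (h1 y) = h4 (h3 y)"
    and t: "t \<in> carrier (tensor K M N)"
  shows "tensor_map K M1 N1 M3 N3 g2 h2 (tensor_map K M N M1 N1 g1 h1 t) =
    tensor_map K M2 N2 M3 N3 g4 h4 (tensor_map K M N M2 N2 g3 h3 t)"
proof -
  have "tensor_map K M1 N1 M3 N3 g2 h2 (tensor_map K M N M1 N1 g1 h1 t) =
    tensor_map K M N M3 N3 (\<lambda>x. g2 (g1 x)) (\<lambda>x. h2 (h1 x)) t"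
    by (rule tensor_map_comp[OF M(1,2,3,4,7,8) g1 g2 t])
  also have "\<dots> = tensor_map K M N M3 N3 (\<lambda>x. g4 (g3 x)) (\<lambda>x. h4 (h3 x)) t"
    by (rule tensor_map_cong[OF M(1,2,7,8) lin_hom_comp[OF g3(1) g4(1)] lin_hom_comp[OF g3(2) g4(2)] eq t])
  also have "\<dots> = tensor_map K M2 N2 M3 N3 g4 h4 (tensor_map K M N M2 N2 g3 h3 t)"
    by (rule tensor_map_comp[OF M(1,2,5,6,7,8) g3 g4 t, symmetric])
  finally show ?thesis .
qed

lemma f3_braid_left: "t \<in> carrier VVV \<Longrightarrow> braid_left K S (f3 t) = f3 (braid_left K B t)"
  unfolding braid_left_def
  by (rule tensor_map_square[OF mods(2,1) smods(2,1) mods(2,1) smods(2,1) f2_lin f_lin S_braiding_lin lin_hom_id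
      braiding_linear lin_hom_id f2_lin f_lin f_braiding refl])

lemma f3_assoc: "t \<in> carrier VVV \<Longrightarrow> tensor_assoc K S S S (f3 t) = f3' (tensor_assoc K B B B t)"
  by (rule tensor_assoc_natural[OF mods(1,1,1) smods(1,1,1) f_lin f_lin f_lin])

lemma f3_assoc_inv:
  "t \<in> carrier (tensor K B VV) \<Longrightarrow> tensor_assoc_inv K S S S (f3' t) = f3 (tensor_assoc_inv K B B B t)"
  by (rule tensor_assoc_inv_natural[OF mods(1,1,1) smods(1,1,1) f_lin f_lin f_lin])

lemma f3_braid_right:
  assumes t: "t \<in> carrier VVV"
  shows "braid_right K S (f3 t) = f3 (braid_right K B t)"
proof -
  note a = lin_hom_closed[OF assoc_lin t]
  have "tensor_map K S SS S SS (\<lambda>x. x) (braiding S) (f3' (tensor_assoc K B B B t)) =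
    f3' (tensor_map K B VV B VV (\<lambda>x. x) (braiding B) (tensor_assoc K B B B t))"
    by (rule tensor_map_square[OF mods(1,2) smods(1,2) mods(1,2) smods(1,2) f_lin f2_lin lin_hom_id S_braiding_lin
      lin_hom_id braiding_linear f_lin f2_lin refl f_braiding a])
  then show ?thesis
    unfolding braid_right_def using t a
    by (simp add: f3_assoc f3_assoc_inv lin_hom_closed[OF tensor_map_lin[OF mods(1,2,1,2) lin_hom_id braiding_linear]])
qed

lemma S_smult_mult:
  assumes a: "a \<in> carrier K" and x: "x \<in> carrier S" and y: "y \<in> carrier S"
  shows "(a \<odot>\<^bsub>S\<^esub> x) \<otimes>\<^bsub>S\<^esub> y = a \<odot>\<^bsub>S\<^esub> (x \<otimes>\<^bsub>S\<^esub> y)" and "x \<otimes>\<^bsub>S\<^esub> (a \<odot>\<^bsub>S\<^esub> y) = a \<odot>\<^bsub>S\<^esub> (x \<otimes>\<^bsub>S\<^esub> y)"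
proof -
  obtain u where u: "u \<in> carrier B" "x = f u" using x by (rule S_obtain)
  obtain v where v: "v \<in> carrier B" "y = f v" using y by (rule S_obtain)
  show "(a \<odot>\<^bsub>S\<^esub> x) \<otimes>\<^bsub>S\<^esub> y = a \<odot>\<^bsub>S\<^esub> (x \<otimes>\<^bsub>S\<^esub> y)"
    using u v a smult_mult_left[OF a u(1) v(1)]
    by (simp add: lin_hom_smult[OF f_lin, symmetric] ring_hom_mult[OF f_ring_hom, symmetric])
  show "x \<otimes>\<^bsub>S\<^esub> (a \<odot>\<^bsub>S\<^esub> y) = a \<odot>\<^bsub>S\<^esub> (x \<otimes>\<^bsub>S\<^esub> y)"
    using u v a smult_mult_right[OF a u(1) v(1)]
    by (simp add: lin_hom_smult[OF f_lin, symmetric] ring_hom_mult[OF f_ring_hom, symmetric])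
qed

lemma S_mult_bilinear: "bilinear K S S S (\<lambda>x y. x \<otimes>\<^bsub>S\<^esub> y)"
  by (intro bilinearI lin_homI) (simp_all add: S.l_distr S.r_distr S_smult_mult)

lemma S_mult_lin: "mult_map K S \<in> lin_hom K SS S"
  unfolding mult_map_def by (intro tensor_lift_lin smods S_mult_bilinear)

lemma f2_mult: "t \<in> carrier VV \<Longrightarrow> mult_map K S (f2 t) = f (mult_map K B t)"
  by (rule lin_hom_tensor_eqI[OF mods(1,1) smods(1) lin_hom_comp[OF f2_lin S_mult_lin] lin_hom_comp[OF mult_lin f_lin]])
    (simp_all add: f2_pure mult_pure mult_map_def[of K S] tensor_lift_pure smods S_mult_bilinear
      lin_hom_closed[OF f_lin] ring_hom_mult[OF f_ring_hom])

lemma f3_mult_left: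
  "t \<in> carrier VVV \<Longrightarrow> tensor_map K SS S S S (mult_map K S) (\<lambda>x. x) (f3 t) =
    f2 (tensor_map K VV B B B (mult_map K B) (\<lambda>x. x) t)"
  by (rule tensor_map_square[OF mods(2,1) smods(2,1) mods(1,1) smods(1,1) f2_lin f_lin S_mult_lin lin_hom_id
      mult_lin lin_hom_id f_lin f_lin f2_mult refl])

lemma f3'_mult_right:
  "t \<in> carrier (tensor K B VV) \<Longrightarrow> tensor_map K S SS S S (\<lambda>x. x) (mult_map K S) (f3' t) =
    f2 (tensor_map K B VV B B (\<lambda>x. x) (mult_map K B) t)"
  by (rule tensor_map_square[OF mods(1,2) smods(1,2) mods(1,1) smods(1,1) f_lin f2_lin lin_hom_id S_mult_lin
      lin_hom_id mult_lin f_lin f_lin refl f2_mult])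

lemma f4_mult:
  "t \<in> carrier (tensor K VV VV) \<Longrightarrow> tensor_map K SS SS S S (mult_map K S) (mult_map K S) (f4 t) =
    f2 (tensor_map K VV VV B B (mult_map K B) (mult_map K B) t)"
  by (rule tensor_map_square[OF mods(2,2) smods(2,2) mods(1,1) smods(1,1) f2_lin f2_lin S_mult_lin S_mult_lin
      mult_lin mult_lin f_lin f_lin f2_mult f2_mult])

lemma S_braided_vector_space: "braided_vector_space K S"
proof (intro braided_vector_space.intro braided_vector_space_axioms.intro)
  show "field K" by (rule field_axioms)
  show "module K S" by (rule smods)
  show "braiding S \<in> lin_hom K SS SS" by (rule S_braiding_lin)
  fix t assume "t \<in> carrier SSS"
  then obtain s where s: "s \<in> carrier VVV" "t = f3 s" by (rule SSS_obtain)
  note cl = lin_hom_closed[OF braid_left_lin] lin_hom_closed[OF braid_right_lin]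
  show "braid_left K S (braid_right K S (braid_left K S t)) =
    braid_right K S (braid_left K S (braid_right K S t))"
    using s braid_equation[OF s(1)] by (simp add: f3_braid_left f3_braid_right cl)
qed

lemma S_braided_algebra: "braided_algebra K S"
proof (intro braided_algebra.intro braided_algebra_axioms.intro)
  show "braided_vector_space K S" by (rule S_braided_vector_space)
  show "ring S" by (rule S.ring_axioms)
  note cl = lin_hom_closed[OF braid_left_lin] lin_hom_closed[OF braid_right_lin] lin_hom_closed[OF assoc_lin]
    lin_hom_closed[OF tensor_map_lin[OF mods(2,1,1,1) mult_lin lin_hom_id]]
    lin_hom_closed[OF tensor_map_lin[OF mods(1,2,1,1) lin_hom_id mult_lin]]
  show "(a \<odot>\<^bsub>S\<^esub> x) \<otimes>\<^bsub>S\<^esub> y = a \<odot>\<^bsub>S\<^esub> (x \<otimes>\<^bsub>S\<^esub> y)" if "a \<in> carrier K" "x \<in> carrier S" "y \<in> carrier S" for a x y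
    by (rule S_smult_mult(1)[OF that])
  show "x \<otimes>\<^bsub>S\<^esub> (a \<odot>\<^bsub>S\<^esub> y) = a \<odot>\<^bsub>S\<^esub> (x \<otimes>\<^bsub>S\<^esub> y)" if "a \<in> carrier K" "x \<in> carrier S" "y \<in> carrier S" for a x y
    by (rule S_smult_mult(2)[OF that])
  show "braiding S (tensor_map K SS S S S (mult_map K S) (\<lambda>x. x) t) =
      tensor_map K S SS S S (\<lambda>x. x) (mult_map K S)
        (tensor_assoc K S S S (braid_left K S (braid_right K S t)))" if "t \<in> carrier SSS" for t
  proof -
    obtain s where s: "s \<in> carrier VVV" "t = f3 s" using \<open>t \<in> carrier SSS\<close> by (rule SSS_obtain)
    then show ?thesis
      using braiding_mult_left[OF s(1)]
      by (simp add: f3_braid_left f3_braid_right f3_assoc f3_mult_left f3'_mult_right f_braiding cl)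
  qed
  show "braiding S (tensor_map K S SS S S (\<lambda>x. x) (mult_map K S) (tensor_assoc K S S S t)) =
      tensor_map K SS S S S (mult_map K S) (\<lambda>x. x) (braid_right K S (braid_left K S t))"
    if "t \<in> carrier SSS" for t
  proof -
    obtain s where s: "s \<in> carrier VVV" "t = f3 s" using \<open>t \<in> carrier SSS\<close> by (rule SSS_obtain)
    then show ?thesis
      using braiding_mult_right[OF s(1)]
      by (simp add: f3_braid_left f3_braid_right f3_assoc f3_mult_left f3'_mult_right f_braiding cl)
  qed
  fix x assume "x \<in> carrier S"
  then obtain u where u: "u \<in> carrier B" "x = f u" by (rule S_obtain)
  have one: "\<one>\<^bsub>S\<^esub> = f \<one>\<^bsub>B\<^esub>" using ring_hom_one[OF f_ring_hom] by simp
  show "braiding S (pure_tensor K S S \<one>\<^bsub>S\<^esub> x) = pure_tensor K S S x \<one>\<^bsub>S\<^esub>"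
    using u by (simp add: one f2_pure[symmetric] f_braiding braiding_unit_left)
  show "braiding S (pure_tensor K S S x \<one>\<^bsub>S\<^esub>) = pure_tensor K S S \<one>\<^bsub>S\<^esub> x"
    using u by (simp add: one f2_pure[symmetric] f_braiding braiding_unit_right)
qed

text \<open>The braided product on S \<otimes> S involves only braiding and product, so its
  compatibility with the surjection is available already at the algebra stage, where the coideal
  argument needs it.\<close>

lemma f4_braid_middle:
  assumes t: "t \<in> carrier (tensor K VV VV)"
  shows "braid_middle K S (f4 t) = f4 (braid_middle K B t)"
proof -
  note r = lin_hom_closed[OF tensor_assoc_inv_lin[OF mods(2,1,1)] t]
  let ?f = "tensor_map K VVV B SSS S f3 f"
  let ?b = "tensor_map K VVV B VVV B (braid_right K B) (\<lambda>x. x)"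
  have 1: "tensor_assoc_inv K SS S S (f4 t) = ?f (tensor_assoc_inv K VV B B t)"
    by (rule tensor_assoc_inv_natural[OF mods(2,1,1) smods(2,1,1) f2_lin f_lin f_lin t])
  have 2: "tensor_map K SSS S SSS S (braid_right K S) (\<lambda>x. x) (?f (tensor_assoc_inv K VV B B t)) =
    ?f (?b (tensor_assoc_inv K VV B B t))"
    by (rule tensor_map_square[OF mods(3,1) smods(3,1) mods(3,1) smods(3,1) f3_lin f_lin
      braided_vector_space.braid_right_lin[OF S_braided_vector_space] lin_hom_id
      braid_right_lin lin_hom_id f3_lin f_lin f3_braid_right refl r])
  have 3: "tensor_assoc K SS S S (?f s) = f4 (tensor_assoc K VV B B s)" if "s \<in> carrier (tensor K VVV B)" for s
    by (rule tensor_assoc_natural[OF mods(2,1,1) smods(2,1,1) f2_lin f_lin f_lin that])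
  show ?thesis
    unfolding braid_middle_def Let_def 1 2
    by (rule 3[OF lin_hom_closed[OF tensor_map_lin[OF mods(3,1,3,1) braid_right_lin lin_hom_id] r]])
qed

end

section \<open>Transport of the coalgebra structure and of \<gamma>\<close>

locale braided_bialgebra_surjection = braided_algebra_surjection K B S f + braided_bialgebra K B
  for K :: "('k, 'r) ring_scheme" and B :: "('k, 'b, 'm) braided_bialg_scheme"
    and S :: "('k, 's, 'n) braided_bialg_scheme" and f :: "'b \<Rightarrow> 's" +
  assumes S_comult_lin: "comult S \<in> lin_hom K S SS"
    and f_comult: "x \<in> carrier B \<Longrightarrow> comult S (f x) = f2 (comult B x)"
    and S_counit_lin: "counit S \<in> lin_hom K S (scalars K)"
    and f_counit: "x \<in> carrier B \<Longrightarrow> counit S (f x) = counit B x"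
begin

lemma f2_comult_left: "t \<in> carrier VV \<Longrightarrow> comult_left K S (f2 t) = f3 (comult_left K B t)"
  unfolding comult_left_def
  by (rule tensor_map_square[OF mods(1,1) smods(1,1) mods(2,1) smods(2,1) f_lin f_lin S_comult_lin lin_hom_id
      comult_linear lin_hom_id f2_lin f_lin f_comult refl])

lemma f2_comult_right:
  assumes t: "t \<in> carrier VV"
  shows "comult_right K S (f2 t) = f3 (comult_right K B t)"
proof -
  have "tensor_map K S S S SS (\<lambda>x. x) (comult S) (f2 t) = f3' (tensor_map K B B B VV (\<lambda>x. x) (comult B) t)"
    by (rule tensor_map_square[OF mods(1,1) smods(1,1) mods(1,2) smods(1,2) f_lin f_lin lin_hom_id S_comult_lin
      lin_hom_id comult_linear f_lin f2_lin refl f_comult t])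
  then show ?thesis
    unfolding comult_right_def
    by (simp add: f3_assoc_inv lin_hom_closed[OF tensor_map_lin[OF mods(1,1,1,2) lin_hom_id comult_linear] t])
qed

lemma f2_comult_comult:
  "t \<in> carrier VV \<Longrightarrow> tensor_map K S S SS SS (comult S) (comult S) (f2 t) =
    f4 (tensor_map K B B VV VV (comult B) (comult B) t)"
  by (rule tensor_map_square[OF mods(1,1) smods(1,1) mods(2,2) smods(2,2) f_lin f_lin S_comult_lin S_comult_lin
      comult_linear comult_linear f2_lin f2_lin f_comult f_comult])

lemma counit_closed: "x \<in> carrier B \<Longrightarrow> counit B x \<in> carrier K"
  using lin_hom_closed[OF counit_linear] by (simp add: scalars_def)

lemma f2_counit:
  assumes t: "t \<in> carrier VV"
  shows "counit_left K S (f2 t) = f (counit_left K B t)" and "counit_right K S (f2 t) = f (counit_right K B t)"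
proof -
  note b = bilinear_scalar_form[OF mods(1) counit_linear] and bS = bilinear_scalar_form[OF smods(1) S_counit_lin]
  note l = tensor_lift_lin[OF mods(1,1,1) b(1)] tensor_lift_lin[OF mods(1,1,1) b(2)]
    tensor_lift_lin[OF smods(1,1,1) bS(1)] tensor_lift_lin[OF smods(1,1,1) bS(2)]
  show "counit_left K S (f2 t) = f (counit_left K B t)"
    unfolding counit_left_def
    by (rule lin_hom_tensor_eqI[OF mods(1,1) smods(1) lin_hom_comp[OF f2_lin l(3)] lin_hom_comp[OF l(1) f_lin] _ t])
      (simp add: f2_pure tensor_lift_pure[OF mods(1,1,1) b(1)] tensor_lift_pure[OF smods(1,1,1) bS(1)]
        lin_hom_closed[OF f_lin] f_counit lin_hom_smult[OF f_lin] counit_closed)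
  show "counit_right K S (f2 t) = f (counit_right K B t)"
    unfolding counit_right_def
    by (rule lin_hom_tensor_eqI[OF mods(1,1) smods(1) lin_hom_comp[OF f2_lin l(4)] lin_hom_comp[OF l(2) f_lin] _ t])
      (simp add: f2_pure tensor_lift_pure[OF mods(1,1,1) b(2)] tensor_lift_pure[OF smods(1,1,1) bS(2)]
        lin_hom_closed[OF f_lin] f_counit lin_hom_smult[OF f_lin] counit_closed)
qed

lemma S_braided_coalgebra: "braided_coalgebra K S"
proof (intro braided_coalgebra.intro braided_coalgebra_axioms.intro)
  show "braided_vector_space K S" by (rule S_braided_vector_space)
  show "comult S \<in> lin_hom K S SS" by (rule S_comult_lin)
  show "counit S \<in> lin_hom K S (scalars K)" by (rule S_counit_lin)
next
  fix x assume "x \<in> carrier S"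
  then obtain u where u: "u \<in> carrier B" "x = f u" by (rule S_obtain)
  note c = comult_closed[OF u(1)]
  show "comult_left K S (comult S x) = comult_right K S (comult S x)"
    using u coassociative[OF u(1)] by (simp add: f_comult f2_comult_left f2_comult_right c)
  show "counit_left K S (comult S x) = x"
    using u counital_left[OF u(1)] by (simp add: f_comult f2_counit c)
  show "counit_right K S (comult S x) = x"
    using u counital_right[OF u(1)] by (simp add: f_comult f2_counit c)
next
  fix t assume "t \<in> carrier SS"
  then obtain s where s: "s \<in> carrier VV" "t = f2 s" by (rule SS_obtain)
  note c = braiding_closed[OF s(1)] lin_hom_closed[OF braid_left_lin] lin_hom_closed[OF braid_right_lin]
  have cl: "comult_left K B s \<in> carrier VVV"
    unfolding comult_left_def by (rule lin_hom_closed[OF tensor_map_lin[OF mods(1,1,2,1) comult_linear lin_hom_id] s(1)])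
  have cr: "comult_right K B s \<in> carrier VVV"
    unfolding comult_right_def
    by (rule lin_hom_closed[OF assoc_inv_lin
          lin_hom_closed[OF tensor_map_lin[OF mods(1,1,1,2) lin_hom_id comult_linear] s(1)]])
  show "comult_left K S (braiding S t) = braid_right K S (braid_left K S (comult_right K S t))"
    using s comult_left_braiding[OF s(1)]
    by (simp add: f_braiding f2_comult_left f2_comult_right f3_braid_left f3_braid_right c cl cr)
  show "comult_right K S (braiding S t) = braid_left K S (braid_right K S (comult_left K S t))"
    using s comult_right_braiding[OF s(1)]
    by (simp add: f_braiding f2_comult_left f2_comult_right f3_braid_left f3_braid_right c cl cr)
  show "counit_left K S (braiding S t) = counit_right K S t"
    using s counit_left_braiding[OF s(1)] by (simp add: f_braiding f2_counit c)
  show "counit_right K S (braiding S t) = counit_left K S t"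
    using s counit_right_braiding[OF s(1)] by (simp add: f_braiding f2_counit c)
qed

lemma S_braided_bialgebra: "braided_bialgebra K S"
proof (intro braided_bialgebra.intro braided_bialgebra_axioms.intro)
  show "braided_algebra K S" by (rule S_braided_algebra)
  show "braided_coalgebra K S" by (rule S_braided_coalgebra)
  have one: "\<one>\<^bsub>S\<^esub> = f \<one>\<^bsub>B\<^esub>" using ring_hom_one[OF f_ring_hom] by simp
  show "comult S \<one>\<^bsub>S\<^esub> = pure_tensor K S S \<one>\<^bsub>S\<^esub> \<one>\<^bsub>S\<^esub>"
    by (simp add: one f_comult comult_one f2_pure)
  show "counit S \<in> ring_hom S K"
  proof (rule ring_hom_memI)
    fix x y assume x: "x \<in> carrier S" and y: "y \<in> carrier S"
    obtain u where u: "u \<in> carrier B" "x = f u" using x by (rule S_obtain)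
    obtain v where v: "v \<in> carrier B" "y = f v" using y by (rule S_obtain)
    show "counit S x \<in> carrier K" using u by (simp add: f_counit counit_closed)
    show "counit S (x \<otimes>\<^bsub>S\<^esub> y) = counit S x \<otimes>\<^bsub>K\<^esub> counit S y"
      using u v by (simp add: ring_hom_mult[OF f_ring_hom, symmetric] f_counit ring_hom_mult[OF counit_algebra_map])
    show "counit S (x \<oplus>\<^bsub>S\<^esub> y) = counit S x \<oplus>\<^bsub>K\<^esub> counit S y"
      using u v by (simp add: ring_hom_add[OF f_ring_hom, symmetric] f_counit ring_hom_add[OF counit_algebra_map])
  next
    show "counit S \<one>\<^bsub>S\<^esub> = \<one>\<^bsub>K\<^esub>" by (simp add: one f_counit ring_hom_one[OF counit_algebra_map])
  qed
  fix t assume "t \<in> carrier SS"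
  then obtain s where s: "s \<in> carrier VV" "t = f2 s" by (rule SS_obtain)
  note d = lin_hom_closed[OF tensor_map_lin[OF mods(1,1,2,2) comult_linear comult_linear] s(1)]
  show "comult S (mult_map K S t) =
      tensor_map K SS SS S S (mult_map K S) (mult_map K S)
        (braid_middle K S (tensor_map K S S SS SS (comult S) (comult S) t))"
    using s comult_mult[OF s(1)]
    by (simp add: f2_mult f_comult f2_comult_comult f4_braid_middle f4_mult d lin_hom_closed[OF mult_lin]
        lin_hom_closed[OF braid_middle_lin])
qed

end

lemma (in cring) scalars_module: "module R (scalars R)"
proof (rule moduleI[OF is_cring abelian_groupI])
  show "\<exists>y\<in>carrier (scalars R). y \<oplus>\<^bsub>scalars R\<^esub> x = \<zero>\<^bsub>scalars R\<^esub>" if "x \<in> carrier (scalars R)" for x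
    using that l_neg[of x] by (intro bexI[of _ "\<ominus> x"]) (auto simp: scalars_def)
qed (simp_all add: scalars_def l_distr r_distr m_assoc a_ac)

text \<open>A bialgebra map sends primitives to primitives, so the composite lands in the
  infinitesimal part of the target; surjectivity carries generation along.\<close>

lemma vc_bialgebra_surjection:
  assumes "braided_bialgebra_surjection K B S f" and "vc_bialgebra K V B \<gamma>"
  shows "vc_bialgebra K V S (\<lambda>v. f (\<gamma> v))"
proof -
  interpret f: braided_bialgebra_surjection K B S f by fact
  interpret vc: vc_bialgebra K V B \<gamma> by fact
  interpret S: braided_bialgebra K S by (rule f.S_braided_bialgebra)
  let ?\<delta> = "\<lambda>v. f (\<gamma> v)"
  let ?Q = "S\<lparr>carrier := primitives K S\<rparr>"
  have same: "same_vector_space (infinitesimal_part K S) ?Q"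
    by (simp add: same_vector_space_def infinitesimal_part_def)
  have lin: "?\<delta> \<in> lin_hom K V S" by (rule lin_hom_comp[OF vc.gamma_lin f.f_lin])
  have prim: "f x \<in> primitives K S" if x: "x \<in> primitives K B" for x
  proof -
    have xc: "x \<in> carrier B" by (rule f.primitives_closed[OF x])
    have "comult S (f x) = tensor_map K B B S S f f (comult B x)" by (rule f.f_comult[OF xc])
    also have "\<dots> = pure_tensor K S S (f x) (f \<one>\<^bsub>B\<^esub>) \<oplus>\<^bsub>tensor K S S\<^esub> pure_tensor K S S (f \<one>\<^bsub>B\<^esub>) (f x)"
      using x xc by (simp add: primitives_def lin_hom_add[OF f.f2_lin] f.f2_pure)
    finally show ?thesis
      using lin_hom_closed[OF f.f_lin xc] by (simp add: primitives_def ring_hom_one[OF f.f_ring_hom])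
  qed
  have linQ: "?\<delta> \<in> lin_hom K V ?Q"
    by (rule lin_hom_corestrict[OF lin]) (rule prim[OF vc.gamma_primitive])
  have hom: "?\<delta> \<in> braided_hom K V (infinitesimal_part K S)"
  proof -
    note Q = submodule_module[OF S.mods(1) S.primitives_submodule]
    note i = submodule_incl_lin[OF S.mods(1) S.primitives_submodule]
    let ?i = "tensor_map K ?Q ?Q S S (\<lambda>x. x) (\<lambda>x. x)" and ?d = "tensor_map K V V ?Q ?Q ?\<delta> ?\<delta>"
    note dl = f.tensor_map_lin[OF vc.V.mods(1,1) Q Q linQ linQ]
    have comp: "?i (?d s) = tensor_map K V V S S ?\<delta> ?\<delta> s" if "s \<in> carrier (tensor K V V)" for s
      by (rule f.tensor_map_comp[OF vc.V.mods(1,1) Q Q S.mods(1,1) linQ linQ i i that])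
    have comp': "tensor_map K B B S S f f (tensor_map K V V B B \<gamma> \<gamma> s) = tensor_map K V V S S ?\<delta> ?\<delta> s"
      if "s \<in> carrier (tensor K V V)" for s
      by (rule f.tensor_map_comp[OF vc.V.mods(1,1) f.mods(1,1) S.mods(1,1) vc.gamma_lin vc.gamma_lin f.f_lin f.f_lin that])
    \<comment> \<open>Equality in the tensor square of the primitives is tested in S \<otimes> S,
      where the embedding is injective; there both sides are f \<otimes> f applied to the braiding
      identity for \<gamma>.\<close>
    have "braiding_on K S (primitives K S) (primitives K S) (?d t) = ?d (braiding V t)"
      if t: "t \<in> carrier (tensor K V V)" for t
    proof (rule inj_onD[OF f.tensor_sub_incl_inj[OF S.mods(1,1) S.primitives_submodule S.primitives_submodule]])
      note bo = S.braiding_on_incl[OF S.primitives_submodule S.primitives_submodule S.braiding_primitives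
          lin_hom_closed[OF dl t]]
      note ct = vc.V.braiding_closed[OF t]
      show "?i (braiding_on K S (primitives K S) (primitives K S) (?d t)) = ?i (?d (braiding V t))"
        using f.f_braiding[OF lin_hom_closed[OF f.tensor_map_lin[OF vc.V.mods(1,1) f.mods(1,1) vc.gamma_lin vc.gamma_lin] t]]
        by (simp add: bo(2) comp[OF t] comp[OF ct] comp'[OF t] vc.gamma_braiding[OF t] comp'[OF ct])
      show "braiding_on K S (primitives K S) (primitives K S) (?d t) \<in> carrier (tensor K ?Q ?Q)" by (rule bo(1))
      show "?d (braiding V t) \<in> carrier (tensor K ?Q ?Q)" by (rule lin_hom_closed[OF dl ct])
    qed
    then show ?thesis
      using linQ
      by (simp add: braided_hom_def lin_hom_same_vector_space[OF same_vector_space_refl same]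
          tensor_map_same_vector_space[OF same_vector_space_refl same_vector_space_refl same same])
        (simp add: infinitesimal_part_def)
  qed
  have gen: "generated_subalgebra K S (?\<delta> ` carrier V) = carrier S"
  proof
    show "generated_subalgebra K S (?\<delta> ` carrier V) \<subseteq> carrier S"
      unfolding generated_subalgebra_def
      using f.S.carrier_is_subring f.S.carrier_is_submodule lin_hom_closed[OF lin] by blast
    show "carrier S \<subseteq> generated_subalgebra K S (?\<delta> ` carrier V)"
      unfolding generated_subalgebra_def
    proof (rule Inter_greatest)
      fix H assume "H \<in> {H. subring H S \<and> submodule H K S \<and> ?\<delta> ` carrier V \<subseteq> H}"
      then have H: "subring H S" "submodule H K S" "?\<delta> ` carrier V \<subseteq> H" by auto
      \<comment> \<open>The preimage of a subalgebra containing the new generators is a subalgebra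
        of B containing the old ones, hence all of B.\<close>
      define H' where "H' = {x \<in> carrier B. f x \<in> H}"
      have H': "submodule H' K B"
        unfolding H'_def by (rule submodule_preimage[OF f.mods(1) S.mods(1) f.f_lin H(2)])
      have "subring H' B"
        by (rule f.subringI_submodule[OF H'])
          (use subringE(3,6)[OF H(1)] in \<open>auto simp: H'_def ring_hom_one[OF f.f_ring_hom] ring_hom_mult[OF f.f_ring_hom]\<close>)
      moreover have "\<gamma> ` carrier V \<subseteq> H'" using H(3) lin_hom_closed[OF vc.gamma_lin] by (auto simp: H'_def)
      ultimately have "carrier B \<subseteq> H'" using f.generated_subalgebra_eqD[OF vc.gamma_generates _ H'] by blast
      then have "f ` carrier B \<subseteq> H" by (auto simp: H'_def)
      then show "carrier S \<subseteq> H" by (simp add: f.f_surj)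
    qed
  qed
  show ?thesis
    by (intro vc_bialgebra.intro vc_bialgebra_axioms.intro vc.V.braided_vector_space_axioms
        S.braided_bialgebra_axioms hom gen)
qed

text \<open>The maps f and f \<otimes> f are onto and intertwine the structure maps, so every value
  on the target is forced by B. Agreement of the linear structures makes f \<otimes> f literally the
  same map for both targets.\<close>

lemma same_vc_structure_surjection:
  assumes B: "module K B" and S: "module K S" and surj: "f ` carrier B = carrier S"
    and f: "f \<in> vc_bialgebra_hom K V B \<gamma> S \<delta>" and f': "f \<in> vc_bialgebra_hom K V B \<gamma> S' \<delta>'"
    and same: "same_vector_space S' S"
  shows "same_vc_structure K V S \<delta> S' \<delta>'"
proof -
  interpret K: cring K using B by (simp add: module_def)
  have lin: "f \<in> lin_hom K B S" and h: "f \<in> ring_hom B S" and h': "f \<in> ring_hom B S'"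
    using f f' by (auto simp: vc_bialgebra_hom_def braided_bialgebra_hom_def braided_hom_def)
  have S': "tensor_map K B B S' S' = tensor_map K B B S S"
    by (rule tensor_map_same_vector_space[OF same_vector_space_refl same_vector_space_refl same same])
  have mult: "x \<otimes>\<^bsub>S\<^esub> y = x \<otimes>\<^bsub>S'\<^esub> y" if x: "x \<in> carrier S" and y: "y \<in> carrier S" for x y
  proof -
    have "x \<in> f ` carrier B" "y \<in> f ` carrier B" using x y surj by simp_all
    then show ?thesis using ring_hom_mult[OF h] ring_hom_mult[OF h'] by auto
  qed
  have one: "\<one>\<^bsub>S\<^esub> = \<one>\<^bsub>S'\<^esub>" using ring_hom_one[OF h] ring_hom_one[OF h'] by simp
  have co: "comult S x = comult S' x \<and> counit S x = counit S' x" if x: "x \<in> carrier S" for x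
  proof -
    have "x \<in> f ` carrier B" using x surj by simp
    then show ?thesis using f f' by (auto simp: vc_bialgebra_hom_def braided_bialgebra_hom_def S')
  qed
  have br: "braiding S t = braiding S' t" if t: "t \<in> carrier (tensor K S S)" for t
  proof -
    have "t \<in> tensor_map K B B S S f f ` carrier (tensor K B B)"
      using t K.tensor_map_surj[OF B B S S lin lin surj surj] by simp
    then obtain s where s: "s \<in> carrier (tensor K B B)" "t = tensor_map K B B S S f f s" by (elim imageE)
    have "braiding S t = tensor_map K B B S S f f (braiding B s)"
      using f s by (simp add: vc_bialgebra_hom_def braided_bialgebra_hom_def braided_hom_def)
    moreover have "braiding S' t = tensor_map K B B S S f f (braiding B s)"
      using f' s by (simp add: vc_bialgebra_hom_def braided_bialgebra_hom_def braided_hom_def S')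
    ultimately show ?thesis by simp
  qed
  have "\<delta> v = \<delta>' v" if "v \<in> carrier V" for v
    using f f' that by (simp add: vc_bialgebra_hom_def)
  then show ?thesis unfolding same_vc_structure_def using mult one co br by simp
qed

section \<open>The quotient bialgebra\<close>

lemma same_vector_space_module:
  assumes "same_vector_space M N" "module K M"
  shows "module K N"
proof -
  interpret M: module K M by fact
  have eq: "carrier N = carrier M" "zero N = zero M" "add N = add M" "smult N = smult M"
    using assms(1) by (simp_all add: same_vector_space_def)
  show ?thesis
  proof (rule moduleI[OF M.is_cring abelian_groupI])
    show "\<exists>y\<in>carrier N. y \<oplus>\<^bsub>N\<^esub> x = \<zero>\<^bsub>N\<^esub>" if "x \<in> carrier N" for x
      using that by (intro bexI[of _ "\<ominus>\<^bsub>M\<^esub> x"]) (simp_all add: eq M.l_neg)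
  qed (simp_all add: eq M.a_ac M.smult_l_distr M.smult_r_distr M.smult_assoc1)
qed

text \<open>Choosing representatives lets the structure maps of the quotient be written down for any
  subset \<open>N\<close>; independence of the choice is a property proved afterwards.\<close>

definition quotient_rep :: "('k, 'a, 'm) module_scheme \<Rightarrow> 'a set \<Rightarrow> 'a set \<Rightarrow> 'a"
  where "quotient_rep M N X = (SOME x. x \<in> carrier M \<and> X = N +>\<^bsub>M\<^esub> x)"

lemma quotient_rep:
  assumes "X \<in> carrier (quotient_module M N)"
  shows "quotient_rep M N X \<in> carrier M" and "N +>\<^bsub>M\<^esub> quotient_rep M N X = X"
proof -
  have "\<exists>x. x \<in> carrier M \<and> X = N +>\<^bsub>M\<^esub> x" using quotient_module_carrierE[OF assms] by blast
  then have "quotient_rep M N X \<in> carrier M \<and> X = N +>\<^bsub>M\<^esub> quotient_rep M N X"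
    unfolding quotient_rep_def by (rule someI_ex)
  then show "quotient_rep M N X \<in> carrier M" and "N +>\<^bsub>M\<^esub> quotient_rep M N X = X" by auto
qed

text \<open>Where \<open>f\<close> kills \<open>N\<close>, evaluation at the chosen representative
  agrees on the carrier with the map induced on the quotient.\<close>

lemma quotient_rep_lift:
  assumes M: "module K M" and N: "submodule N K M" and L: "module K L"
    and f: "f \<in> lin_hom K M L" and null: "\<And>x. x \<in> N \<Longrightarrow> f x = \<zero>\<^bsub>L\<^esub>"
  shows "(\<lambda>X. f (quotient_rep M N X)) \<in> lin_hom K (quotient_module M N) L"
    and "x \<in> carrier M \<Longrightarrow> f (quotient_rep M N (N +>\<^bsub>M\<^esub> x)) = f x"
proof -
  obtain h where h: "h \<in> lin_hom K (quotient_module M N) L"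
    "\<And>x. x \<in> carrier M \<Longrightarrow> h (N +>\<^bsub>M\<^esub> x) = f x"
    using quotient_module_lift[OF M N L f null] by blast
  have eq: "f (quotient_rep M N X) = h X" if "X \<in> carrier (quotient_module M N)" for X
    using h(2)[OF quotient_rep(1)[OF that]] quotient_rep(2)[OF that] by simp
  show "(\<lambda>X. f (quotient_rep M N X)) \<in> lin_hom K (quotient_module M N) L"
    by (rule lin_hom_cong[OF quotient_module_is_module[OF M N] h(1) eq])
  show "f (quotient_rep M N (N +>\<^bsub>M\<^esub> x)) = f x" if "x \<in> carrier M"
    using eq[OF coset_closed[OF that]] h(2)[OF that] by simp
qed

text \<open>An explicit record whose linear and ring parts are copied from the quotient, so that
  truncation returns it literally. The braiding is the lift of a form in two representatives; it and
  the coalgebra maps acquire meaning only from the stability of \<open>I\<close> under them.\<close>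

definition quotient_bialgebra ::
  "('k, 'r) ring_scheme \<Rightarrow> ('k, 'b, 'm) braided_bialg_scheme \<Rightarrow> 'b set \<Rightarrow> ('k, 'b set) braided_bialg"
  where "quotient_bialgebra K B I =
    (let W = quotient_module B I; r = quotient_rep B I;
         p = tensor_map K B B W W (\<lambda>x. I +>\<^bsub>B\<^esub> x) (\<lambda>x. I +>\<^bsub>B\<^esub> x) in
      \<lparr>carrier = carrier W, mult = mult W, one = one W, zero = zero W, add = add W, smult = smult W,
       braiding = tensor_lift K W W (tensor K W W) (\<lambda>X Y. p (braiding B (pure_tensor K B B (r X) (r Y)))),
       comult = (\<lambda>X. p (comult B (r X))), counit = (\<lambda>X. counit B (r X))\<rparr>)"

lemma quotient_bialgebra_same: "same_vector_space (quotient_bialgebra K B I) (quotient_module B I)"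
  by (simp add: quotient_bialgebra_def Let_def same_vector_space_def)

lemma quotient_bialgebra_truncate: "module.truncate (quotient_bialgebra K B I) = quotient_module B I"
  by (simp add: quotient_bialgebra_def Let_def module.truncate_def)

lemma coset_null:
  assumes "module K M" "submodule N K M" "x \<in> N"
  shows "N +>\<^bsub>M\<^esub> x = N"
proof -
  interpret N: abelian_subgroup N M by (rule submodule_abelian_subgroup) fact+
  show ?thesis using assms(3) by (intro N.a_coset_join2) (auto simp: N.a_subgroup)
qed

section \<open>Descent of the structure maps to the quotient\<close>

context vc_bialgebra_section
begin

abbreviation "W \<equiv> quotient_module B I"
abbreviation "S \<equiv> quotient_bialgebra K B I"
abbreviation "\<pi> \<equiv> \<lambda>x. I +>\<^bsub>B\<^esub> x"
abbreviation "\<pi>2 \<equiv> tensor_map K B B S S \<pi> \<pi>"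
abbreviation "r \<equiv> quotient_rep B I"

lemma S_module: "module K S"
proof -
  have "same_vector_space W S" using quotient_bialgebra_same[of K B I] by (simp add: same_vector_space_def)
  then show ?thesis by (rule same_vector_space_module) (rule quotient_module_is_module[OF B.mods(1) I_submodule])
qed

text \<open>The body of \<open>quotient_bialgebra\<close> can refer only to the plain quotient
  \<open>W\<close>, whereas the axioms speak of \<open>S\<close>. These identifications move between
  the two.\<close>

lemma S_lin_hom: "lin_hom K B S = lin_hom K B W" "lin_hom K S L = lin_hom K W L"
  by (rule lin_hom_same_vector_space[OF same_vector_space_refl quotient_bialgebra_same],
      rule lin_hom_same_vector_space[OF quotient_bialgebra_same same_vector_space_refl])

lemma S_tensor: "tensor K W W = tensor K S S"
  by (rule tensor_same_vector_space(1)[OF quotient_bialgebra_same quotient_bialgebra_same, symmetric])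

lemma S_tensor_map: "tensor_map K B B W W = tensor_map K B B S S"
  by (rule tensor_map_same_vector_space[OF same_vector_space_refl same_vector_space_refl
      quotient_bialgebra_same quotient_bialgebra_same, symmetric])

lemma S_tensor_lift: "tensor_lift K W W L = tensor_lift K S S L"
  by (rule tensor_lift_same_vector_space[OF quotient_bialgebra_same quotient_bialgebra_same
      same_vector_space_refl, symmetric])

lemma S_braiding: "braiding S =
    tensor_lift K S S (tensor K S S) (\<lambda>X Y. \<pi>2 (braiding B (pure_tensor K B B (r X) (r Y))))"
  unfolding S_tensor_map[symmetric] S_tensor_lift[symmetric] S_tensor[symmetric]
  by (simp add: quotient_bialgebra_def Let_def)

lemma S_comult: "comult S = (\<lambda>X. \<pi>2 (comult B (r X)))"
  unfolding S_tensor_map[symmetric] by (simp add: quotient_bialgebra_def Let_def)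

lemma S_counit: "counit S = (\<lambda>X. counit B (r X))"
  by (simp add: quotient_bialgebra_def Let_def)

lemma S_carrier: "carrier S = carrier W"
  by (simp add: quotient_bialgebra_def Let_def)

lemma pi_lin: "\<pi> \<in> lin_hom K B S"
  unfolding S_lin_hom by (rule coset_lin_hom[OF B.mods(1) I_submodule])

lemma pi_surj: "\<pi> ` carrier B = carrier S"
  by (auto simp: S_carrier A_RCOSETS_def')

lemma S_ring: "ring S"
proof -
  interpret Q: ring "B Quot I" by (rule ideal.quotient_is_ring[OF I_ideal])
  have eq: "carrier S = carrier (B Quot I)" "add S = add (B Quot I)" "mult S = mult (B Quot I)"
    "one S = one (B Quot I)"
    by (simp_all add: quotient_bialgebra_def Let_def FactRing_def)
  show ?thesis
  proof (rule ringI)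
    show "abelian_group S" using S_module by (simp add: module_def)
    show "monoid S" by (rule monoidI) (simp_all add: eq Q.m_assoc)
  qed (simp_all add: eq Q.l_distr Q.r_distr)
qed

lemma pi_ring_hom: "\<pi> \<in> ring_hom B S"
  using ideal.rcos_ring_hom[OF I_ideal]
  by (simp add: quotient_bialgebra_def Let_def ring_hom_def FactRing_def)

lemma pi_null: "x \<in> I \<Longrightarrow> \<pi> x = \<zero>\<^bsub>S\<^esub>"
  using coset_null[OF B.mods(1) I_submodule] by (simp add: quotient_bialgebra_def Let_def)

lemma pi2_lin: "\<pi>2 \<in> lin_hom K (tensor K B B) (tensor K S S)"
  by (rule V.tensor_map_lin[OF B.mods(1,1) S_module S_module pi_lin pi_lin])

text \<open>A factor from the ideal becomes zero under \<pi>, and tensoring with zero gives zero.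
  This is the form in which stability of the ideal enters the descent of braiding and
  comultiplication.\<close>

lemma pi2_null:
  assumes "t \<in> tensor_sub K B B I (carrier B) \<or> t \<in> tensor_sub K B B (carrier B) I"
  shows "\<pi>2 t = \<zero>\<^bsub>tensor K S S\<^esub>"
proof -
  note SS = V.tensor_is_module[OF S_module S_module]
  interpret SS: module K "tensor K S S" by (rule SS)
  interpret S: module K S by (rule S_module)
  have z: "submodule {\<zero>\<^bsub>tensor K S S\<^esub>} K (tensor K S S)" by (rule SS.submoduleI) auto
  have z1: "pure_tensor K S S \<zero>\<^bsub>S\<^esub> y = \<zero>\<^bsub>tensor K S S\<^esub>" if "y \<in> carrier S" for y
    by (rule lin_hom_zero[OF S_module SS V.pure_tensor_lin_left[OF S_module S_module that]])
  have z2: "pure_tensor K S S y \<zero>\<^bsub>S\<^esub> = \<zero>\<^bsub>tensor K S S\<^esub>" if "y \<in> carrier S" for y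
    by (rule lin_hom_zero[OF S_module SS V.pure_tensor_lin_right[OF S_module S_module that]])
  note Ic = B.submoduleE(1)[OF I_submodule, THEN subsetD]
  have pure: "\<pi>2 (pure_tensor K B B x y) = pure_tensor K S S (\<pi> x) (\<pi> y)" if "x \<in> carrier B" "y \<in> carrier B" for x y
    by (rule V.tensor_map_pure[OF B.mods(1,1) S_module S_module pi_lin pi_lin that])
  from assms have "\<pi>2 t \<in> {\<zero>\<^bsub>tensor K S S\<^esub>}"
  proof
    assume t: "t \<in> tensor_sub K B B I (carrier B)"
    show ?thesis
      by (rule V.tensor_sub_image_into[OF B.mods(1,1) SS I_submodule B.carrier_is_submodule pi2_lin z _ t])
        (simp add: pure Ic pi_null z1 lin_hom_closed[OF pi_lin])
  next
    assume t: "t \<in> tensor_sub K B B (carrier B) I"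
    show ?thesis
      by (rule V.tensor_sub_image_into[OF B.mods(1,1) SS B.carrier_is_submodule I_submodule pi2_lin z _ t])
        (simp add: pure Ic pi_null z2 lin_hom_closed[OF pi_lin])
  qed
  then show ?thesis by simp
qed

lemma rep_closed: "X \<in> carrier S \<Longrightarrow> r X \<in> carrier B"
  unfolding S_carrier by (rule quotient_rep(1))

lemma rep_lift:
  assumes "module K L" "f \<in> lin_hom K B L" "\<And>x. x \<in> I \<Longrightarrow> f x = \<zero>\<^bsub>L\<^esub>"
  shows "(\<lambda>X. f (r X)) \<in> lin_hom K S L" and "x \<in> carrier B \<Longrightarrow> f (r (\<pi> x)) = f x"
proof -
  show "(\<lambda>X. f (r X)) \<in> lin_hom K S L"
    unfolding S_lin_hom by (rule quotient_rep_lift(1)[OF B.mods(1) I_submodule assms])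
  show "f (r (\<pi> x)) = f x" if "x \<in> carrier B"
    by (rule quotient_rep_lift(2)[OF B.mods(1) I_submodule assms that])
qed

text \<open>Each slot descends separately: with one argument fixed, the braiding followed by \<pi>
  \<otimes> \<pi> kills the ideal in the other, by \<open>braiding_I_left\<close> or
  \<open>braiding_I_right\<close>.\<close>

lemma S_braiding_props:
  shows "braiding S \<in> lin_hom K (tensor K S S) (tensor K S S)"
    and "t \<in> carrier (tensor K B B) \<Longrightarrow> braiding S (\<pi>2 t) = \<pi>2 (braiding B t)"
proof -
  note SS = V.tensor_is_module[OF S_module S_module]
  let ?c = "\<lambda>x y. \<pi>2 (braiding B (pure_tensor K B B x y))"
  have left: "(\<lambda>x. ?c x y) \<in> lin_hom K B (tensor K S S)" if "y \<in> carrier B" for y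
    by (rule lin_hom_comp[OF B.braiding_pure_lin_left[OF that] pi2_lin])
  have right: "?c x \<in> lin_hom K B (tensor K S S)" if "x \<in> carrier B" for x
    by (rule lin_hom_comp[OF B.braiding_pure_lin_right[OF that] pi2_lin])
  have left_null: "?c x y = \<zero>\<^bsub>tensor K S S\<^esub>" if "x \<in> I" "y \<in> carrier B" for x y
    using pi2_null braiding_I_left[OF that] by blast
  have right_null: "?c x y = \<zero>\<^bsub>tensor K S S\<^esub>" if "y \<in> I" "x \<in> carrier B" for x y
    using pi2_null braiding_I_right[OF that] by blast
  have bil: "bilinear K S S (tensor K S S) (\<lambda>X Y. ?c (r X) (r Y))"
  proof (rule bilinearI)
    show "(\<lambda>Y. ?c (r X) (r Y)) \<in> lin_hom K S (tensor K S S)" if "X \<in> carrier S" for X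
      by (rule rep_lift(1)[OF SS right[OF rep_closed[OF that]]]) (rule right_null[OF _ rep_closed[OF that]])
    show "(\<lambda>X. ?c (r X) (r Y)) \<in> lin_hom K S (tensor K S S)" if "Y \<in> carrier S" for Y
      by (rule rep_lift(1)[OF SS left[OF rep_closed[OF that]]]) (rule left_null[OF _ rep_closed[OF that]])
  qed
  show lin: "braiding S \<in> lin_hom K (tensor K S S) (tensor K S S)"
    unfolding S_braiding by (rule V.tensor_lift_lin[OF S_module S_module SS bil])
  show "braiding S (\<pi>2 t) = \<pi>2 (braiding B t)" if t: "t \<in> carrier (tensor K B B)"
  proof (rule V.lin_hom_tensor_eqI[OF B.mods(1,1) SS lin_hom_comp[OF pi2_lin lin]
        lin_hom_comp[OF B.braiding_linear pi2_lin] _ t])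
    fix x y assume x: "x \<in> carrier B" and y: "y \<in> carrier B"
    have c: "\<pi> x \<in> carrier S" "\<pi> y \<in> carrier S" using x y lin_hom_closed[OF pi_lin] by blast+
    have "braiding S (\<pi>2 (pure_tensor K B B x y)) = ?c (r (\<pi> x)) (r (\<pi> y))"
      unfolding V.tensor_map_pure[OF B.mods(1,1) S_module S_module pi_lin pi_lin x y] S_braiding
      by (rule V.tensor_lift_pure[OF S_module S_module SS bil c])
    \<comment> \<open>Representatives are removed one slot at a time; here the second argument is
      still the chosen one.\<close>
    also have "\<dots> = ?c x (r (\<pi> y))"
      by (rule rep_lift(2)[OF SS left[OF rep_closed[OF c(2)]] left_null[OF _ rep_closed[OF c(2)]] x])
    also have "\<dots> = ?c x y"
      by (rule rep_lift(2)[OF SS right[OF x] right_null[OF _ x] y])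
    finally show "braiding S (\<pi>2 (pure_tensor K B B x y)) = ?c x y" .
  qed
qed

lemma pi_algebra_surjection: "braided_algebra_surjection K B S \<pi>"
  by (intro braided_algebra_surjection.intro braided_algebra_surjection_axioms.intro
      B.braided_algebra_axioms S_module S_ring pi_lin pi_surj pi_ring_hom S_braiding_props)

lemma delta_primitive: "d \<in> D \<Longrightarrow> d \<in> PB"
  using B.submoduleE(3,5)[OF B.primitives_submodule] gamma_primitive b_closed
  by (auto simp: a_minus_def)

text \<open>Counitality applied to x \<otimes> 1 + 1 \<otimes> x gives x = \<epsilon>(x) 1 + x,
  hence \<epsilon>(x) 1 = 0; applying \<epsilon> once more gives \<epsilon>(x) = 0, also when B is
  not known to be nonzero.\<close>

lemma counit_primitive:
  assumes x: "x \<in> PB"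
  shows "counit B x = \<zero>\<^bsub>K\<^esub>"
proof -
  have xc: "x \<in> carrier B" by (rule B.primitives_closed[OF x])
  note b = V.bilinear_scalar_form(1)[OF B.mods(1) B.counit_linear]
  note l = V.tensor_lift_lin[OF B.mods(1,1,1) b]
  have e: "counit B x \<in> carrier K" using lin_hom_closed[OF B.counit_linear xc] by (simp add: scalars_def)
  have e1: "counit B \<one>\<^bsub>B\<^esub> = \<one>\<^bsub>K\<^esub>" by (rule ring_hom_one[OF B.counit_algebra_map])
  have "x = counit_left K B (comult B x)" by (rule B.counital_left[OF xc, symmetric])
  also have "\<dots> = counit B x \<odot>\<^bsub>B\<^esub> \<one>\<^bsub>B\<^esub> \<oplus>\<^bsub>B\<^esub> x"
    using x xc by (simp add: primitives_def counit_left_def lin_hom_add[OF l] V.tensor_lift_pure[OF B.mods(1,1,1) b] e1)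
  finally have "counit B x \<odot>\<^bsub>B\<^esub> \<one>\<^bsub>B\<^esub> = \<zero>\<^bsub>B\<^esub>" using xc e by simp
  then have "counit B (counit B x \<odot>\<^bsub>B\<^esub> \<one>\<^bsub>B\<^esub>) = counit B \<zero>\<^bsub>B\<^esub>" by simp
  moreover have "counit B (counit B x \<odot>\<^bsub>B\<^esub> \<one>\<^bsub>B\<^esub>) = counit B x"
    using lin_hom_smult[OF B.counit_linear e, of "\<one>\<^bsub>B\<^esub>"] e by (simp add: scalars_def e1)
  moreover have "counit B \<zero>\<^bsub>B\<^esub> = \<zero>\<^bsub>K\<^esub>"
    using lin_hom_zero[OF B.mods(1) V.scalars_module B.counit_linear] by (simp add: scalars_def)
  ultimately show ?thesis by simp
qed

text \<open>The counit is an algebra map, so its kernel is an ideal, and D lies in it because its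
  elements are primitive.\<close>

lemma counit_I:
  assumes "x \<in> I"
  shows "counit B x = \<zero>\<^bsub>K\<^esub>"
proof -
  note sc = V.scalars_module
  have e: "counit B x \<in> carrier K" if "x \<in> carrier B" for x
    using lin_hom_closed[OF B.counit_linear that] by (simp add: scalars_def)
  let ?J = "{x \<in> carrier B. counit B x = \<zero>\<^bsub>K\<^esub>}"
  have "submodule ?J K B"
    using submodule_kernel[OF B.mods(1) sc B.counit_linear] by (simp add: scalars_def)
  then have "ideal ?J B"
    by (rule B.submodule_idealI) (simp_all add: ring_hom_mult[OF B.counit_algebra_map] e)
  moreover have "D \<subseteq> ?J"
    using D_subset delta_primitive counit_primitive by blast
  ultimately have "I \<subseteq> ?J" by (rule B.genideal_minimal)
  then show ?thesis using assms by blast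
qed

text \<open>
  Since \<open>S\<close> is already a braided algebra, \<open>\<pi>2 \<circ> comult B\<close> is multiplicative for the braided product
  \<open>\<Phi>\<close> on \<open>S \<otimes> S\<close>; so its kernel is an ideal, and it contains \<open>D\<close>.
\<close>

lemma pi2_comult_I:
  assumes "x \<in> I"
  shows "\<pi>2 (comult B x) = \<zero>\<^bsub>tensor K S S\<^esub>"
proof -
  interpret p: braided_algebra_surjection K B S \<pi> by (rule pi_algebra_surjection)
  interpret SS: module K "tensor K S S" by (rule p.smods)
  let ?d = "\<lambda>x. \<pi>2 (comult B x)"
  have d: "?d \<in> lin_hom K B (tensor K S S)" by (rule lin_hom_comp[OF B.comult_linear pi2_lin])
  let ?J = "{x \<in> carrier B. ?d x = \<zero>\<^bsub>tensor K S S\<^esub>}"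
  note J = submodule_kernel[OF B.mods(1) p.smods(2) d]
  let ?M = "tensor_map K p.SS p.SS S S (mult_map K S) (mult_map K S)"
  note SSSS = V.tensor_is_module[OF p.smods(2,2)]
  \<comment> \<open>The product (m \<otimes> m)(S \<otimes> c \<otimes> S) on S \<otimes> S. Only
    its linearity is used, as it makes a product with a zero factor vanish; associativity plays no
    part.\<close>
  define \<Phi> where "\<Phi> t = ?M (braid_middle K S t)" for t
  have \<Phi>: "\<Phi> \<in> lin_hom K (tensor K p.SS p.SS) p.SS"
  proof -
    interpret Sa: braided_algebra K S by (rule p.S_braided_algebra)
    show ?thesis
      unfolding \<Phi>_def
      by (rule lin_hom_comp[OF Sa.braid_middle_lin V.tensor_map_lin[OF p.smods(2,2,1,1) p.S_mult_lin p.S_mult_lin]])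
  qed
  have mult: "?d (x \<otimes>\<^bsub>B\<^esub> y) = \<Phi> (pure_tensor K p.SS p.SS (?d x) (?d y))"
    if x: "x \<in> carrier B" and y: "y \<in> carrier B" for x y
  proof -
    let ?t = "pure_tensor K (tensor K B B) (tensor K B B) (comult B x) (comult B y)"
    have t: "?t \<in> carrier (tensor K (tensor K B B) (tensor K B B))"
      using x y by (simp add: B.comult_closed)
    have "comult B (x \<otimes>\<^bsub>B\<^esub> y) =
      tensor_map K (tensor K B B) (tensor K B B) B B (mult_map K B) (mult_map K B) (braid_middle K B ?t)"
      using B.comult_mult[of "pure_tensor K B B x y"] x y
      by (simp add: B.mult_pure V.tensor_map_pure B.mods B.comult_linear)
    then have "?d (x \<otimes>\<^bsub>B\<^esub> y) = ?M (p.f4 (braid_middle K B ?t))"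
      using p.f4_mult[OF lin_hom_closed[OF B.braid_middle_lin t]] by simp
    also have "\<dots> = \<Phi> (p.f4 ?t)" using p.f4_braid_middle[OF t] by (simp add: \<Phi>_def)
    also have "p.f4 ?t = pure_tensor K p.SS p.SS (?d x) (?d y)"
      using x y by (intro V.tensor_map_pure B.mods p.smods pi2_lin B.comult_closed)
    finally show ?thesis .
  qed
  have dc: "?d x \<in> carrier p.SS" if "x \<in> carrier B" for x by (rule lin_hom_closed[OF d that])
  have "ideal ?J B"
  proof (rule B.submodule_idealI[OF J])
    fix a x assume a: "a \<in> ?J" and x: "x \<in> carrier B"
    have z1: "pure_tensor K p.SS p.SS (?d x) \<zero>\<^bsub>p.SS\<^esub> = \<zero>\<^bsub>tensor K p.SS p.SS\<^esub>"
      by (rule lin_hom_zero[OF p.smods(2) SSSS V.pure_tensor_lin_right[OF p.smods(2,2) dc[OF x]]])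
    have z2: "pure_tensor K p.SS p.SS \<zero>\<^bsub>p.SS\<^esub> (?d x) = \<zero>\<^bsub>tensor K p.SS p.SS\<^esub>"
      by (rule lin_hom_zero[OF p.smods(2) SSSS V.pure_tensor_lin_left[OF p.smods(2,2) dc[OF x]]])
    note z = lin_hom_zero[OF SSSS p.smods(2) \<Phi>]
    show "x \<otimes>\<^bsub>B\<^esub> a \<in> ?J" using a x by (simp add: mult z1 z)
    show "a \<otimes>\<^bsub>B\<^esub> x \<in> ?J" using a x by (simp add: mult z2 z)
  qed
  \<comment> \<open>For d in D the two summands of d \<otimes> 1 + 1 \<otimes> d each have a factor
    in the ideal, hence vanish under \<pi> \<otimes> \<pi>.\<close>
  moreover have "D \<subseteq> ?J"
  proof
    fix d assume dD: "d \<in> D"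
    have dP: "d \<in> PB" and dI: "d \<in> I" and dc: "d \<in> carrier B"
      using delta_primitive[OF dD] D_subset_I D_subset dD by auto
    have cd: "comult B d = pure_tensor K B B d \<one>\<^bsub>B\<^esub> \<oplus>\<^bsub>tensor K B B\<^esub> pure_tensor K B B \<one>\<^bsub>B\<^esub> d"
      using dP by (simp add: primitives_def)
    have z1: "\<pi>2 (pure_tensor K B B d \<one>\<^bsub>B\<^esub>) = \<zero>\<^bsub>tensor K S S\<^esub>"
      by (rule pi2_null, rule disjI1, rule V.tensor_sub_pure[OF B.mods(1,1) I_submodule B.carrier_is_submodule dI])
        (rule B.one_closed)
    have z2: "\<pi>2 (pure_tensor K B B \<one>\<^bsub>B\<^esub> d) = \<zero>\<^bsub>tensor K S S\<^esub>"
      by (rule pi2_null, rule disjI2, rule V.tensor_sub_pure[OF B.mods(1,1) B.carrier_is_submodule I_submodule _ dI])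
        (rule B.one_closed)
    have "?d d = \<zero>\<^bsub>tensor K S S\<^esub> \<oplus>\<^bsub>tensor K S S\<^esub> \<zero>\<^bsub>tensor K S S\<^esub>"
      unfolding cd using dc by (subst lin_hom_add[OF pi2_lin]) (simp_all add: z1 z2)
    then show "d \<in> ?J" using dc by simp
  qed
  ultimately have "I \<subseteq> ?J" by (rule B.genideal_minimal)
  then show ?thesis using assms by blast
qed

lemma pi_bialgebra_surjection: "braided_bialgebra_surjection K B S \<pi>"
proof (intro braided_bialgebra_surjection.intro braided_bialgebra_surjection_axioms.intro)
  show "braided_algebra_surjection K B S \<pi>" by (rule pi_algebra_surjection)
  show "braided_bialgebra K B" by (rule B.braided_bialgebra_axioms)
  note SS = V.tensor_is_module[OF S_module S_module]
  note d = lin_hom_comp[OF B.comult_linear pi2_lin]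
  show "comult S \<in> lin_hom K S (tensor K S S)"
    unfolding S_comult by (rule rep_lift(1)[OF SS d pi2_comult_I])
  show "comult S (\<pi> x) = \<pi>2 (comult B x)" if "x \<in> carrier B" for x
    unfolding S_comult by (rule rep_lift(2)[OF SS d pi2_comult_I that])
  have null: "counit B x = \<zero>\<^bsub>scalars K\<^esub>" if "x \<in> I" for x
    using counit_I[OF that] by (simp add: scalars_def)
  show "counit S \<in> lin_hom K S (scalars K)"
    unfolding S_counit by (rule rep_lift(1)[OF V.scalars_module B.counit_linear null])
  show "counit S (\<pi> x) = counit B x" if "x \<in> carrier B" for x
    unfolding S_counit by (rule rep_lift(2)[OF V.scalars_module B.counit_linear null that])
qed

lemma pi_vc_hom: "\<pi> \<in> vc_bialgebra_hom K V B \<gamma> S (\<lambda>v. \<pi> (\<gamma> v))"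
proof -
  interpret p: braided_bialgebra_surjection K B S \<pi> by (rule pi_bialgebra_surjection)
  show ?thesis
    unfolding vc_bialgebra_hom_def braided_bialgebra_hom_def braided_hom_def
    using pi_lin pi_ring_hom p.f_braiding p.f_comult p.f_counit by simp
qed

lemma quotient_vc_bialgebra: "vc_bialgebra K V S (\<lambda>v. \<pi> (\<gamma> v))"
  by (rule vc_bialgebra_surjection[OF pi_bialgebra_surjection vc_bialgebra_axioms])

lemma quotient_unique:
  assumes "same_vector_space S' W" "\<pi> \<in> vc_bialgebra_hom K V B \<gamma> S' \<delta>'"
  shows "same_vc_structure K V S (\<lambda>v. \<pi> (\<gamma> v)) S' \<delta>'"
proof (rule same_vc_structure_surjection[OF B.mods(1) S_module pi_surj pi_vc_hom assms(2)])
  show "same_vector_space S' S"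
    using assms(1) quotient_bialgebra_same[of K B I] by (simp add: same_vector_space_def)
qed

end

theorem theorem4p11:
  fixes K :: "('k, 'r) ring_scheme"
    and V :: "('k, 'v) braided_space"
    and B :: "('k, 'b) braided_bialg"
    and \<gamma> :: "'v \<Rightarrow> 'b"
    and b :: "'b \<Rightarrow> 'v"
  assumes "vc_bialgebra K V B \<gamma>"
    and "b \<in> lin_hom K (B\<lparr>carrier := primitives K B\<rparr>) V"
    and "let P = B\<lparr>carrier := primitives K B\<rparr>; G = B\<lparr>carrier := \<gamma> ` carrier V\<rparr> in
      \<forall>t\<in>carrier (tensor K P G).
        braiding_on K B (carrier G) (carrier G)
          (tensor_map K P G G G (\<lambda>x. \<gamma> (b x)) (\<lambda>x. x) t) =
        tensor_map K G P G G (\<lambda>x. x) (\<lambda>x. \<gamma> (b x))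
          (braiding_on K B (carrier P) (carrier G) t)"
    and "let P = B\<lparr>carrier := primitives K B\<rparr>; G = B\<lparr>carrier := \<gamma> ` carrier V\<rparr> in
      \<forall>t\<in>carrier (tensor K G P).
        braiding_on K B (carrier G) (carrier G)
          (tensor_map K G P G G (\<lambda>x. x) (\<lambda>x. \<gamma> (b x)) t) =
        tensor_map K P G G G (\<lambda>x. \<gamma> (b x)) (\<lambda>x. x)
          (braiding_on K B (carrier G) (carrier P) t)"
  shows "let I = Idl\<^bsub>B\<^esub> ((\<lambda>x. x \<ominus>\<^bsub>B\<^esub> \<gamma> (b x)) ` primitives K B);
             W = quotient_module B I;
             \<pi> = (\<lambda>x. I +>\<^bsub>B\<^esub> x) in
    \<exists>(S :: ('k, 'b set) braided_bialg) \<delta>.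
      module.truncate S = W \<and> vc_bialgebra K V S \<delta> \<and> \<pi> \<in> vc_bialgebra_hom K V B \<gamma> S \<delta> \<and>
      (\<forall>(S' :: ('k, 'b set) braided_bialg) \<delta>'.
        same_vector_space S' W \<and> vc_bialgebra K V S' \<delta>' \<and> \<pi> \<in> vc_bialgebra_hom K V B \<gamma> S' \<delta>'
          \<longrightarrow> same_vc_structure K V S \<delta> S' \<delta>')"
proof -
  interpret vc_bialgebra_section K V B \<gamma> b
    using assms(2-4) by (intro vc_bialgebra_section.intro vc_bialgebra_section_axioms.intro assms(1))
      (simp_all add: Let_def)
  \<comment> \<open>The map \<pi> \<gamma> is the only possible choice on \<open>carrier V\<close>,
    since a morphism of (V,c)-bialgebras must carry \<gamma> to the structure map of its
    target.\<close>
  show ?thesis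
    unfolding Let_def
    using quotient_bialgebra_truncate[of K B I] quotient_vc_bialgebra pi_vc_hom quotient_unique
    by (intro exI[of _ S] exI[of _ "\<lambda>v. \<pi> (\<gamma> v)"]) blast
qed

end
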